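(* Let $q\in\{3,4\}$ and let $d$ be an integer with $d\ge 2$ if $q=3$ and $d\ge 4$ if $q=4$. Let $w$ be a real number with $1-\frac{q}{d+1}\le w<1$ and $w>0$. Then the $q$-state Potts model with weight (interaction parameter) $w$ on the infinite $(d+1)$-regular tree $\mathbb{T}_d$ has a unique Gibbs measure.
   Context: Let $[q]=\{1,\dots,q\}$. For a finite graph $H$ and a configuration $\sigma:V(H)\to[q]$, the weight of $\sigma$ is $w^{m(\sigma)}$, where $m(\sigma)$ is the number of monochromatic edges of $H$ under $\sigma$. Let $\mathbb{T}_d$ be the infinite $(d+1)$-regular tree with vertex set $V_d$, and let $\Omega_{q,d}$ be the set of all maps $\psi:V_d\to[q]$, equipped with the sigma algebra generated by the sets $\{\psi\in\Omega_{q,d}: \psi\restriction_U=\phi\}$ with $U\subset V_d$ finite and $\phi:U\to[q]$. For $U\subset V_d$, let $\partial U$ be the set of vertices of $U$ adjacent to some vertex of $V_d\setminus U$, and $U^\circ=U\setminus\partial U$. A probability measure $\mu$ on $\Omega_{q,d}$ is a Gibbs measure (for the $q$-state Potts model with parameter $w$) if for every finite $U\subset V_d$ and $\mu$-almost every $\phi\in\Omega_{q,d}$, $$\mathbb{P}_{\mathbf{\Phi}\sim\mu}[\mathbf{\Phi}\restriction_U=\phi\restriction_U \mid \mathbf{\Phi}\restriction_{V_d\setminus U^\circ}=\phi\restriction_{V_d\setminus U^\circ}]=\mathbb{P}_U[\mathbf{\Phi}\restriction_U=\phi\restriction_U\mid \mathbf{\Phi}\restriction_{\partial U}=\phi\restriction_{\partial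 U}],$$ where the left-hand side is understood via conditional expectation, and the right-hand side is the weight of $\phi\restriction_U$ on the finite induced graph $\mathbb{T}_d[U]$ divided by the sum of the weights of all colorings $U\to[q]$ that agree with $\phi$ on $\partial U$. *)

theory Defs
  imports "HOL-Probability.Probability"
begin

text \<open>Simple graphs are given by a vertex set \<open>V\<close> and a set \<open>E\<close> of two-element subsets of \<open>V\<close>.\<close>

definition simple_graph :: "'a set \<Rightarrow> 'a set set \<Rightarrow> bool" where
  "simple_graph V E \<longleftrightarrow> (\<forall>e\<in>E. e \<subseteq> V \<and> card e = 2)"

definition walk :: "'a set \<Rightarrow> 'a set set \<Rightarrow> 'a list \<Rightarrow> bool" where
  "walk V E xs \<longleftrightarrow> xs \<noteq> [] \<and> set xs \<subseteq> V \<and> successively (\<lambda>u v. {u, v} \<in> E) xs"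

definition connected_graph :: "'a set \<Rightarrow> 'a set set \<Rightarrow> bool" where
  "connected_graph V E \<longleftrightarrow>
     V \<noteq> {} \<and> (\<forall>u\<in>V. \<forall>v\<in>V. \<exists>xs. walk V E xs \<and> hd xs = u \<and> last xs = v)"

text \<open>The closing edge of a cycle joins its last vertex to its first one.\<close>

definition graph_cycle :: "'a set \<Rightarrow> 'a set set \<Rightarrow> 'a list \<Rightarrow> bool" where
  "graph_cycle V E xs \<longleftrightarrow>
     walk V E xs \<and> distinct xs \<and> length xs \<ge> 3 \<and> {last xs, hd xs} \<in> E"

definition tree_graph :: "'a set \<Rightarrow> 'a set set \<Rightarrow> bool" where
  "tree_graph V E \<longleftrightarrow>
     simple_graph V E \<and> connected_graph V E \<and> (\<nexists>xs. graph_cycle V E xs)"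

text \<open>The infinite \<open>k\<close>-regular tree, specified up to isomorphism. If \<open>k > 0\<close>, the condition
  \<open>card \<dots> = k\<close> also forces the set of neighbours to be finite.\<close>

definition infinite_regular_tree :: "nat \<Rightarrow> 'a set \<Rightarrow> 'a set set \<Rightarrow> bool" where
  "infinite_regular_tree k V E \<longleftrightarrow>
     tree_graph V E \<and> infinite V \<and> (\<forall>v\<in>V. card {u \<in> V. {u, v} \<in> E} = k)"

definition induced_edges :: "'a set set \<Rightarrow> 'a set \<Rightarrow> 'a set set" where
  "induced_edges E U = {e \<in> E. e \<subseteq> U}"

definition bdry :: "'a set \<Rightarrow> 'a set set \<Rightarrow> 'a set \<Rightarrow> 'a set" where
  "bdry V E U = {u \<in> U. \<exists>v \<in> V - U. {u, v} \<in> E}"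

definition inner_part :: "'a set \<Rightarrow> 'a set set \<Rightarrow> 'a set \<Rightarrow> 'a set" where
  "inner_part V E U = U - bdry V E U"

text \<open>A colouring \<open>U \<rightarrow> [q]\<close> is an element of \<open>U \<rightarrow>\<^sub>E {1..q}\<close>, i.e. it is \<open>undefined\<close> outside \<open>U\<close>.\<close>

definition colourings :: "nat \<Rightarrow> 'a set \<Rightarrow> ('a \<Rightarrow> nat) set" where
  "colourings q U = U \<rightarrow>\<^sub>E {1..q}"

definition num_mono :: "'a set set \<Rightarrow> ('a \<Rightarrow> nat) \<Rightarrow> nat" where
  "num_mono F \<sigma> = card {e \<in> F. \<forall>u\<in>e. \<forall>v\<in>e. \<sigma> u = \<sigma> v}"

definition potts_weight :: "real \<Rightarrow> 'a set set \<Rightarrow> ('a \<Rightarrow> nat) \<Rightarrow> real" where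
  "potts_weight w F \<sigma> = w ^ num_mono F \<sigma>"

text \<open>The sigma algebra on \<open>colourings q V\<close> generated by the cylinder sets based on finite subsets
  of \<open>W \<subseteq> V\<close>. For \<open>W = V\<close> it is the sigma algebra on which Gibbs measures live; in general it is
  the one generated by the restriction of a random colouring to \<open>W\<close>. As a measure it carries the
  null measure: only its \<open>space\<close> and \<open>sets\<close> matter.\<close>

definition cylinder_algebra :: "nat \<Rightarrow> 'a set \<Rightarrow> 'a set \<Rightarrow> ('a \<Rightarrow> nat) measure" where
  "cylinder_algebra q V W =
     sigma (colourings q V)
       {{\<psi> \<in> colourings q V. restrict \<psi> U = \<phi>} | U \<phi>.
          finite U \<and> U \<subseteq> W \<and> \<phi> \<in> colourings q U}"

definition finite_cond_prob ::
    "nat \<Rightarrow> real \<Rightarrow> 'a set \<Rightarrow> 'a set set \<Rightarrow> 'a set \<Rightarrow> ('a \<Rightarrow> nat) \<Rightarrow> real" where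
  "finite_cond_prob q w V E U \<phi> =
     potts_weight w (induced_edges E U) (restrict \<phi> U) /
     (\<Sum>\<sigma> | \<sigma> \<in> colourings q U \<and> (\<forall>v \<in> bdry V E U. \<sigma> v = \<phi> v).
        potts_weight w (induced_edges E U) \<sigma>)"

text \<open>The left-hand side of the Gibbs condition is the conditional probability, given the colouring
  outside \<open>inner_part V E U\<close>, of the event \<open>restrict \<psi> U = \<tau>\<close>, evaluated at \<open>\<phi>\<close> with
  \<open>\<tau> = restrict \<phi> U\<close>. Since there are only finitely many \<open>\<tau>\<close>, the choice of a version of each of
  these conditional expectations does not matter.\<close>

definition gibbs_measure ::
    "nat \<Rightarrow> real \<Rightarrow> 'a set \<Rightarrow> 'a set set \<Rightarrow> ('a \<Rightarrow> nat) measure \<Rightarrow> bool" where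
  "gibbs_measure q w V E M \<longleftrightarrow>
     prob_space M \<and>
     sets M = sets (cylinder_algebra q V V) \<and>
     (\<forall>U. finite U \<and> U \<subseteq> V \<longrightarrow>
        (AE \<phi> in M.
           real_cond_exp M (cylinder_algebra q V (V - inner_part V E U))
             (indicat_real {\<psi> \<in> colourings q V. restrict \<psi> U = restrict \<phi> U}) \<phi>
           = finite_cond_prob q w V E U \<phi>))"

end

theory Submission imports Defs begin

text \<open>Root the tree and let \<open>u\<close> be the vector of weights that the subtree below a vertex, with a fixed
  boundary colouring, gives to the colours of that vertex. The vector of a parent is the product over its
  children of the messages \<open>i \<mapsto> (\<Sum>j. u j) - (1 - w) u i\<close>. Uniqueness follows once all ratios
  \<open>u i / u j\<close> tend to \<open>1\<close>, uniformly in the boundary colouring, as the depth grows.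

  This is shown with a Lyapunov function that, in the coordinates \<open>ln (u i)\<close>, is a sum of exponentials of
  linear forms. By convexity its value at a product of \<open>d\<close> messages is at most its largest value at the
  \<open>d\<close>-th power of one message, so it suffices that passing from \<open>u\<close> to the \<open>d\<close>-th power of its message
  decreases the function strictly unless \<open>u\<close> is constant; compactness then gives uniform convergence.

  For \<open>d \<ge> q\<close> the function is \<open>(\<Sum>i. u i powr \<theta>) / (\<Prod>i. u i) powr (\<theta> / q)\<close> with
  \<open>\<theta> = 3 (d + 1) / (2 d)\<close>. For \<open>u\<close> of mean one and the critical \<open>w = 1 - q / (d + 1)\<close>, which is the worst
  case, the message is proportional to \<open>v i = 1 + (1 - u i) / d\<close>, and the decrease is the sum of a one-variable
  comparison of powers and logarithms and of \<open>(\<Sum>i. d ln (v i) - ln (u i)) \<ge> 0\<close>. For \<open>q = 3\<close> and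
  \<open>d = 2\<close> the function is \<open>(\<Sum>i. (u i)\<^sup>3) + (\<Sum>i. u i) (\<Sum>i. (u i)\<^sup>2)\<close> divided by \<open>u 1 u 2 u 3\<close>, and the
  decrease is a polynomial inequality.

  A Gibbs measure is built by broadcasting colours from the root along the edges.\<close>

section \<open>Comparison of powers and logarithms\<close>

text \<open>At the critical \<open>w\<close> a perturbation of a constant vector is, in logarithmic
  coordinates and to first order, only reflected: the multiplier is -1. No linearised contraction is
  available there, so the decrease has to come from higher order terms. With
  \<open>u = 1 + h\<close>, the expressions \<open>u powr \<theta> - \<theta> * ln u\<close> and
  \<open>v powr K - K * ln v\<close>, where \<open>K = \<theta> * d\<close>, have the same quadratic
  term for every \<open>\<theta>\<close>. Their cubic terms differ by a multiple of
  \<open>2 * \<theta> - 3 - 3 / d\<close>, and a nonzero cubic difference would have opposite signs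
  on the two sides of 1. This forces \<open>\<theta> = 3 (d + 1) / (2 d)\<close>, which leaves a
  difference of fourth order.

  The comparison needs \<open>v > 0\<close> up to \<open>u = q\<close>, the supremum of a coordinate
  at mean one, that is \<open>q < d + 1\<close>. For \<open>q = 3\<close> and \<open>d = 2\<close>
  the term \<open>ln v\<close> is unbounded near that endpoint, so no such one-variable comparison
  can hold and a different function is used.\<close>

lemma powr_taylor3:
  fixes b x :: real
  assumes "x > 0" "x \<noteq> 1"
  obtains t where "x < 1 \<Longrightarrow> x < t \<and> t < 1" "x > 1 \<Longrightarrow> 1 < t \<and> t < x"
    "x powr b = 1 + b * (x - 1) + b * (b - 1) / 2 * (x - 1)^2
       + b * (b - 1) * (b - 2) / 6 * t powr (b - 3) * (x - 1)^3"
proof -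
  define diff where "diff m t = (\<Prod>i<m. b - real i) * t powr (b - real m)" for m and t :: real
  have D: "DERIV (diff m) t :> diff (Suc m) t" if "t > 0" for m t
  proof -
    have "DERIV (\<lambda>t. t powr (b - real m)) t :> (b - real m) * t powr (b - real m - 1)"
      using that by (rule has_real_derivative_powr)
    from DERIV_cmult[OF this, of "\<Prod>i<m. b - real i"] show ?thesis
      by (simp add: diff_def[abs_def] algebra_simps)
  qed
  have "\<exists>t. (if x < 1 then x < t \<and> t < 1 else 1 < t \<and> t < x) \<and>
      x powr b = (\<Sum>m<3. diff m 1 / fact m * (x - 1)^m) + diff 3 t / fact 3 * (x - 1)^3"
  proof (rule Taylor[where a = "min x 1" and b = "max x 1"])
    show "diff 0 = (\<lambda>x. x powr b)" by (simp add: diff_def fun_eq_iff)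
    show "\<forall>m t. m < 3 \<and> min x 1 \<le> t \<and> t \<le> max x 1 \<longrightarrow> DERIV (diff m) t :> diff (Suc m) t"
      using D assms by (metis min_def order_less_le_trans zero_less_one)
  qed (use assms in auto)
  then obtain t where t: "if x < 1 then x < t \<and> t < 1 else 1 < t \<and> t < x"
    "x powr b = (\<Sum>m<3. diff m 1 / fact m * (x - 1)^m) + diff 3 t / fact 3 * (x - 1)^3" by blast
  have "(\<Sum>m<3. diff m 1 / fact m * (x - 1)^m) = 1 + b * (x - 1) + b * (b - 1) / 2 * (x - 1)^2"
    by (simp add: diff_def eval_nat_numeral)
  moreover have "diff 3 t / fact 3 = b * (b - 1) * (b - 2) / 6 * t powr (b - 3)"
    by (simp add: diff_def eval_nat_numeral)
  ultimately have eq: "x powr b = 1 + b * (x - 1) + b * (b - 1) / 2 * (x - 1)^2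
       + b * (b - 1) * (b - 2) / 6 * t powr (b - 3) * (x - 1)^3"
    using t(2) by (simp only:)
  show thesis by (rule that[OF _ _ eq]) (use t(1) in simp_all)
qed

text \<open>The exponents are \<open>\<theta> - 1\<close> and \<open>K - 1\<close>, so this is the
  sign of the derivative of the difference studied in \<open>power_log_compare\<close>. Both sides
  agree at 1 through second order in \<open>s = 1 - u\<close>, and only cubic remainders are
  compared: that of the first power has a favourable sign, that of the second is beaten by the tail
  \<open>s^3 / (1 - s)\<close> of the geometric series for \<open>1 / u\<close>.\<close>

lemma pair_slope_below_one:
  fixes D u :: real
  assumes D: "D \<ge> 3" and u: "0 < u" "u < 1"
  shows "u powr ((D+3)/(2*D)) + (1+(1-u)/D) powr ((3*D+1)/2) < 1/u + 1/(1+(1-u)/D)"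
proof -
  define s where "s = 1 - u"
  define a where "a = (D+3)/(2*D)"
  define b where "b = (3*D+1)/2"
  define v where "v = 1 + s/D"
  define e where "e = 1/D"
  have s: "0 < s" "s < 1" using u by (auto simp: s_def)
  have e: "0 < e" "e \<le> 1/3" using D by (auto simp: e_def field_simps)
  have v: "v > 1" "v = 1 + e * s" using s D by (auto simp: v_def e_def)
  have a: "a = (1+3*e)/2" using D by (simp add: a_def e_def field_simps)
  have be: "b * e = (3+e)/2" using D by (simp add: b_def e_def field_simps)
  obtain t where t:
    "u powr a = 1 + a * (u - 1) + a * (a - 1) / 2 * (u - 1)^2
       + a * (a - 1) * (a - 2) / 6 * t powr (a - 3) * (u - 1)^3"
    by (rule powr_taylor3[of u a], use u in simp, use u in simp, rule that, assumption)
  have "a * (a - 1) * (a - 2) \<ge> 0"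
  proof -
    have "a \<ge> 0" "1 - a \<ge> 0" "2 - a \<ge> 0" using e by (auto simp: a)
    then have "a * ((1 - a) * (2 - a)) \<ge> 0" by simp
    then show ?thesis by (simp add: algebra_simps)
  qed
  moreover have "(u-1)^3 \<le> 0" using u by (simp add: power_le_zero_eq)
  ultimately have "a * (a - 1) * (a - 2) / 6 * t powr (a - 3) * (u - 1)^3 \<le> 0"
    by (intro mult_nonneg_nonpos mult_nonneg_nonneg) auto
  moreover have "a * (u - 1) = - (a * s)" "(u - 1)^2 = s^2"
    by (simp_all add: s_def algebra_simps power2_commute)
  ultimately have ua: "u powr a \<le> 1 - a * s + a * (a - 1) / 2 * s^2"
    using t by simp
  obtain t where "v > 1 \<Longrightarrow> 1 < t \<and> t < v" and t3:
    "v powr b = 1 + b * (v - 1) + b * (b - 1) / 2 * (v - 1)^2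
       + b * (b - 1) * (b - 2) / 6 * t powr (b - 3) * (v - 1)^3"
    by (rule powr_taylor3[of v b], use v(1) in simp, use v(1) in simp, rule that, assumption+)
  with v(1) have t: "1 < t" "t < v" by auto
  have b3: "b \<ge> 3" using D by (simp add: b_def)
  have "t powr (b - 3) \<le> v powr (b - 3)" using t b3 by (intro powr_mono2) auto
  also have "\<dots> = exp ((b - 3) * ln v)" using v by (simp add: powr_def)
  \<comment> \<open>Uniform in \<open>D\<close>, because \<open>ln v \<le> e * s\<close> and
    \<open>(b - 3) * e = 3/2 - 5/2 * e\<close>.\<close>
  also have "\<dots> \<le> exp (3/2 * s)"
  proof -
    have "ln v \<le> e * s" using v ln_add_one_self_le_self[of "e * s"] e s by simp
    then have "(b - 3) * ln v \<le> (b - 3) * (e * s)" using b3 by (intro mult_left_mono) auto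
    also have "\<dots> = (b * e - 3 * e) * s" by (simp add: algebra_simps)
    also have "\<dots> \<le> 3/2 * s" using s e by (intro mult_right_mono) (auto simp: be field_simps)
    finally show ?thesis by simp
  qed
  finally have tb: "t powr (b - 3) \<le> exp (3/2 * s)" .
  define c where "c = b * (b - 1) * (b - 2) / 6 * e^3"
  have c: "c = (9 - e^2) * (1 - e) / 16"
  proof -
    have "c = (b * e) * (b * e - e) * (b * e - 2 * e) / 6" by (simp add: c_def power3_eq_cube algebra_simps)
    also have "\<dots> = (9 - e^2) * (1 - e) / 16" by (simp add: be field_simps power2_eq_square)
    finally show ?thesis .
  qed
  have "e^2 \<le> 1" using e by (simp add: abs_square_le_1)
  then have c0: "0 \<le> c" using e by (simp add: c)
  have "(9 - e^2) * (1 - e) \<le> 9 * 1" using e \<open>e^2 \<le> 1\<close> by (intro mult_mono) auto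
  then have c1: "c \<le> 9/16" by (simp add: c)
  have "b * (b - 1) * (b - 2) / 6 * t powr (b - 3) * (v - 1)^3 = c * t powr (b-3) * s^3"
    by (simp add: c_def v power_mult_distrib)
  also have "\<dots> \<le> 9/16 * exp (3/2 * s) * s^3"
    using c0 c1 tb s by (intro mult_right_mono mult_mono) auto
  finally have "v powr b \<le> 1 + b * (v - 1) + b * (b - 1) / 2 * (v - 1)^2 + 9/16 * exp (3/2 * s) * s^3"
    unfolding t3 by simp
  also have "b * (v - 1) = (b * e) * s" by (simp add: v)
  also have "b * (b - 1) / 2 * (v - 1)^2 = (b * e) * (b * e - e) / 2 * s^2"
    by (simp add: v power2_eq_square algebra_simps)
  finally have vb: "v powr b \<le> 1 + (3+e)/2 * s + (3+e)/2 * (3-e)/4 * s^2 + 9/16 * exp (3/2 * s) * s^3"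
    by (simp add: be field_simps)
  have iu: "1/u = 1 + s + s^2 + s^3/(1-s)" using u by (simp add: s_def field_simps power2_eq_square power3_eq_cube)
  have iv: "1/v = 1 - e * s + e^2 * s^2 - e^3 * s^3/v"
    using v by (simp add: field_simps power2_eq_square power3_eq_cube)
  have "e^3 \<le> (1/3)^3" using e by (intro power_mono) auto
  then have e3: "e^3 \<le> 1/27" by (simp add: power3_eq_cube)
  have "e^3/v \<le> e^3" using divide_left_mono[of 1 v "e^3"] e v(1) by simp
  with e3 have e3v: "e^3/v \<le> 1/27" by linarith
  \<comment> \<open>The factor \<open>1 - s\<close> absorbs \<open>exp s\<close>, and what is left
    is at most \<open>exp (1/2) \<le> 1.7\<close>. The margin is small:
    \<open>9/16 * 1.7 + 1/27\<close> is about 0.993.\<close>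
  have "9/16 * exp (3/2 * s) + 1/27 < 1/(1-s)"
  proof -
    have "(1 - s) * exp s \<le> 1"
      using exp_ge_add_one_self[of "-s"] s by (simp add: exp_minus field_simps)
    then have "(1-s) * exp s * exp (s/2) \<le> 1 * exp (s/2)" by (intro mult_right_mono) auto
    moreover have "exp (3/2 * s) = exp s * exp (s/2)" by (simp flip: exp_add)
    ultimately have 1: "(1-s) * exp (3/2 * s) \<le> exp (s/2)" by (simp add: mult.assoc)
    have "exp (1/2 :: real) * exp (1/2) = exp 1" by (simp flip: exp_add)
    then have "exp (1/2 :: real)^2 \<le> 1.7^2"
      using e_less_272 unfolding power2_eq_square by linarith
    then have "exp (1/2 :: real) \<le> 1.7" by (rule power2_le_imp_le) simp
    moreover have "exp (s/2) \<le> exp (1/2)" using s by simp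
    ultimately have "exp (s/2) \<le> 1.7" by linarith
    have "(1-s) * exp (3/2 * s) \<le> 1.7" using 1 \<open>exp (s/2) \<le> 1.7\<close> by (rule order_trans)
    then have "9/16 * ((1-s) * exp (3/2 * s)) \<le> 9/16 * 1.7" by (rule mult_left_mono) simp
    moreover have "(1-s) * (1/27) \<le> 1/27" using s by simp
    ultimately have "9/16 * ((1-s) * exp (3/2 * s)) + (1-s) * (1/27) \<le> 9/16 * 1.7 + 1/27" by (rule add_mono)
    also have "\<dots> < 1" by simp
    finally have "(1-s) * (9/16 * exp (3/2 * s) + 1/27) < 1" by (simp only: distrib_left mult.left_commute)
    then show ?thesis using s by (simp add: field_simps)
  qed
  then have "(9/16 * exp (3/2 * s) + e^3/v) * s^3 < 1/(1-s) * s^3"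
    using e3v s by (intro mult_strict_right_mono) auto
  then have "9/16 * exp (3/2 * s) * s^3 + e^3 * s^3/v < s^3/(1-s)" by (simp add: algebra_simps)
  then have R: "9/16 * exp (3/2 * s) * s^3 < s^3/(1-s) - e^3 * s^3/v" by (rule less_diff_eq[THEN iffD2])
  have swap: "(p + q) + (x - y) = (p + x) + (q - y)" for p q x y :: real by simp
  \<comment> \<open>This identity is where the value of \<open>\<theta>\<close> enters: the
    quadratic terms match only for these exponents.\<close>
  have eq: "1 - a * s + a * (a - 1) / 2 * s^2 + (1 + (3+e)/2 * s + (3+e)/2 * (3-e)/4 * s^2)
     = 1 + s + s^2 + (1 - e * s + e^2 * s^2)"
    by (simp add: a field_simps power2_eq_square)
  have "u powr a + v powr b < (1 - a * s + a * (a - 1) / 2 * s^2)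
      + (1 + (3+e)/2 * s + (3+e)/2 * (3-e)/4 * s^2 + (s^3/(1-s) - e^3 * s^3/v))"
    by (rule add_le_less_mono[OF ua order_le_less_trans[OF vb add_strict_left_mono[OF R]]])
  also have "\<dots> = (1 - a * s + a * (a - 1) / 2 * s^2 + (1 + (3+e)/2 * s + (3+e)/2 * (3-e)/4 * s^2))
      + (s^3/(1-s) - e^3 * s^3/v)" by (rule add.assoc[symmetric])
  also have "\<dots> = (1 + s + s^2 + (1 - e * s + e^2 * s^2)) + (s^3/(1-s) - e^3 * s^3/v)"
    by (rule arg_cong[OF eq])
  also have "\<dots> = (1 + s + s^2 + s^3/(1-s)) + (1 - e * s + e^2 * s^2 - e^3 * s^3/v)"
    by (rule swap)
  also have "\<dots> = 1/u + 1/v" by (rule arg_cong2[OF iu[symmetric] iv[symmetric]])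
  finally show ?thesis by (simp only: a_def b_def v_def s_def)
qed

text \<open>Here \<open>x\<close> and \<open>y\<close> stand for values of \<open>u - 1\<close>, and
  \<open>R\<close>, \<open>S\<close> for the corresponding values of a decreasing weight. With
  \<open>p\<close> and \<open>c\<close> as in the proof, the assumption \<open>neg\<close> says that
  \<open>(p * x - (1 - e)) / (c * x - (1 - e))\<close> exceeds \<open>R\<close>. Since
  \<open>p \<le> c\<close>, this quotient grows with \<open>x\<close>, while the weight falls, so
  the inequality persists to the right.\<close>

lemma second_derivative_sign:
  fixes D x y R S :: real
  assumes D: "D \<ge> 1" and xy: "0 < x" "x < y" and R: "R \<le> 1" "S \<le> R" "0 < R"
  defines "e \<equiv> 1 / D"
  assumes neg: "(1 - e) - e * (5 + 3 * e) * x < R * ((1 - e) - (3 + 5 * e) * x)"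
  shows "(1 - e) - e * (5 + 3 * e) * y \<le> S * ((1 - e) - (3 + 5 * e) * y)"
proof -
  define p where "p = e * (5 + 3 * e)"
  define c where "c = 3 + 5 * e"
  have e: "0 < e" "e \<le> 1" using D by (auto simp: e_def)
  have "e * e \<le> 1" using e by (simp add: mult_le_one)
  then have pc: "0 < p" "p \<le> c" using e by (auto simp: p_def c_def algebra_simps intro!: add_pos_pos add_pos_nonneg)
  have b2: "c * x - (1 - e) > 0"
  proof (rule ccontr)
    assume "\<not> c * x - (1 - e) > 0"
    then have "R * ((1 - e) - c * x) \<le> 1 * ((1 - e) - c * x)"
      using R by (intro mult_right_mono) auto
    moreover have "p * x \<le> c * x" using pc xy by simp
    ultimately show False using neg by (simp add: p_def c_def)
  qed
  have "(p * x - (1 - e)) * (c * y - (1 - e)) \<le> (p * y - (1 - e)) * (c * x - (1 - e))"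
  proof -
    have "(1 - e) * ((c - p) * (y - x)) \<ge> 0" using e pc xy by simp
    then show ?thesis by (simp add: algebra_simps)
  qed
  moreover have y2: "c * y - (1 - e) > 0"
    using b2 xy pc mult_strict_left_mono[of x y c] by linarith
  moreover have "R * (c * x - (1 - e)) \<le> p * x - (1 - e)"
    using neg by (simp add: p_def c_def algebra_simps)
  ultimately have "R * (c * x - (1 - e)) * (c * y - (1 - e)) \<le> (p * y - (1 - e)) * (c * x - (1 - e))"
    by (meson mult_right_mono less_imp_le order_trans)
  then have "(R * (c * y - (1 - e))) * (c * x - (1 - e)) \<le> (p * y - (1 - e)) * (c * x - (1 - e))"
    by (simp add: mult_ac)
  then have "R * (c * y - (1 - e)) \<le> p * y - (1 - e)" using b2 by simp
  moreover have "S * (c * y - (1 - e)) \<le> R * (c * y - (1 - e))"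
    using R y2 by (intro mult_right_mono) auto
  ultimately show ?thesis by (simp add: p_def c_def algebra_simps)
qed

text \<open>For \<open>u < 1\<close> the difference \<open>F\<close> decreases to
  \<open>F 1 = 0\<close>. For \<open>u > 1\<close>, a negative value of \<open>F\<close> between
  \<open>F 1 = 0\<close> and \<open>F Q \<ge> 0\<close> would, by the mean value theorem applied to
  \<open>F\<close>, \<open>G\<close> and \<open>G1\<close> in turn, make \<open>G2\<close> negative
  at one point and positive at a later one, which \<open>second_derivative_sign\<close> excludes. So
  the single inequality at \<open>Q\<close> controls the whole interval.\<close>

lemma power_log_compare:
  fixes D Q u :: real
  defines "\<theta> \<equiv> 3 * (D + 1) / (2 * D)" and "K \<equiv> 3 * (D + 1) / 2"
  defines "v \<equiv> \<lambda>u. 1 + (1 - u) / D"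
  assumes D: "D \<ge> 3" "1 < Q" "Q \<le> D" and u: "0 < u" "u \<le> Q"
    and Q: "v Q powr K - K * ln (v Q) \<le> Q powr \<theta> - \<theta> * ln Q"
  shows "v u powr K - K * ln (v u) \<le> u powr \<theta> - \<theta> * ln u"
    and "u < 1 \<Longrightarrow> v u powr K - K * ln (v u) < u powr \<theta> - \<theta> * ln u"
proof -
  define e where "e = 1 / D"
  have e: "0 < e" "e \<le> 1/3" "K * e = \<theta>" "\<theta> = 3/2 * (1 + e)"
    using D by (auto simp: e_def \<theta>_def K_def field_simps)
  have \<theta>: "1 < \<theta>" "\<theta> \<le> 2" "2 - \<theta> \<le> \<theta> - 2 * e" using e by auto
  have v: "v u = 1 + e * (1 - u)" for u by (simp add: v_def e_def)
  have vpos: "v u > 0" if "u \<le> Q" for u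
  proof -
    have "e * (u - 1) \<le> e * (D - 1)" using that D e by (intro mult_left_mono) auto
    also have "\<dots> < 1" using D by (simp add: e_def field_simps)
    finally show ?thesis by (simp add: v algebra_simps)
  qed
  have dv: "(v has_real_derivative - e) (at u)" for u
    unfolding v_def e_def using D by (auto intro!: derivative_eq_intros)
  have dvp: "((\<lambda>u. v u powr b) has_real_derivative - (b * e * v u powr (b - 1))) (at u)" if "u \<le> Q" for u b
    using DERIV_fun_powr[OF dv vpos[OF that], of b] by (simp add: algebra_simps)
  have dup: "((\<lambda>u. u powr b) has_real_derivative b * u powr (b - 1)) (at u)" if "0 < u" for u b :: real
    using that by (rule has_real_derivative_powr)
  have dlv: "((\<lambda>u. ln (v u)) has_real_derivative - e / v u) (at u)" if "u \<le> Q" for u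
    using DERIV_ln_divide[THEN DERIV_chain2, OF vpos[OF that] dv] by simp
  define F where "F u = (u powr \<theta> - \<theta> * ln u) - (v u powr K - K * ln (v u))" for u
  define g where "g u = u powr (\<theta> - 1) + v u powr (K - 1) - 1 / u - 1 / v u" for u
  \<comment> \<open>\<open>G\<close> is \<open>g\<close> with its denominators cleared, and
    \<open>G1\<close>, \<open>G2\<close> are its first two derivatives. \<open>G\<close> and
    \<open>G1\<close> vanish at 1, so a sign of \<open>G\<close> right of 1 is passed on to
    \<open>G2\<close>.\<close>
  define G where "G u = v u * (u powr \<theta> - 1) - u * (1 - v u powr K)" for u
  define G1 where "G1 u = v u * (\<theta> * u powr (\<theta> - 1)) - e * (u powr \<theta> - 1)
     - (1 - v u powr K + u * (\<theta> * v u powr (K - 1)))" for u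
  define G2 where "G2 u = \<theta> * (u powr (\<theta> - 2) * ((\<theta> - 1) * v u - 2 * e * u)
     + v u powr (K - 2) * ((\<theta> - e) * u - 2 * v u))" for u
  have dF: "(F has_real_derivative \<theta> * g u) (at u)" if "0 < u" "u \<le> Q" for u
  proof -
    have "(F has_real_derivative (\<theta> * u powr (\<theta> - 1) - \<theta> * (1 / u)) -
        (- (K * e * v u powr (K - 1)) - K * (- e / v u))) (at u)"
      unfolding F_def using that by (intro DERIV_diff DERIV_cmult dup dvp dlv DERIV_ln_divide) auto
    also have "(\<theta> * u powr (\<theta> - 1) - \<theta> * (1 / u)) - (- (K * e * v u powr (K - 1)) - K * (- e / v u)) = \<theta> * g u"
      using e(3) by (simp add: g_def algebra_simps)
    finally show ?thesis .
  qed
  have F1: "F 1 = 0" by (simp add: F_def v_def)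
  have "F u \<ge> 0 \<and> (u < 1 \<longrightarrow> F u > 0)"
  proof (cases "u < 1")
    case True
    have "F u > F 1"
    proof (rule DERIV_neg_imp_decreasing_open[OF True])
      fix x assume x: "u < x" "x < 1"
      then have "x powr ((D+3)/(2*D)) + (1+(1-x)/D) powr ((3*D+1)/2) < 1/x + 1/(1+(1-x)/D)"
        using u D by (intro pair_slope_below_one) auto
      moreover have "(D+3)/(2*D) = \<theta> - 1" "(3*D+1)/2 = K - 1"
        using D by (auto simp: \<theta>_def K_def field_simps)
      ultimately have "g x < 0" by (simp add: g_def v_def)
      then have "\<theta> * g x < 0" using \<theta> by (simp add: mult_pos_neg)
      then show "\<exists>y. (F has_real_derivative y) (at x) \<and> y < 0"
        using dF[of x] x u D by auto
    next
      show "continuous_on {u..1} F"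
        using u D by (intro continuous_at_imp_continuous_on ballI DERIV_isCont[OF dF]) auto
    qed
    then show ?thesis using F1 by simp
  next
    case False
    have "F u \<ge> 0"
    proof (rule ccontr)
      assume neg: "\<not> F u \<ge> 0"
      have FQ: "F Q \<ge> 0" using Q by (simp add: F_def)
      have uq: "1 < u" "u < Q" using neg False u FQ F1 by (cases "u = 1"; cases "u = Q"; simp)+
      have gG: "u * v u * g u = G u" if "0 < u" "u \<le> Q" for u
      proof -
        have "u powr \<theta> = u * u powr (\<theta> - 1)" "v u powr K = v u * v u powr (K - 1)"
          using that vpos[of u] by (simp_all add: powr_diff)
        then show ?thesis using that vpos[of u] by (simp add: g_def G_def field_simps)
      qed
      have dG: "(G has_real_derivative G1 u) (at u)" if "0 < u" "u \<le> Q" for u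
      proof -
        have "(G has_real_derivative (- e * (u powr \<theta> - 1) + (\<theta> * u powr (\<theta> - 1) - 0) * v u)
           - (1 * (1 - v u powr K) + (0 - - (K * e * v u powr (K - 1))) * u)) (at u)"
          unfolding G_def using that by (intro DERIV_diff DERIV_mult DERIV_const DERIV_ident dup dvp dv) auto
        also have "(- e * (u powr \<theta> - 1) + (\<theta> * u powr (\<theta> - 1) - 0) * v u)
           - (1 * (1 - v u powr K) + (0 - - (K * e * v u powr (K - 1))) * u) = G1 u"
          using e(3) by (simp add: G1_def algebra_simps)
        finally show ?thesis .
      qed
      have dG1: "(G1 has_real_derivative G2 u) (at u)" if "0 < u" "u \<le> Q" for u
      proof -
        have "(G1 has_real_derivative ((- e * (\<theta> * u powr (\<theta> - 1)) + (\<theta> * ((\<theta> - 1) * u powr (\<theta> - 1 - 1))) * v u)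
            - e * (\<theta> * u powr (\<theta> - 1) - 0))
           - ((0 - - (K * e * v u powr (K - 1))) + (1 * (\<theta> * v u powr (K - 1))
              + (\<theta> * - ((K - 1) * e * v u powr (K - 1 - 1))) * u))) (at u)"
          unfolding G1_def using that
          by (intro DERIV_diff DERIV_add DERIV_cmult DERIV_mult DERIV_const DERIV_ident dup dvp dv) auto
        also have "((- e * (\<theta> * u powr (\<theta> - 1)) + (\<theta> * ((\<theta> - 1) * u powr (\<theta> - 1 - 1))) * v u)
            - e * (\<theta> * u powr (\<theta> - 1) - 0))
           - ((0 - - (K * e * v u powr (K - 1))) + (1 * (\<theta> * v u powr (K - 1))
              + (\<theta> * - ((K - 1) * e * v u powr (K - 1 - 1))) * u)) = G2 u"
        proof -
          have "u powr (\<theta> - 1) = u * u powr (\<theta> - 2)" "v u powr (K - 1) = v u * v u powr (K - 2)"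
            using that vpos[of u] by (simp_all add: powr_diff power2_eq_square)
          moreover have "(K - 1) * e = \<theta> - e" using e(3) by (simp add: algebra_simps)
          moreover have "\<theta> - 1 - 1 = \<theta> - 2" "K - 1 - 1 = K - 2" by auto
          ultimately show ?thesis unfolding G2_def e(3) by (simp only:) (simp add: algebra_simps)
        qed
        finally show ?thesis .
      qed
      have g1: "G 1 = 0" "G1 1 = 0" using e(3) by (simp_all add: G_def G1_def v_def)
      obtain m1 where m1: "1 < m1" "m1 < u" "F u - F 1 = (u - 1) * (\<theta> * g m1)"
        using MVT2[of 1 u F "\<lambda>x. \<theta> * g x"] dF uq by force
      obtain m2 where m2: "u < m2" "m2 < Q" "F Q - F u = (Q - u) * (\<theta> * g m2)"
        using MVT2[of u Q F "\<lambda>x. \<theta> * g x"] dF uq by force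
      have "(u - 1) * \<theta> * g m1 < 0" using m1 F1 neg by (simp add: mult.assoc)
      then have "g m1 < 0" using uq \<theta> by (simp add: mult_less_0_iff)
      then have "G m1 < 0" using gG[of m1] vpos[of m1] m1 uq by (simp add: mult_pos_neg flip: gG)
      have "(Q - u) * \<theta> * g m2 > 0" using m2 FQ neg by (simp add: mult.assoc)
      then have "g m2 > 0" by (rule zero_less_mult_pos) (use uq \<theta>(1) in simp)
      then have "G m2 > 0" using gG[of m2] vpos[of m2] m2 uq by (simp flip: gG)
      obtain p1 where p1: "1 < p1" "p1 < m1" "G m1 - G 1 = (m1 - 1) * G1 p1"
        using MVT2[of 1 m1 G G1] dG m1 uq by force
      obtain p2 where p2: "m1 < p2" "p2 < m2" "G m2 - G m1 = (m2 - m1) * G1 p2"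
        using MVT2[of m1 m2 G G1] dG m1 m2 uq by force
      have "G1 p1 < 0" using p1 g1 \<open>G m1 < 0\<close> m1 by (simp add: mult_less_0_iff)
      have "(m2 - m1) * G1 p2 > 0" using p2(3) \<open>G m1 < 0\<close> \<open>G m2 > 0\<close> by linarith
      then have "G1 p2 > 0" using m1 m2 by (simp add: zero_less_mult_iff)
      obtain r1 where r1: "1 < r1" "r1 < p1" "G1 p1 - G1 1 = (p1 - 1) * G2 r1"
        using MVT2[of 1 p1 G1 G2] dG1 p1 m1 uq by force
      obtain r2 where r2: "p1 < r2" "r2 < p2" "G1 p2 - G1 p1 = (p2 - p1) * G2 r2"
        using MVT2[of p1 p2 G1 G2] dG1 p1 p2 m1 m2 uq by force
      have n1: "G2 r1 < 0" using r1 g1 \<open>G1 p1 < 0\<close> p1 by (simp add: mult_less_0_iff)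
      have "(p2 - p1) * G2 r2 > 0" using r2(3) \<open>G1 p1 < 0\<close> \<open>G1 p2 > 0\<close> by linarith
      then have n2: "G2 r2 > 0" using p1 p2 by (simp add: zero_less_mult_iff)
      \<comment> \<open>Scaling \<open>G2\<close> by \<open>u powr (2 - \<theta>)\<close> leaves two
        affine functions of \<open>u - 1\<close>, one of them weighted by \<open>R\<close>. This is
        the form treated in \<open>second_derivative_sign\<close>.\<close>
      define R where "R u = v u powr (K - 2) * u powr (2 - \<theta>)" for u
      have RG: "2 / \<theta> * u powr (2 - \<theta>) * G2 u =
          ((1 - e) - e * (5 + 3 * e) * (u - 1)) - R u * ((1 - e) - (3 + 5 * e) * (u - 1))" if "0 < u" for u
      proof -
        have "u powr (2 - \<theta>) * u powr (\<theta> - 2) = 1" using that by (simp flip: powr_add)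
        moreover have "2 / \<theta> * u powr (2 - \<theta>) * G2 u =
           (u powr (2 - \<theta>) * u powr (\<theta> - 2)) * (2 * ((\<theta> - 1) * v u - 2 * e * u))
            + R u * (2 * ((\<theta> - e) * u - 2 * v u))"
          using \<theta> by (simp add: G2_def R_def field_simps)
        moreover have "2 * ((\<theta> - 1) * v u - 2 * e * u) = (1 - e) - e * (5 + 3 * e) * (u - 1)"
          "2 * ((\<theta> - e) * u - 2 * v u) = - ((1 - e) - (3 + 5 * e) * (u - 1))"
          unfolding e(4) v by (simp_all add: field_simps)
        ultimately show ?thesis by (simp only: mult_1 mult_minus_right diff_conv_add_uminus)
      qed
      have Rmono: "R y \<le> R x" if "1 \<le> x" "x \<le> y" "y \<le> Q" for x y
      proof -
        define L where "L u = (K - 2) * ln (v u) + (2 - \<theta>) * ln u" for u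
        have "L y \<le> L x"
        proof (rule DERIV_nonpos_imp_nonincreasing[OF that(2)])
          fix z assume z: "x \<le> z" "z \<le> y"
          have "(L has_real_derivative (K - 2) * (- e / v z) + (2 - \<theta>) * (1 / z)) (at z)"
            unfolding L_def using z that by (intro DERIV_add DERIV_cmult dlv DERIV_ln_divide) auto
          moreover have "(K - 2) * (- e / v z) + (2 - \<theta>) * (1 / z) \<le> 0"
          proof -
            have "v z \<le> 1" using z that e by (simp add: v mult_nonneg_nonpos)
            then have "1 \<le> 1 / v z" using vpos[of z] z that by simp
            have "(2 - \<theta>) * (1 / z) \<le> (2 - \<theta>) * 1" using \<theta> z that by (intro mult_left_mono) auto
            also have "\<dots> \<le> (\<theta> - 2 * e) * (1 / v z)"
              by (rule mult_mono[OF \<theta>(3) \<open>1 \<le> 1 / v z\<close>]) (use \<theta> in auto)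
            also have "\<dots> = (K - 2) * (e / v z)" using e(3) by (simp add: algebra_simps flip: e(3))
            finally show ?thesis by simp
          qed
          ultimately show "\<exists>y. (L has_real_derivative y) (at z) \<and> y \<le> 0" by blast
        qed
        then have "exp (L y) \<le> exp (L x)" by simp
        moreover have "R u = exp (L u)" if "0 < u" "u \<le> Q" for u
          using that vpos[of u] by (simp add: R_def L_def powr_def exp_add)
        ultimately show ?thesis using that by simp
      qed
      have "R 1 = 1" by (simp add: R_def v_def)
      have rr: "R r1 \<le> 1" "R r2 \<le> R r1" "0 < R r1"
        using Rmono[of 1 r1] Rmono[of r1 r2] \<open>R 1 = 1\<close> vpos[of r1] r1 r2 p1 p2 m1 m2 uq by (auto simp: R_def)
      have "2 / \<theta> * r1 powr (2 - \<theta>) * G2 r1 < 0" using n1 \<theta> r1 by (intro mult_pos_neg) auto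
      then have "(1 - e) - e * (5 + 3 * e) * (r1 - 1) < R r1 * ((1 - e) - (3 + 5 * e) * (r1 - 1))"
        using RG[of r1] r1 by simp
      then have "(1 - e) - e * (5 + 3 * e) * (r2 - 1) \<le> R r2 * ((1 - e) - (3 + 5 * e) * (r2 - 1))"
        using second_derivative_sign[of D "r1 - 1" "r2 - 1" "R r1" "R r2"] D r1 r2 rr by (simp add: e_def)
      then have "2 / \<theta> * r2 powr (2 - \<theta>) * G2 r2 \<le> 0" using RG[of r2] r1 r2 by simp
      moreover have "2 / \<theta> * r2 powr (2 - \<theta>) * G2 r2 > 0"
        using n2 \<theta> r1 r2 by (intro mult_pos_pos) auto
      ultimately show False by simp
    qed
    then show ?thesis using False by simp
  qed
  then show "v u powr K - K * ln (v u) \<le> u powr \<theta> - \<theta> * ln u"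
    and "u < 1 \<Longrightarrow> v u powr K - K * ln (v u) < u powr \<theta> - \<theta> * ln u"
    by (simp_all add: F_def)
qed

section \<open>Numerical estimates for the comparison at the endpoint \<open>u = q\<close>\<close>

text \<open>With \<open>z = 1 + y\<close> the bound reads \<open>ln z \<le> (z - 1 / z) / 2\<close>,
  and the difference has derivative \<open>(1 - 1 / z)^2 / 2\<close>.\<close>

lemma ln_one_plus_le_rational:
  fixes y :: real
  assumes "y \<ge> 0"
  shows "ln (1 + y) \<le> y * (2 + y) / (2 * (1 + y))"
proof -
  define h where "h y = (1 + y) / 2 - inverse (1 + y) / 2 - ln (1 + y)" for y :: real
  have "h 0 \<le> h y"
  proof (rule DERIV_nonneg_imp_nondecreasing[OF assms])
    fix x :: real assume x: "0 \<le> x" "x \<le> y"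
    have d: "((\<lambda>x. 1 + x) has_real_derivative 1) (at x)" by (auto intro!: derivative_eq_intros)
    have "(h has_real_derivative 1 / 2 - (- (inverse (1 + x) * 1 * inverse (1 + x))) / 2 - 1 / (1 + x) * 1) (at x)"
      unfolding h_def using x
      by (intro DERIV_diff DERIV_cdivide DERIV_inverse' DERIV_chain2[OF DERIV_ln_divide] d) auto
    also have "1 / 2 - (- (inverse (1 + x) * 1 * inverse (1 + x))) / 2 - 1 / (1 + x) * 1
        = 1/2 + inverse (1 + x)^2 / 2 - inverse (1 + x)"
      by (simp add: power2_eq_square inverse_eq_divide)
    finally have "(h has_real_derivative 1/2 + inverse (1 + x)^2 / 2 - inverse (1 + x)) (at x)" .
    moreover have "1/2 + inverse (1 + x)^2 / 2 - inverse (1 + x) = (1 - inverse (1 + x))^2 / 2"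
      by (simp add: power2_eq_square algebra_simps)
    ultimately show "\<exists>d. (h has_real_derivative d) (at x) \<and> 0 \<le> d" by fastforce
  qed
  moreover have "(1 + y) / 2 - inverse (1 + y) / 2 = y * (2 + y) / (2 * (1 + y))"
    using assms by (simp add: field_simps)
  ultimately show ?thesis by (simp add: h_def)
qed

lemma ln_3_bounds: "12/11 \<le> ln (3::real)" "ln (3::real) \<le> 10/9"
proof -
  have "exp 12 = exp (1::real) ^ 12" by (simp flip: exp_of_nat_mult)
  also have "\<dots> \<le> 2.72 ^ 12" using e_less_272 by (intro power_mono) auto
  also have "\<dots> \<le> 3 ^ 11" by (simp add: power_divide)
  finally have "12 \<le> ln (3 ^ 11 :: real)" by (subst ln_ge_iff) auto
  also have "\<dots> = 11 * ln 3" by (subst ln_realpow) simp_all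
  finally show "12/11 \<le> ln (3::real)" by simp
  have "ln (3::real) = ln (1 + 1/2) + ln 2" using ln_mult[of "3/2::real" 2] by simp
  then show "ln (3::real) \<le> 10/9"
    using ln_one_plus_le_rational[of "1/2"] ln2_le_25_over_36 by simp
qed

lemma powr_lower: "x powr b \<ge> 1 + b * ln x" if "x > 0" for x b :: real
  using that exp_ge_add_one_self[of "b * ln x"] by (simp add: powr_def)

lemma exp_minus_3_le: "exp (-3 :: real) \<le> (3/50)"
proof -
  have "(1 + 3 / real 24) ^ 24 \<le> exp (3::real)"
    by (rule exp_ge_one_plus_x_over_n_power_n) auto
  moreover have "((167/10)::real) \<le> (1 + 3 / real 24) ^ 24" by (simp add: power_divide)
  ultimately have "(167/10) \<le> exp (3::real)" by linarith
  then show ?thesis by (simp add: exp_minus field_simps)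
qed

lemma divided_bound:
  fixes n m a b e p :: real
  assumes "n > 0" "m > 0" "e * (n * m) + p \<le> a * (n * m) + b * n"
  shows "e + p / (n * m) \<le> a + b / m"
proof -
  have "(e * (n * m) + p) / (n * m) \<le> (a * (n * m) + b * n) / (n * m)"
    using assms by (intro divide_right_mono) auto
  then show ?thesis using assms(1,2) by (simp add: add_divide_distrib)
qed

text \<open>With \<open>p = q - 1\<close>, the quotient \<open>n / D\<close> is the value of
  \<open>v\<close> at \<open>u = q\<close>. The power is at most \<open>exp (-3)\<close> because
  \<open>K * (n / D - 1) = - 3/2 * (1 + 1 / D) * p\<close>. The logarithm is replaced by a rational
  function so that the remaining comparison is polynomial in \<open>n\<close>.\<close>

lemma endpoint_bound:
  fixes n D p :: real
  assumes "n > 0" "D = n + p" "p \<ge> 2"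
  defines "K \<equiv> 3 * (D + 1) / 2"
  shows "(n / D) powr K - K * ln (n / D)
     \<le> (3/50) + 3 * p * (D + 1) * (2 * n + p) / (4 * n * D)"
proof -
  have n: "n > 0" "D > 0" "D = n + p" and q: "p \<ge> 2" using assms by auto
  have K: "K > 0" using n by (simp add: K_def)
  have "ln (n / D) \<le> n / D - 1" using n by (intro ln_le_minus_one) auto
  then have "K * ln (n / D) \<le> K * (n / D - 1)" using K by (intro mult_left_mono) auto
  also have "K * (n / D - 1) = - (3 / 2 * (1 + 1 / D) * p)"
    using n by (simp add: K_def field_simps)
  also have "\<dots> \<le> -3"
  proof -
    have "3 / 2 * 1 * 2 \<le> 3 / 2 * (1 + 1 / D) * p" using n q by (intro mult_mono) auto
    then show ?thesis by simp
  qed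
  finally have "(n / D) powr K \<le> exp (-3)" using n by (simp add: powr_def)
  then have 1: "(n / D) powr K \<le> (3/50)" using exp_minus_3_le by linarith
  have "- ln (n / D) = ln (1 + p / n)"
  proof -
    have "1 + p / n = D / n" using n by (simp add: field_simps)
    then show ?thesis using n by (simp add: ln_div)
  qed
  also have "\<dots> \<le> p / n * (2 + p / n) / (2 * (1 + p / n))"
    using n q by (intro ln_one_plus_le_rational) auto
  also have "1 + p / n = D / n" using n by (simp add: field_simps)
  also have "2 + p / n = (2 * n + p) / n" using n(1) by (simp add: field_simps)
  also have "p / n * ((2 * n + p) / n) / (2 * (D / n)) = p * (2 * n + p) / (2 * n * D)"
    using n(1,2) by simp
  finally have "K * - ln (n / D) \<le> K * (p * (2 * n + p) / (2 * n * D))"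
    using K by (intro mult_left_mono) auto
  also have "\<dots> = 3 * p * (D + 1) * (2 * n + p) / (4 * n * D)"
    by (simp only: K_def times_divide_times_eq) (simp add: mult_ac)
  finally show ?thesis using 1 by simp
qed

text \<open>This supplies the hypothesis of \<open>power_log_compare\<close> at
  \<open>Q = 3\<close>. The estimate of \<open>endpoint_bound\<close> is too weak for
  \<open>d = 3\<close> and \<open>d = 4\<close>, where numbers are compared directly.\<close>

lemma endpoint_3:
  fixes d :: nat
  assumes "d \<ge> 3"
  defines "D \<equiv> real d"
  defines "K \<equiv> 3 * (D + 1) / 2" and "\<theta> \<equiv> 3 * (D + 1) / (2 * D)"
  shows "(1 + (1 - 3) / D) powr K - K * ln (1 + (1 - 3) / D) \<le> 3 powr \<theta> - \<theta> * ln 3"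
proof -
  note ln3 = ln_3_bounds
  consider "d = 3" | "d = 4" | "d \<ge> 5" using assms by linarith
  then show ?thesis
  proof cases
    case 1
    have "ln (1 / 3 :: real) = - ln 3" by (simp add: ln_div)
    then show ?thesis using 1 ln3 by (simp add: D_def K_def \<theta>_def power_divide)
  next
    case 2
    have "(1 / 2 :: real) powr (15 / 2) \<le> (1 / 2) powr 7" by (intro powr_mono') auto
    then have a: "(1 / 2 :: real) powr (15 / 2) \<le> 1 / 128" by (simp add: power_divide)
    have "(3::real) powr (15 / 8) = 9 * 3 powr (- 1 / 8)"
      using powr_add[of "3::real" 2 "-1/8"] by simp
    moreover have "(3::real) powr (- 1 / 8) \<ge> 1 - ln 3 / 8" using powr_lower[of 3 "-1/8"] by simp
    ultimately have b: "(3::real) powr (15 / 8) \<ge> 9 - 9 * ln 3 / 8" by simp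
    have c: "ln (1 / 2 :: real) = - ln 2" by (simp add: ln_div)
    have "(1 / 2 :: real) powr (15 / 2) - 15 / 2 * ln (1 / 2) \<le> 3 powr (15 / 8) - 15 / 8 * ln 3"
      unfolding c using a b ln3 ln2_le_25_over_36 by linarith
    then show ?thesis using 2 by (simp add: D_def K_def \<theta>_def)
  next
    case 3
    define n where "n = D - 2"
    have n: "n \<ge> 3" "D = n + 2" "D > 0" using 3 by (auto simp: n_def D_def)
    have "sqrt 3 \<ge> (173/100)" by (rule real_le_rsqrt) (simp add: power2_eq_square)
    moreover have "(3::real) powr (3/2) = 3 * sqrt 3"
      using powr_add[of "3::real" 1 "1/2"] by (simp add: powr_half_sqrt)
    ultimately have s3: "(3::real) powr (3/2) \<ge> (519/100)" by simp
    have th: "\<theta> = 3/2 + 3/2 / D" using n(3) by (simp add: \<theta>_def field_simps)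
    have "3 powr \<theta> = 3 powr (3/2) * 3 powr (3/2 / D)" unfolding th by (rule powr_add)
    also have "\<dots> \<ge> (519/100) * (1 + 3/2 / D * ln 3)"
      using s3 powr_lower[of 3 "3/2 / D"] n ln3 by (intro mult_mono) auto
    finally have "3 powr \<theta> - \<theta> * ln 3 \<ge> (519/100) * (1 + 3/2 / D * ln 3) - (3/2 + 3/2 / D) * ln 3"
      unfolding th by simp
    also have "(519/100) * (1 + 3/2 / D * ln 3) - (3/2 + 3/2 / D) * ln 3 = (519/100) - 3/2 * ln 3 + (1257/200) / D * ln (3::real)"
      by (simp add: field_simps)
    also have "\<dots> \<ge> (519/100) - 3/2 * (10/9) + (1257/200) / D * (12 / 11)"
      using ln3 n by (intro add_mono diff_mono mult_left_mono) auto
    finally have A: "3 powr \<theta> - \<theta> * ln 3 \<ge> (519/100) - 3/2 * (10/9) + (1257/200) / D * (12 / 11)" .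
    have B: "(3/50) + 3 * 2 * (D + 1) * (2 * n + 2) / (4 * n * D) \<le> (519/100) - 3/2 * (10/9) + (1257/200) / D * (12 / 11)"
    proof -
      \<comment> \<open>Grouping around \<open>n * (n - 3)\<close> makes both summands nonnegative
        for \<open>n \<ge> 3\<close>, that is from \<open>d = 5\<close> on.\<close>
      have "((519/100) - 3/2 * (10/9)) * (n * D) + (1257/200) * (12 / 11) * n - ((3/50) * (n * D) + 3 * (n + 3) * (n + 1))
         = 139/300 * (n * (n - 3)) + ((139/100 + 519/50 - 10/3 + 3771/50/11 - 303/25) * n - 9)"
        unfolding n(2) by (simp add: field_simps)
      moreover have "0 \<le> 139/300 * (n * (n - 3)) + ((139/100 + 519/50 - 10/3 + 3771/50/11 - 303/25) * n - 9)"
        using n(1) by (intro add_nonneg_nonneg) auto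
      ultimately have "0 \<le> ((519/100) - 3/2 * (10/9)) * (n * D) + (1257/200) * (12 / 11) * n - ((3/50) * (n * D) + 3 * (n + 3) * (n + 1))" by (simp only:)
      then have "(3/50) * (n * D) + 3 * (n + 3) * (n + 1) \<le> ((519/100) - 3/2 * (10/9)) * (n * D) + (1257/200) * (12 / 11) * n"
        by (simp only: diff_ge_0_iff_ge)
      then have "(3/50) + 3 * (n + 3) * (n + 1) / (n * D) \<le> (519/100) - 3/2 * (10/9) + (1257/200) * (12 / 11) / D"
        using n by (intro divided_bound) auto
      moreover have "3 * 2 * (D + 1) * (2 * n + 2) / (4 * n * D) = (4 * (3 * (n + 3) * (n + 1))) / (4 * (n * D))"
        by (rule arg_cong2[where f = "(/)"]) (simp_all add: n(2) algebra_simps)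
      ultimately show ?thesis by simp
    qed
    have v: "1 + (1 - 3) / D = n / D" using n by (simp add: field_simps)
    have "(n / D) powr K - K * ln (n / D) \<le> 3/50 + 3 * 2 * (D + 1) * (2 * n + 2) / (4 * n * D)"
      unfolding K_def using n by (intro endpoint_bound) auto
    from order_trans[OF order_trans[OF this B] A] show ?thesis unfolding v .
  qed
qed

text \<open>As for \<open>Q = 3\<close>, with \<open>d = 4\<close> and \<open>d = 5\<close> done by
  hand. Here \<open>4 powr (3/2)\<close> is exactly 8, and bounds on \<open>ln 2\<close> are the
  only numerical input for \<open>ln 4\<close>.\<close>

lemma endpoint_4:
  fixes d :: nat
  assumes "d \<ge> 4"
  defines "D \<equiv> real d"
  defines "K \<equiv> 3 * (D + 1) / 2" and "\<theta> \<equiv> 3 * (D + 1) / (2 * D)"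
  shows "(1 + (1 - 4) / D) powr K - K * ln (1 + (1 - 4) / D) \<le> 4 powr \<theta> - \<theta> * ln 4"
proof -
  have "ln (2 * 2 :: real) = ln 2 + ln 2" by (rule ln_mult_pos) auto
  moreover have "2 * 2 = (4::real)" by simp
  ultimately have ln4: "ln (4::real) = 2 * ln 2" by (simp only: mult_2)
  consider "d = 4" | "d = 5" | "d \<ge> 6" using assms by linarith
  then show ?thesis
  proof cases
    case 1
    have "(1 / 4 :: real) powr (15 / 2) \<le> (1 / 4) powr 7" by (intro powr_mono') auto
    then have a: "(1 / 4 :: real) powr (15 / 2) \<le> 1 / 128" by (simp add: power_divide)
    have "(4::real) powr (15 / 8) = 16 * 4 powr (- 1 / 8)"
      using powr_add[of "4::real" 2 "-1/8"] by simp
    moreover have "(4::real) powr (- 1 / 8) \<ge> 1 - ln 2 / 4" using powr_lower[of 4 "-1/8"] ln4 by simp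
    ultimately have b: "(4::real) powr (15 / 8) \<ge> 16 - 4 * ln 2" by simp
    have c: "ln (1 / 4 :: real) = - 2 * ln 2" by (simp add: ln_div ln4)
    have "(1 / 4 :: real) powr (15 / 2) - 15 / 2 * ln (1 / 4) \<le> 4 powr (15 / 8) - 15 / 8 * ln 4"
      unfolding c ln4 using a b ln2_le_25_over_36 by linarith
    then show ?thesis using 1 by (simp add: D_def K_def \<theta>_def)
  next
    case 2
    have "(4::real) powr (9 / 5) = 16 * 4 powr (- 1 / 5)"
      using powr_add[of "4::real" 2 "-1/5"] by simp
    moreover have "(4::real) powr (- 1 / 5) \<ge> 1 - 2 / 5 * ln 2" using powr_lower[of 4 "-1/5"] ln4 by simp
    ultimately have b: "(4::real) powr (9 / 5) \<ge> 16 - 32 / 5 * ln 2" by simp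
    have "ln (5 / 2 :: real) = ln 2 + ln (1 + 1/4)" using ln_mult[of 2 "5/4::real"] by simp
    then have "ln (5 / 2 :: real) \<le> 23/25"
      using ln_one_plus_le_rational[of "1/4"] ln2_le_25_over_36 by simp
    moreover have "ln (2 / 5 :: real) = - ln (5 / 2)" by (simp add: ln_div)
    ultimately have c: "ln (2 / 5 :: real) \<ge> - (23/25)" by simp
    have "(2 / 5 :: real) powr 9 \<le> 1/1000" by (simp add: power_divide)
    then have "(2 / 5 :: real) powr 9 - 9 * ln (2 / 5) \<le> 4 powr (9 / 5) - 9 / 5 * ln 4"
      unfolding ln4 using b c ln2_le_25_over_36 by linarith
    then show ?thesis using 2 by (simp add: D_def K_def \<theta>_def)
  next
    case 3
    define n where "n = D - 3"
    have n: "n \<ge> 3" "D = n + 3" "D > 0" using 3 by (auto simp: n_def D_def)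
    have "(2 powr 2) powr (3/2) = 2 powr (2 * (3/2) :: real)" by (rule powr_powr)
    then have s3: "(4::real) powr (3/2) = 8" by simp
    have th: "\<theta> = 3/2 + 3/2 / D" using n(3) by (simp add: \<theta>_def field_simps)
    have "4 powr \<theta> = 4 powr (3/2) * 4 powr (3/2 / D)" unfolding th by (rule powr_add)
    also have "\<dots> \<ge> 8 * (1 + 3/2 / D * ln 4)"
      unfolding s3 using powr_lower[of 4 "3/2 / D"] by simp
    finally have "4 powr \<theta> - \<theta> * ln 4 \<ge> 8 * (1 + 3/2 / D * ln 4) - (3/2 + 3/2 / D) * ln 4"
      unfolding th by simp
    also have "8 * (1 + 3/2 / D * ln 4) - (3/2 + 3/2 / D) * ln 4 = 8 - 3/2 * ln 4 + (21/2) / D * ln (4::real)"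
      by (simp add: field_simps)
    also have "\<dots> \<ge> 8 - 3/2 * (25/18) + (21/2) / D * (4 / 3)"
      using ln4 ln2_le_25_over_36 ln2_ge_two_thirds n by (intro add_mono diff_mono mult_left_mono) auto
    finally have A: "4 powr \<theta> - \<theta> * ln 4 \<ge> 8 - 3/2 * (25/18) + (21/2) / D * (4 / 3)" .
    have B: "(3/50) + 3 * 3 * (D + 1) * (2 * n + 3) / (4 * n * D) \<le> 8 - 3/2 * (25/18) + (21/2) / D * (4 / 3)"
    proof -
      have "(8 - 3/2 * (25/18)) * (n * D) + (21/2) * (4 / 3) * n - ((3/50) * (n * D) + 9/4 * (n + 4) * (2 * n + 3))
         = 407/300 * (n * (n - 3)) + ((407/100 + 341/50) * n - 27)"
        unfolding n(2) by (simp add: field_simps)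
      moreover have "0 \<le> 407/300 * (n * (n - 3)) + ((407/100 + 341/50) * n - 27)"
        using n(1) by (intro add_nonneg_nonneg) auto
      ultimately have "0 \<le> (8 - 3/2 * (25/18)) * (n * D) + (21/2) * (4 / 3) * n - ((3/50) * (n * D) + 9/4 * (n + 4) * (2 * n + 3))" by (simp only:)
      then have "(3/50) * (n * D) + 9/4 * (n + 4) * (2 * n + 3) \<le> (8 - 3/2 * (25/18)) * (n * D) + (21/2) * (4 / 3) * n"
        by (simp only: diff_ge_0_iff_ge)
      then have "(3/50) + 9/4 * (n + 4) * (2 * n + 3) / (n * D) \<le> 8 - 3/2 * (25/18) + (21/2) * (4 / 3) / D"
        using n by (intro divided_bound) auto
      moreover have "3 * 3 * (D + 1) * (2 * n + 3) / (4 * n * D) = (4 * (9/4 * (n + 4) * (2 * n + 3))) / (4 * (n * D))"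
        by (rule arg_cong2[where f = "(/)"]) (simp_all add: n(2) algebra_simps)
      ultimately show ?thesis by simp
    qed
    have v: "1 + (1 - 4) / D = n / D" using n by (simp add: field_simps)
    have "(n / D) powr K - K * ln (n / D) \<le> 3/50 + 3 * 3 * (D + 1) * (2 * n + 3) / (4 * n * D)"
      unfolding K_def using n by (intro endpoint_bound) auto
    from order_trans[OF order_trans[OF this B] A] show ?thesis unfolding v .
  qed
qed

section \<open>Nonnegativity of the sum of \<open>d * ln (v i) - ln (u i)\<close>\<close>

text \<open>Concavity of \<open>ln\<close> on the segment from 1 to \<open>1 + a / p\<close>. It
  makes \<open>D = q\<close> the worst case in \<open>sum_log_compare\<close>.\<close>

lemma ln_scaled_mono:
  fixes a p D :: real
  assumes "0 < p" "p \<le> D" "1 + a / p > 0"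
  shows "p * ln (1 + a / p) \<le> D * ln (1 + a / D)"
proof -
  define t where "t = p / D"
  have t: "0 \<le> t" "t \<le> 1" using assms by (auto simp: t_def)
  have c: "(1 - t) * ln 1 + t * ln (1 + a / p) \<le> ln ((1 - t) *\<^sub>R 1 + t *\<^sub>R (1 + a / p))"
    using concave_onD[OF ln_concave t, of 1 "1 + a / p"] assms by simp
  have eq: "(1 - t) *\<^sub>R 1 + t *\<^sub>R (1 + a / p) = 1 + a / D"
    using assms by (simp add: t_def field_simps)
  have "t * ln (1 + a / p) \<le> ln (1 + a / D)" using c[unfolded eq] by simp
  then have "D * (t * ln (1 + a / p)) \<le> D * ln (1 + a / D)"
    using assms by (intro mult_left_mono) auto
  then show ?thesis using assms by (simp add: t_def)
qed

text \<open>The slope 2 makes 1 a critical point of the difference. The derivative of the difference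
  changes sign only at 1 and at \<open>(q + 1) / 2\<close>, which explains the range of
  \<open>u\<close>. In a sum over coordinates of mean one the linear terms cancel.\<close>

lemma tangent_log_bound:
  fixes q u :: real
  assumes q: "q \<ge> 3" and u: "0 < u" "u \<le> (q + 1) / 2"
  shows "ln u \<le> q * ln (1 + (1 - u) / q) + 2 * (u - 1)"
proof -
  define f where "f u = q * ln (1 + (1 - u) / q) + 2 * (u - 1) - ln u" for u
  have v: "1 + (1 - x) / q > 0" if "x \<le> (q + 1) / 2" for x
    using q that by (simp add: field_simps)
  have df: "(f has_real_derivative (x - 1) * ((q + 1) / 2 - x) * (2 / q) / (x * (1 + (1 - x) / q))) (at x)"
    if "0 < x" "x \<le> (q + 1) / 2" for x
  proof -
    have "((\<lambda>x. 1 + (1 - x) / q) has_real_derivative - 1 / q) (at x)"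
      using q by (auto intro!: derivative_eq_intros)
    then have "(f has_real_derivative q * (1 / (1 + (1 - x) / q) * (- 1 / q)) + 2 * (1 - 0) - 1 / x) (at x)"
      unfolding f_def using v[of x] that
      by (intro DERIV_diff DERIV_add DERIV_cmult DERIV_ident DERIV_const DERIV_ln_divide
            DERIV_chain2[OF DERIV_ln_divide]) auto
    moreover have "q * (1 / (1 + (1 - x) / q) * (- 1 / q)) + 2 * (1 - 0) - 1 / x
       = (x - 1) * ((q + 1) / 2 - x) * (2 / q) / (x * (1 + (1 - x) / q))"
    proof -
      define y where "y = 1 + (1 - x) / q"
      have "y > 0" "x = 1 + q * (1 - y)" using v[of x] that q by (auto simp: y_def field_simps)
      have "2 * (x * y) - x - y = (x - 1) * ((q + 1) / 2 - x) * (2 / q)"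
        using q by (simp add: y_def field_simps)
      moreover have "q * (1 / y * (- 1 / q)) + 2 * (1 - 0) - 1 / x = (2 * (x * y) - x - y) / (x * y)"
        using \<open>y > 0\<close> that q by (simp add: field_simps)
      ultimately show ?thesis unfolding y_def by simp
    qed
    ultimately show ?thesis by simp
  qed
  have "f 1 \<le> f u"
  proof (cases "u \<le> 1")
    case True
    show ?thesis
    proof (rule DERIV_nonpos_imp_nonincreasing[OF True, of f])
      fix x assume x: "u \<le> x" "x \<le> 1"
      then have "(x - 1) * ((q + 1) / 2 - x) * (2 / q) / (x * (1 + (1 - x) / q)) \<le> 0"
        using u q v[of x] by (intro divide_nonpos_pos mult_nonpos_nonneg mult_pos_pos) auto
      then show "\<exists>y. (f has_real_derivative y) (at x) \<and> y \<le> 0" using df[of x] x u q by fastforce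
    qed
  next
    case False
    show ?thesis
    proof (rule DERIV_nonneg_imp_nondecreasing[of 1 u f])
      show "1 \<le> u" using False by simp
      fix x assume x: "1 \<le> x" "x \<le> u"
      then have "0 \<le> (x - 1) * ((q + 1) / 2 - x) * (2 / q) / (x * (1 + (1 - x) / q))"
        using u q v[of x] by (intro divide_nonneg_pos mult_nonneg_nonneg mult_pos_pos) auto
      then show "\<exists>y. (f has_real_derivative y) (at x) \<and> 0 \<le> y" using df[of x] x u by fastforce
    qed
  qed
  then show ?thesis by (simp add: f_def)
qed

lemma sum_upto_3: "(\<Sum>i\<in>{1..3::nat}. f i) = f 1 + f 2 + f (3::nat)" for f :: "nat \<Rightarrow> real"
  by (simp add: eval_nat_numeral)

lemma sum_upto_4: "(\<Sum>i\<in>{1..4::nat}. f i) = f 1 + f 2 + f 3 + f (4::nat)" for f :: "nat \<Rightarrow> real"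
  by (simp add: eval_nat_numeral)

text \<open>The case that the tangent bound misses: a coordinate above
  \<open>(q + 1) / 2 = 2\<close>. The other two have a sum \<open>y < 1\<close>, so
  \<open>b * c \<le> y^2 / 4\<close> and \<open>(4 - b) * (4 - c) \<ge> 12\<close> are good enough,
  and a cubic inequality in \<open>y\<close> remains.\<close>

lemma log_product_large_3:
  fixes a b c :: real
  assumes pos: "a > 2" "b > 0" "c > 0" and sum: "a + b + c = 3"
  shows "ln a + ln b + ln c \<le> 3 * ln (1 + (1 - a) / 3) + 3 * ln (1 + (1 - b) / 3) + 3 * ln (1 + (1 - c) / 3)"
proof -
  define y where "y = b + c"
  have y: "0 < y" "y < 1" "a = 3 - y" using assms by (auto simp: y_def)
  have "4 * (b * c) \<le> y^2" using sum_squares_ge_zero[of "b - c" 0] by (simp add: y_def power2_eq_square algebra_simps)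
  then have bc: "b * c \<le> y^2 / 4" by simp
  have "(4 - a) * ((4 - b) * (4 - c)) = (1 + y) * (16 - 4 * y + b * c)"
    by (simp add: y y_def algebra_simps)
  moreover have "(1 + y) * 12 \<le> (1 + y) * (16 - 4 * y + b * c)"
  proof (rule mult_left_mono)
    show "12 \<le> 16 - 4 * y + b * c" using y mult_pos_pos[OF pos(2,3)] by linarith
  qed (use y in auto)
  ultimately have "4 / 9 * (1 + y) \<le> (4 - a) * ((4 - b) * (4 - c)) / 27" by simp
  then have "(4 / 9 * (1 + y))^3 \<le> ((4 - a) * ((4 - b) * (4 - c)) / 27)^3"
    using y by (intro power_mono) auto
  moreover have "a * (b * c) \<le> (4 / 9 * (1 + y))^3"
  proof -
    have "a * (b * c) \<le> (3 - y) * (y^2 / 4)" using bc y by (intro mult_mono) (use pos in auto)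
    moreover have "(4 / 9 * (1 + y))^3 - (3 - y) * (y^2 / 4) = (256 * (1 + y)^3 - 729 * ((3 - y) * y^2)) / 2916"
      by (simp add: power3_eq_cube power2_eq_square field_simps)
    \<comment> \<open>A certificate on \<open>0 < y < 1\<close>: the cubic is rewritten with
      positive coefficients in \<open>y\<close>, \<open>y^3\<close> and
      \<open>y * (1 - y)^2\<close>.\<close>
    moreover have "256 * (1 + y)^3 - 729 * ((3 - y) * y^2)
        = 256 + 117 / 2 * y + 551 / 2 * y^3 + 1419 / 2 * (y * (1 - y)^2)"
      by (simp add: power3_eq_cube power2_eq_square field_simps)
    moreover have "256 + 117 / 2 * y + 551 / 2 * y^3 + 1419 / 2 * (y * (1 - y)^2) \<ge> 0"
      using y by (intro add_nonneg_nonneg mult_nonneg_nonneg) auto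
    ultimately show ?thesis by simp
  qed
  ultimately have "ln (a * (b * c)) \<le> ln (((4 - a) * ((4 - b) * (4 - c)) / 27)^3)"
    using assms by (subst ln_le_cancel_iff) (auto intro!: mult_pos_pos zero_less_power divide_pos_pos)
  also have "((4 - a) * ((4 - b) * (4 - c)) / 27) = (1 + (1 - a) / 3) * ((1 + (1 - b) / 3) * (1 + (1 - c) / 3))"
    by (simp add: field_simps)
  also have "ln (\<dots> ^ 3) = 3 * (ln (1 + (1 - a) / 3) + (ln (1 + (1 - b) / 3) + ln (1 + (1 - c) / 3)))"
  proof -
    have "a < 4" "b < 4" "c < 4" using assms by linarith+
    then have "1 + (1 - a) / 3 > 0" "1 + (1 - b) / 3 > 0" "1 + (1 - c) / 3 > 0" by (simp_all add: field_simps)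
    then show ?thesis by (simp add: ln_realpow ln_mult_pos)
  qed
  finally show ?thesis using assms by (simp add: ln_mult)
qed

text \<open>The counterpart for \<open>q = 4\<close>, where the threshold \<open>(q + 1) / 2\<close>
  is \<open>5/2\<close> and the other three coordinates have a sum \<open>y < 3/2\<close>. Their
  product is at most \<open>y^3 / 27\<close>, and in the expansion of
  \<open>(5 - b) * (5 - c) * (5 - e)\<close> the second order terms outweigh the third order
  one.\<close>

lemma log_product_large_4:
  fixes a b c e :: real
  assumes pos: "a > 5/2" "b > 0" "c > 0" "e > 0" and sum: "a + b + c + e = 4"
  shows "ln a + ln b + ln c + ln e \<le> 4 * ln (1 + (1 - a) / 4) + 4 * ln (1 + (1 - b) / 4)
     + 4 * ln (1 + (1 - c) / 4) + 4 * ln (1 + (1 - e) / 4)"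
proof -
  define y where "y = b + c + e"
  have y: "0 < y" "y < 3/2" "a = 4 - y" using assms by (auto simp: y_def)
  define P where "P = (5 - a) * ((5 - b) * ((5 - c) * (5 - e)))"
  have "4 * (c * e) \<le> (y - b)^2"
    using zero_le_square[of "c - e"] by (simp add: y_def power2_eq_square algebra_simps)
  then have "b * (4 * (c * e)) \<le> b * (y - b)^2" using pos by (intro mult_left_mono) auto
  moreover have "27 * (b * (y - b)^2) \<le> 4 * y^3"
  proof -
    \<comment> \<open>The factorisation proves the inequality of arithmetic and geometric means for
      three numbers, with equality at \<open>b = y / 3\<close>.\<close>
    have "4 * y^3 - 27 * (b * (y - b)^2) = (y - 3 * b)^2 * (4 * y - 3 * b)"
      by (simp add: power3_eq_cube power2_eq_square algebra_simps)
    moreover have "(y - 3 * b)^2 * (4 * y - 3 * b) \<ge> 0" using pos by (simp add: y_def)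
    ultimately show ?thesis by simp
  qed
  ultimately have bce: "b * (c * e) \<le> y^3 / 27" by simp
  have "(5 - b) * ((5 - c) * (5 - e)) \<ge> 125 - 25 * y"
  proof -
    have "b * (c * e) \<le> 5 * (c * e)" using pos y by (intro mult_right_mono) (auto simp: y_def)
    moreover have "b * c > 0" "b * e > 0" using pos by auto
    ultimately show ?thesis by (simp add: y_def algebra_simps)
  qed
  then have "(1 + y) * (125 - 25 * y) \<le> (1 + y) * ((5 - b) * ((5 - c) * (5 - e)))"
    using y by (intro mult_left_mono) auto
  moreover have "(1 + y) * (125 - 25 * y) = 125 + 125/2 * y + 25 * (y * (3/2 - y))"
    by (simp add: algebra_simps)
  moreover have "y * (3/2 - y) \<ge> 0" using y by simp
  ultimately have "125 * (1 + y / 2) \<le> P" by (simp add: P_def y)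
  then have "(125/256 * (1 + y / 2))^4 \<le> (P / 256)^4" using y by (intro power_mono) auto
  moreover have "a * (b * (c * e)) \<le> (125/256 * (1 + y / 2))^4"
  proof -
    have "a * (b * (c * e)) \<le> (4 - y) * (y^3 / 27)" using bce y by (intro mult_mono) (use pos in auto)
    also have "\<dots> = y * (4 - y) * (y^2 / 27)" by (simp add: power3_eq_cube power2_eq_square)
    also have "\<dots> \<le> 15/4 * (y^2 / 27)"
    proof (rule mult_right_mono)
      have "15/4 - y * (4 - y) = (3/2 - y) * (5/2 - y)" by (simp add: algebra_simps)
      moreover have "(3/2 - y) * (5/2 - y) \<ge> 0" using y by simp
      ultimately show "y * (4 - y) \<le> 15/4" by linarith
    qed simp
    also have "15/4 * (y^2 / 27) \<le> 14/250 * (1 + 2 * y + 3/2 * y^2)"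
    proof -
      have "15/4 * (z / 27) \<le> 14/250 * (1 + 2 * y + 3/2 * z)" if "z \<le> 3/2 * y" for z
        using that y by simp
      moreover have "y * y \<le> 3/2 * y" using y by (intro mult_right_mono) auto
      ultimately show ?thesis unfolding power2_eq_square by blast
    qed
    also have "\<dots> \<le> (125/256)^4 * (1 + y / 2)^4"
    proof (rule mult_mono)
      have "(1 + y / 2)^4 = 1 + 2 * y + 3/2 * y^2 + y^3 / 2 + y^4 / 16"
        by (simp add: eval_nat_numeral field_simps)
      then show "1 + 2 * y + 3/2 * y^2 \<le> (1 + y / 2)^4" using y by simp
      show "14/250 \<le> (125/256 :: real)^4" by (simp add: power_divide)
    qed (use y in auto)
    finally show ?thesis by (simp only: power_mult_distrib)
  qed
  ultimately have "ln (a * (b * (c * e))) \<le> ln ((P / 256)^4)"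
    using assms by (subst ln_le_cancel_iff) (auto simp: P_def intro!: mult_pos_pos zero_less_power divide_pos_pos)
  also have "P / 256 = (1 + (1 - a) / 4) * ((1 + (1 - b) / 4) * ((1 + (1 - c) / 4) * (1 + (1 - e) / 4)))"
    by (simp add: P_def field_simps)
  also have "ln (\<dots> ^ 4) = 4 * (ln (1 + (1 - a) / 4) + (ln (1 + (1 - b) / 4) + (ln (1 + (1 - c) / 4) + ln (1 + (1 - e) / 4))))"
  proof -
    have "a < 5" "b < 5" "c < 5" "e < 5" using assms by linarith+
    then have "1 + (1 - a) / 4 > 0" "1 + (1 - b) / 4 > 0" "1 + (1 - c) / 4 > 0" "1 + (1 - e) / 4 > 0"
      by (simp_all add: field_simps)
    then show ?thesis by (simp add: ln_realpow ln_mult_pos)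
  qed
  finally show ?thesis using assms by (simp add: ln_mult)
qed

text \<open>If no coordinate exceeds \<open>(q + 1) / 2\<close>, the tangent bounds add up.
  Otherwise the offending coordinate is singled out and \<open>log_product_large_3\<close> or
  \<open>log_product_large_4\<close> applies. The passage from \<open>q\<close> to \<open>D\<close>
  is \<open>ln_scaled_mono\<close>.\<close>

lemma sum_log_compare:
  fixes u :: "nat \<Rightarrow> real" and D :: real
  assumes q: "q \<in> {3, 4}" and D: "D \<ge> real q"
    and u: "\<And>i. i \<in> {1..q} \<Longrightarrow> u i > 0" "(\<Sum>i\<in>{1..q}. u i) = real q"
  shows "(\<Sum>i\<in>{1..q}. ln (u i)) \<le> (\<Sum>i\<in>{1..q}. D * ln (1 + (1 - u i) / D))"
proof -
  have uq: "u i \<le> real q" if "i \<in> {1..q}" for i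
    using member_le_sum[of i "{1..q}" u] u that by (simp add: less_imp_le)
  have "(\<Sum>i\<in>{1..q}. ln (u i)) \<le> (\<Sum>i\<in>{1..q}. real q * ln (1 + (1 - u i) / real q))"
  proof (cases "\<forall>i\<in>{1..q}. u i \<le> (real q + 1) / 2")
    case True
    have "(\<Sum>i\<in>{1..q}. ln (u i)) \<le> (\<Sum>i\<in>{1..q}. real q * ln (1 + (1 - u i) / real q) + 2 * (u i - 1))"
      using True u q by (intro sum_mono tangent_log_bound) auto
    also have "\<dots> = (\<Sum>i\<in>{1..q}. real q * ln (1 + (1 - u i) / real q))"
      using u(2) by (simp add: sum.distrib sum_subtractf flip: sum_distrib_left)
    finally show ?thesis .
  next
    case False
    then obtain i where i: "i \<in> {1..q}" "u i > (real q + 1) / 2" by force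
    from q consider "q = 3" | "q = 4" by auto
    then show ?thesis
    proof cases
      case 1
      have p: "u 1 > 0" "u 2 > 0" "u 3 > 0" "u 1 + u 2 + u 3 = 3"
        using u 1 sum_upto_3[of u] by auto
      have "i = 1 \<or> i = 2 \<or> i = 3" using i(1) 1 by auto
      then show ?thesis
        using i(2) p log_product_large_3[of "u 1" "u 2" "u 3"]
          log_product_large_3[of "u 2" "u 1" "u 3"] log_product_large_3[of "u 3" "u 1" "u 2"]
        unfolding 1 sum_upto_3 by auto
    next
      case 2
      have p: "u 1 > 0" "u 2 > 0" "u 3 > 0" "u 4 > 0" "u 1 + u 2 + u 3 + u 4 = 4"
        using u 2 sum_upto_4[of u] by auto
      have "i = 1 \<or> i = 2 \<or> i = 3 \<or> i = 4" using i(1) 2 by auto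
      then show ?thesis
        using i(2) p log_product_large_4[of "u 1" "u 2" "u 3" "u 4"] log_product_large_4[of "u 2" "u 1" "u 3" "u 4"]
          log_product_large_4[of "u 3" "u 1" "u 2" "u 4"] log_product_large_4[of "u 4" "u 1" "u 2" "u 3"]
        unfolding 2 sum_upto_4 by auto
    qed
  qed
  also have "\<dots> \<le> (\<Sum>i\<in>{1..q}. D * ln (1 + (1 - u i) / D))"
  proof (intro sum_mono ln_scaled_mono)
    fix i assume "i \<in> {1..q}"
    then have "u i \<le> real q" by (rule uq)
    then show "1 + (1 - u i) / real q > 0" using q by (auto simp: field_simps)
  qed (use q D in auto)
  finally show ?thesis .
qed

section \<open>Lyapunov functions of the message map\<close>

definition message :: "nat \<Rightarrow> real \<Rightarrow> (nat \<Rightarrow> real) \<Rightarrow> nat \<Rightarrow> real" where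
  "message q w u i = (\<Sum>j\<in>{1..q}. (if j = i then w else 1) * u j)"

text \<open>A posynomial of geometric programming in logarithmic variables: at
  \<open>x i = ln (u i)\<close> it is a sum of monomials in the \<open>u i\<close> with real
  exponents. For nonnegative \<open>a\<close> it is convex in \<open>x\<close>.\<close>

definition posynomial :: "nat \<Rightarrow> 'k set \<Rightarrow> ('k \<Rightarrow> real) \<Rightarrow> ('k \<Rightarrow> nat \<Rightarrow> real) \<Rightarrow> (nat \<Rightarrow> real) \<Rightarrow> real" where
  "posynomial q I a c x = (\<Sum>k\<in>I. a k * exp (\<Sum>i\<in>{1..q}. c k i * x i))"

lemma message_eq:
  assumes "i \<in> {1..q}"
  shows "message q w u i = (\<Sum>j\<in>{1..q}. u j) - (1 - w) * u i"
proof -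
  have "message q w u i = (\<Sum>j\<in>{1..q}. u j - (1 - w) * (if j = i then u j else 0))"
    unfolding message_def by (intro sum.cong) (auto simp: algebra_simps)
  also have "\<dots> = (\<Sum>j\<in>{1..q}. u j) - (1 - w) * u i"
    using assms by (simp add: sum_subtractf sum.delta flip: sum_distrib_left)
  finally show ?thesis .
qed

section \<open>Strict decrease of the power function for \<open>d \<ge> q\<close>\<close>

lemma powr_bernoulli:
  fixes x p :: real
  assumes "x > 0" "p > 1"
  shows "1 + p * (x - 1) \<le> x powr p"
proof -
  define s where "s = 1 / p"
  have s: "0 \<le> s" "s \<le> 1" "s * p = 1" using assms by (auto simp: s_def)
  have c: "(1 - s) * ln 1 + s * ln (x powr p) \<le> ln ((1 - s) *\<^sub>R 1 + s *\<^sub>R (x powr p))"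
    using concave_onD[OF ln_concave s(1,2), of 1 "x powr p"] assms by simp
  have "s * ln (x powr p) = ln x" proof -
    have "s * ln (x powr p) = (s * p) * ln x" using assms by (simp add: ln_powr)
    then show ?thesis using s(3) by simp
  qed
  with c have "ln x \<le> ln ((1 - s) + s * x powr p)" by (simp only: ln_one real_scaleR_def mult_zero_right add_0_left mult_1_right)
  moreover have "(1 - s) + s * x powr p > 0"
    using s assms by (intro add_nonneg_pos) (auto simp: s_def)
  ultimately have "x \<le> (1 - s) + s * x powr p" using assms by (subst (asm) ln_le_cancel_iff) auto
  then have "p * x \<le> p * ((1 - s) + s * x powr p)" using assms by simp
  also have "\<dots> = p - 1 + x powr p" using assms by (simp add: s_def field_simps)
  finally show ?thesis by (simp add: algebra_simps)
qed

text \<open>Moving \<open>z\<close> towards 1 lowers \<open>z powr K - K * ln z\<close>, on this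
  side and, by \<open>one_plus_ln_mono\<close>, on the other. So a message coefficient
  \<open>t\<close> below \<open>1 / d\<close> is no worse than the critical
  \<open>1 / d\<close>.\<close>

lemma one_minus_ln_mono:
  fixes x y :: real
  assumes "0 < x" "x \<le> y" "y \<le> 1" "K > 0"
  shows "y powr K - K * ln y \<le> x powr K - K * ln x"
proof -
  define f where "f z = z powr K - K * ln z" for z
  have "f y \<le> f x"
  proof (rule DERIV_nonpos_imp_nonincreasing[OF assms(2)])
    fix z assume z: "x \<le> z" "z \<le> y"
    have "(f has_real_derivative K * z powr (K - 1) - K * (1 / z)) (at z)"
      unfolding f_def using z assms
      by (intro DERIV_diff DERIV_cmult DERIV_ln_divide has_real_derivative_powr) auto
    moreover have "K * z powr (K - 1) - K * (1 / z) = K / z * (z powr K - 1)"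
      using z assms by (simp add: powr_diff field_simps)
    moreover have "z powr K \<le> 1" using z assms by (simp add: powr_le1)
    then have "K / z * (z powr K - 1) \<le> 0" using z assms by (intro mult_nonneg_nonpos) auto
    ultimately show "\<exists>d. (f has_real_derivative d) (at z) \<and> d \<le> 0" by auto
  qed
  then show ?thesis by (simp add: f_def)
qed

lemma one_plus_ln_mono:
  fixes x y :: real
  assumes "1 \<le> x" "x \<le> y" "K > 0"
  shows "x powr K - K * ln x \<le> y powr K - K * ln y"
proof -
  define f where "f z = z powr K - K * ln z" for z
  have "f x \<le> f y"
  proof (rule DERIV_nonneg_imp_nondecreasing[OF assms(2)])
    fix z assume z: "x \<le> z" "z \<le> y"
    have "(f has_real_derivative K * z powr (K - 1) - K * (1 / z)) (at z)"
      unfolding f_def using z assms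
      by (intro DERIV_diff DERIV_cmult DERIV_ln_divide has_real_derivative_powr) auto
    moreover have "K * z powr (K - 1) - K * (1 / z) = K / z * (z powr K - 1)"
      using z assms by (simp add: powr_diff field_simps)
    moreover have "z powr K \<ge> 1" using z assms by (intro ge_one_powr_ge_zero) auto
    then have "K / z * (z powr K - 1) \<ge> 0" using z assms by (intro mult_nonneg_nonneg) auto
    ultimately show "\<exists>d. (f has_real_derivative d) (at z) \<and> 0 \<le> d" by auto
  qed
  then show ?thesis by (simp add: f_def)
qed

lemma exp_diff_powr:
  fixes x :: real
  assumes "x > 0"
  shows "exp (p * ln x - y) = x powr p * exp (- y)"
  using assms by (simp add: powr_def flip: exp_add)

text \<open>Since \<open>K = \<theta> * d\<close>, the left side is the power function at the
  \<open>d\<close>-th powers of the \<open>v i\<close>. Adding the coordinatewise comparison gives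
  \<open>A < B + X\<close> for the two power sums, where
  \<open>X = (\<Sum>i. K * ln (v i) - \<theta> * ln (u i))\<close>. As \<open>X \<ge> 0\<close> and
  \<open>B \<ge> q\<close>, the additive gain is at most a factor:
  \<open>B + X \<le> B * exp (X / q)\<close>, and this factor is exactly the quotient of the
  geometric mean normalisations.\<close>

lemma power_lyapunov:
  fixes u :: "nat \<Rightarrow> real" and d q :: nat and t :: real
  assumes q: "q \<in> {3, 4}" and d: "d \<ge> q" and t: "0 < t" "t \<le> 1 / real d"
    and u: "\<And>i. i \<in> {1..q} \<Longrightarrow> u i > 0" "(\<Sum>i\<in>{1..q}. u i) = real q"
    and ne: "\<exists>i\<in>{1..q}. u i \<noteq> 1"
  defines "K \<equiv> 3 * (real d + 1) / 2" and "\<theta> \<equiv> 3 * (real d + 1) / (2 * real d)"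
    and "v \<equiv> \<lambda>i. 1 + t * (1 - u i)"
  shows "(\<Sum>i\<in>{1..q}. exp (K * ln (v i) - K / q * (\<Sum>j\<in>{1..q}. ln (v j))))
     < (\<Sum>i\<in>{1..q}. exp (\<theta> * ln (u i) - \<theta> / q * (\<Sum>j\<in>{1..q}. ln (u j))))"
proof -
  define D where "D = real d"
  have D: "D \<ge> 3" "real q \<le> D" "D > 0" using q d by (auto simp: D_def)
  have K: "K > 0" "K = \<theta> * D" "\<theta> > 1" using D by (auto simp: K_def \<theta>_def D_def field_simps)
  have uq: "u i \<le> real q" if "i \<in> {1..q}" for i
    using member_le_sum[of i "{1..q}" u] u that by (simp add: less_imp_le)
  have v1: "1 + (1 - u i) / D > 0" if "i \<in> {1..q}" for i
    using uq[OF that] D by (simp add: field_simps)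
  \<comment> \<open>\<open>v i\<close> interpolates with weight \<open>r\<close> between 1 and its
    critical value \<open>1 + (1 - u i) / D\<close>, so concavity of \<open>ln\<close> handles all
    subcritical \<open>t\<close>.\<close>
  define r where "r = t * D"
  have r: "0 < r" "r \<le> 1" using t D by (auto simp: r_def D_def field_simps)
  have vr: "v i = (1 - r) * 1 + r * (1 + (1 - u i) / D)" for i
    using D by (simp add: v_def r_def field_simps)
  have vpos: "v i > 0" if "i \<in> {1..q}" for i
    unfolding vr using mult_pos_pos[OF r(1) v1[OF that]] r(2) by (intro add_nonneg_pos) auto
  have Qend: "(1 + (1 - real q) / D) powr K - K * ln (1 + (1 - real q) / D) \<le> real q powr \<theta> - \<theta> * ln (real q)"
  proof -
    from q consider "q = 3" | "q = 4" by auto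
    then show ?thesis
    proof cases
      case 1
      then have "real q = 3" "d \<ge> 3" using d by auto
      then show ?thesis using endpoint_3[of d] by (simp only: K_def \<theta>_def D_def)
    next
      case 2
      then have "real q = 4" "d \<ge> 4" using d by auto
      then show ?thesis using endpoint_4[of d] by (simp only: K_def \<theta>_def D_def)
    qed
  qed
  have comp: "v i powr K - K * ln (v i) \<le> u i powr \<theta> - \<theta> * ln (u i)"
    "u i < 1 \<Longrightarrow> v i powr K - K * ln (v i) < u i powr \<theta> - \<theta> * ln (u i)" if i: "i \<in> {1..q}" for i
  proof -
    have "v i powr K - K * ln (v i) \<le> (1 + (1 - u i) / D) powr K - K * ln (1 + (1 - u i) / D)"
    proof (cases "u i \<le> 1")
      case True
      have "0 \<le> t * (1 - u i)" using True t by simp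
      moreover have "t * (1 - u i) \<le> 1 / D * (1 - u i)"
        unfolding D_def using True t by (intro mult_right_mono) auto
      ultimately show ?thesis using K by (intro one_plus_ln_mono) (auto simp: v_def)
    next
      case False
      have "1 / D * (1 - u i) \<le> t * (1 - u i)"
        unfolding D_def using False t by (intro mult_right_mono_neg) auto
      moreover have "t * (1 - u i) \<le> 0" using False t by (simp add: mult_nonneg_nonpos)
      ultimately show ?thesis using K v1[OF i] by (intro one_minus_ln_mono) (auto simp: v_def)
    qed
    moreover have "real q > 1" using q by auto
    ultimately show "v i powr K - K * ln (v i) \<le> u i powr \<theta> - \<theta> * ln (u i)"
      "u i < 1 \<Longrightarrow> v i powr K - K * ln (v i) < u i powr \<theta> - \<theta> * ln (u i)"
      using power_log_compare[OF D(1) \<open>real q > 1\<close> D(2) u(1)[OF i] uq[OF i]] Qend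
      unfolding K_def \<theta>_def D_def by (blast intro: order_trans order_le_less_trans)+
  qed
  define A where "A = (\<Sum>i\<in>{1..q}. v i powr K)"
  define B where "B = (\<Sum>i\<in>{1..q}. u i powr \<theta>)"
  define X where "X = (\<Sum>i\<in>{1..q}. K * ln (v i) - \<theta> * ln (u i))"
  \<comment> \<open>The strict comparison is available only below 1; a nonconstant vector of mean
    one has such a coordinate.\<close>
  have "\<exists>i\<in>{1..q}. u i < 1"
  proof (rule ccontr)
    assume a: "\<not> ?thesis"
    from ne obtain i where i: "i \<in> {1..q}" "u i \<noteq> 1" by auto
    with a have "1 < u i" by force
    with a i have "(\<Sum>i\<in>{1..q}. 1) < (\<Sum>i\<in>{1..q}. u i)"
      by (intro sum_strict_mono_ex1) (auto simp: not_less intro!: bexI[of _ i])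
    with u(2) show False by simp
  qed
  then obtain i0 where "i0 \<in> {1..q}" "u i0 < 1" by auto
  then have "(\<Sum>i\<in>{1..q}. v i powr K - K * ln (v i)) < (\<Sum>i\<in>{1..q}. u i powr \<theta> - \<theta> * ln (u i))"
    using comp by (intro sum_strict_mono_ex1 ballI bexI[of _ i0]) auto
  then have AB: "A < B + X" by (simp add: A_def B_def X_def sum_subtractf)
  have X0: "X \<ge> 0"
  proof -
    have "(\<Sum>i\<in>{1..q}. ln (u i)) \<le> (\<Sum>i\<in>{1..q}. D * ln (1 + (1 - u i) / D))"
      using q D u by (intro sum_log_compare) auto
    also have "\<dots> \<le> (\<Sum>i\<in>{1..q}. D * ln (v i))"
    proof -
      have *: "r * ln (1 + (1 - u i) / D) \<le> ln (v i)" if "i \<in> {1..q}" for i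
        using concave_onD[OF ln_concave, of r 1 "1 + (1 - u i) / D"] r v1[OF that] unfolding vr by simp
      \<comment> \<open>The critical logarithms have a nonpositive sum, so multiplying it by
        \<open>r \<le> 1\<close> can only increase it.\<close>
      have "(\<Sum>i\<in>{1..q}. ln (1 + (1 - u i) / D)) \<le> (\<Sum>i\<in>{1..q}. (1 - u i) / D)"
      proof (intro sum_mono ln_add_one_self_le_self2)
        fix i assume "i \<in> {1..q}"
        from v1[OF this] show "- 1 < (1 - u i) / D" by linarith
      qed
      also have "\<dots> = 0" using u(2) by (simp add: sum_subtractf flip: sum_divide_distrib)
      finally have "(1 - r) * (\<Sum>i\<in>{1..q}. ln (1 + (1 - u i) / D)) \<le> 0"
        using r by (simp add: mult_nonneg_nonpos)
      then have "(\<Sum>i\<in>{1..q}. ln (1 + (1 - u i) / D)) \<le> (\<Sum>i\<in>{1..q}. r * ln (1 + (1 - u i) / D))"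
        by (simp add: left_diff_distrib flip: sum_distrib_left)
      also have "\<dots> \<le> (\<Sum>i\<in>{1..q}. ln (v i))" using * by (intro sum_mono)
      finally show ?thesis using D by (simp flip: sum_distrib_left)
    qed
    finally have "0 \<le> \<theta> * ((\<Sum>i\<in>{1..q}. D * ln (v i)) - (\<Sum>i\<in>{1..q}. ln (u i)))" using K by simp
    then show ?thesis by (simp add: X_def K(2) sum_subtractf sum_distrib_left algebra_simps)
  qed
  \<comment> \<open>Bernoulli at mean one gives \<open>B \<ge> q\<close>, which allows
    \<open>X\<close> to be replaced by \<open>B * X / q\<close>.\<close>
  have "B \<ge> (\<Sum>i\<in>{1..q}. 1 + \<theta> * (u i - 1))"
    unfolding B_def
  proof (intro sum_mono)
    fix i assume "i \<in> {1..q}"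
    then have "u i > 0" by (rule u)
    then show "1 + \<theta> * (u i - 1) \<le> u i powr \<theta>"
      using K by (intro powr_bernoulli) auto
  qed
  then have Bq: "B \<ge> real q" using u(2) by (simp add: sum.distrib sum_subtractf flip: sum_distrib_left)
  have qpos: "real q > 0" using q by auto
  have "B + X \<le> B * (1 + X / q)"
    using mult_right_mono[OF Bq, of "X / q"] X0 qpos by (simp add: algebra_simps)
  also have "\<dots> \<le> B * exp (X / q)" using Bq qpos by (intro mult_left_mono exp_ge_add_one_self) auto
  finally have main: "A < B * exp (X / q)" using AB by linarith
  have "(\<Sum>i\<in>{1..q}. exp (K * ln (v i) - K / q * (\<Sum>j\<in>{1..q}. ln (v j))))
      = A * exp (- (K / q * (\<Sum>j\<in>{1..q}. ln (v j))))"
    unfolding A_def sum_distrib_right by (intro sum.cong refl exp_diff_powr vpos)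
  also have "\<dots> < B * exp (X / q) * exp (- (K / q * (\<Sum>j\<in>{1..q}. ln (v j))))"
    using main by (intro mult_strict_right_mono) auto
  also have "\<dots> = B * exp (X / q - K / q * (\<Sum>j\<in>{1..q}. ln (v j)))"
    by (simp add: mult.assoc flip: exp_add)
  also have "X / q - K / q * (\<Sum>j\<in>{1..q}. ln (v j)) = - (\<theta> / q * (\<Sum>j\<in>{1..q}. ln (u j)))"
    by (simp add: X_def sum_subtractf diff_divide_distrib flip: sum_distrib_left)
  also have "B * exp (- (\<theta> / q * (\<Sum>j\<in>{1..q}. ln (u j))))
     = (\<Sum>i\<in>{1..q}. exp (\<theta> * ln (u i) - \<theta> / q * (\<Sum>j\<in>{1..q}. ln (u j))))"
    unfolding B_def sum_distrib_right by (intro sum.cong refl exp_diff_powr[symmetric] u(1))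
  finally show ?thesis .
qed

section \<open>Strict decrease of the cubic function for \<open>q = 3\<close> and
  \<open>d = 2\<close>\<close>

text \<open>The bound on \<open>b\<close> says that the cubic \<open>T^3 - a T - b\<close> has
  nonnegative discriminant, as holds when its roots \<open>x\<close>, \<open>y\<close>,
  \<open>z\<close> are real. \<open>F\<close> is right minus left. For \<open>b \<ge> 0\<close> all
  its terms are nonnegative; for \<open>b < 0\<close> it is smallest at the least admissible
  \<open>b\<close>, where the discriminant vanishes.\<close>

lemma cubic_core:
  fixes a b :: real
  assumes a: "0 < a" "a < 3/4" and b: "27 * b^2 \<le> 4 * a^3"
  shows "(1 - 4 * a - 8 * b) * (12 + 72 * a + 96 * b + 60 * a^2 + 54 * a * b + 6 * a^3 + 3 * b^2)
     < (12 + 48 * a - 24 * b) * (1 - a + b)^2"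
proof -
  define F where "F b = 144 * a^2 + 1026 * a * b + 729 * b^2 + 282 * a^3 + 576 * a^2 * b
     + 540 * a * b^2 + 24 * a^4 + 48 * a^3 * b" for b
  have "F b > 0"
  proof (cases "b \<ge> 0")
    case True
    have "144 * a^2 > 0" using a by simp
    moreover have "1026 * a * b + 729 * b^2 + 282 * a^3 + 576 * a^2 * b
     + 540 * a * b^2 + 24 * a^4 + 48 * a^3 * b \<ge> 0" using a True by simp
    ultimately show ?thesis unfolding F_def by linarith
  next
    case False
    \<comment> \<open>With \<open>a = 3 * c^2\<close> the least admissible \<open>b\<close> is
      \<open>- 2 * c^3\<close>, which belongs to the roots \<open>c\<close>, \<open>c\<close> and
      \<open>- 2 * c\<close>.\<close>
    define c where "c = sqrt (a / 3)"
    have c: "0 < c" "a = 3 * c^2" using a by (auto simp: c_def)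
    have "c^2 < (1/2)^2" using a c by (simp add: power2_eq_square)
    then have c2: "c < 1/2" by (rule power2_less_imp_less) simp
    define n where "n = 2 * c^3"
    have "b^2 \<le> n^2" using b by (simp add: c n_def power_mult_distrib flip: power_mult)
    then have bn: "- n \<le> b" using c abs_le_square_iff[of b n] by (simp add: n_def)
    have "F b - F (- n) = (b + n) * ((1026 * a + 576 * a^2 + 48 * a^3) - (729 + 540 * a) * (n - b))"
      by (simp add: F_def power2_eq_square algebra_simps)
    moreover have "(729 + 540 * a) * (n - b) \<le> 1026 * a + 576 * a^2 + 48 * a^3"
    proof -
      have "(729 + 540 * a) * (n - b) \<le> (729 + 540 * a) * (4 * c^3)"
        using a bn by (intro mult_left_mono) (auto simp: n_def)
      moreover have "1026 * a + 576 * a^2 + 48 * a^3 - (729 + 540 * a) * (4 * c^3)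
         = c^2 * (3078 - 2916 * c + 5184 * c^2 - 6480 * c^3 + 1296 * c^4)"
        by (simp add: c eval_nat_numeral algebra_simps)
      moreover have "3078 - 2916 * c + 5184 * c^2 - 6480 * c^3 + 1296 * c^4 \<ge> 0"
      proof -
        have "c^2 * c \<le> c^2 * (1/2)" using c2 c by (intro mult_left_mono) auto
        then have "6480 * c^3 \<le> 5184 * c^2 * (5/8)" by (simp add: power3_eq_cube power2_eq_square)
        moreover have "c^2 * (5/8) \<le> c^2" "c^4 \<ge> 0" by auto
        ultimately show ?thesis using c2 by linarith
      qed
      then have "c^2 * (3078 - 2916 * c + 5184 * c^2 - 6480 * c^3 + 1296 * c^4) \<ge> 0" by simp
      ultimately show ?thesis by linarith
    qed
    then have "(b + n) * ((1026 * a + 576 * a^2 + 48 * a^3) - (729 + 540 * a) * (n - b)) \<ge> 0"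
      using bn by simp
    ultimately have "F (- n) \<le> F b" by linarith
    \<comment> \<open>The double zero at \<open>c = 1/2\<close> is the boundary case in which two of
      the weights \<open>1 - 2 * x\<close> vanish; \<open>a < 3/4\<close> excludes it.\<close>
    moreover have "F (- n) = c^4 * ((1 - 2 * c)^2 * (1296 - 972 * c + 1458 * c^2 - 648 * c^3))"
      by (simp add: F_def c n_def eval_nat_numeral algebra_simps)
    moreover have "1296 - 972 * c + 1458 * c^2 - 648 * c^3 > 0"
    proof -
      have "c^2 * c \<le> c^2 * (1/2)" using c2 c by (intro mult_left_mono) auto
      then have "c^3 \<le> c^2 * (1/2)" by (simp add: power3_eq_cube power2_eq_square)
      moreover have "c^2 \<ge> 0" by simp
      ultimately show ?thesis using c2 by linarith
    qed
    then have "c^4 * ((1 - 2 * c)^2 * (1296 - 972 * c + 1458 * c^2 - 648 * c^3)) > 0" using c c2 by simp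
    ultimately show ?thesis by linarith
  qed
  moreover have "(12 + 48 * a - 24 * b) * (1 - a + b)^2 -
     (1 - 4 * a - 8 * b) * (12 + 72 * a + 96 * b + 60 * a^2 + 54 * a * b + 6 * a^3 + 3 * b^2) = F b"
    by (simp add: F_def eval_nat_numeral algebra_simps)
  ultimately show ?thesis by linarith
qed

text \<open>For weights of mean one, \<open>x = (1 - u1) / 2\<close> and \<open>s\<close> is twice
  the message coefficient, so \<open>s = 1\<close> is critical. As \<open>x + y + z = 0\<close>,
  both sides are functions of \<open>a\<close> and \<open>b\<close>. The numerator satisfies
  \<open>N s \<le> N 1\<close> and the product of the messages satisfies
  \<open>X s \<ge> X 1 > 0\<close>, which reduces everything to \<open>s = 1\<close>, that is to
  \<open>cubic_core\<close>.\<close>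

lemma cubic_lyapunov:
  fixes x y z s :: real
  assumes sum: "x + y + z = 0" and pos: "x < 1/2" "y < 1/2" "z < 1/2" and ne: "x \<noteq> 0 \<or> y \<noteq> 0 \<or> z \<noteq> 0"
    and s: "0 < s" "s \<le> 1"
  defines "v1 \<equiv> 1 + s * x" and "v2 \<equiv> 1 + s * y" and "v3 \<equiv> 1 + s * z"
    and "u1 \<equiv> 1 - 2 * x" and "u2 \<equiv> 1 - 2 * y" and "u3 \<equiv> 1 - 2 * z"
  shows "((v1^6 + v2^6 + v3^6) + (v1^2 + v2^2 + v3^2) * (v1^4 + v2^4 + v3^4)) / (v1 * v2 * v3)^2
    < ((u1^3 + u2^3 + u3^3) + (u1 + u2 + u3) * (u1^2 + u2^2 + u3^2)) / (u1 * u2 * u3)"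
proof -
  define a where "a = - (x * y + y * z + z * x)"
  define b where "b = x * y * z"
  have z: "z = - x - y" using sum by simp
  have u: "u1 > 0" "u2 > 0" "u3 > 0" using pos by (auto simp: u1_def u2_def u3_def)
  have a2: "2 * a = x^2 + y^2 + z^2" by (simp add: a_def z power2_eq_square algebra_simps)
  have "x^2 + y^2 + z^2 > 0" using ne by (smt (verit) zero_less_power2 zero_le_power2)
  then have a: "a > 0" using a2 by simp
  have "u1 * u2 + u2 * u3 + u3 * u1 > 0" using u by (simp add: add_pos_pos)
  moreover have "u1 * u2 + u2 * u3 + u3 * u1 = 3 - 4 * a"
    by (simp add: u1_def u2_def u3_def a_def z algebra_simps)
  ultimately have a3: "a < 3/4" by simp
  have "4 * a^3 - 27 * b^2 = ((x - y) * (y - z) * (z - x))^2"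
    by (simp add: a_def b_def z eval_nat_numeral algebra_simps)
  moreover have "((x - y) * (y - z) * (z - x))^2 \<ge> 0" by simp
  ultimately have disc: "27 * b^2 \<le> 4 * a^3" by linarith
  have "b^2 \<le> (a / 3)^2"
  proof -
    have "a^2 * a \<le> a^2 * (3/4)" using a3 by (intro mult_left_mono) auto
    then show ?thesis using disc by (simp add: power3_eq_cube power2_eq_square)
  qed
  then have ba: "\<bar>b\<bar> \<le> a / 3" using a abs_le_square_iff[of b "a/3"] by simp
  define N where "N s = 12 + 72 * (s^2 * a) + 96 * (s^3 * b) + 60 * (s^4 * a^2) + 54 * (s^5 * (a * b))
     + 6 * (s^6 * a^3) + 3 * (s^6 * b^2)" for s
  define X where "X s = 1 - s^2 * a + s^3 * b" for s
  have eN: "(v1^6 + v2^6 + v3^6) + (v1^2 + v2^2 + v3^2) * (v1^4 + v2^4 + v3^4) = N s"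
    unfolding v1_def v2_def v3_def N_def a_def b_def z by algebra
  have eX: "v1 * v2 * v3 = X s"
    unfolding v1_def v2_def v3_def X_def a_def b_def z by algebra
  have eU: "(u1^3 + u2^3 + u3^3) + (u1 + u2 + u3) * (u1^2 + u2^2 + u3^2) = 12 + 48 * a - 24 * b"
    unfolding u1_def u2_def u3_def a_def b_def z by algebra
  have eY: "u1 * u2 * u3 = 1 - 4 * a - 8 * b"
    unfolding u1_def u2_def u3_def a_def b_def z by algebra
  have Y: "1 - 4 * a - 8 * b > 0" using u eY by (metis mult_pos_pos)
  have sk: "s^k \<le> 1" "0 \<le> s^k" for k :: nat using s by (auto simp: power_le_one)
  \<comment> \<open>With \<open>\<bar>b\<bar> \<le> a / 3\<close>, this and \<open>d5\<close> let
    the terms linear in \<open>b\<close>, of unknown sign, be absorbed by the neighbouring terms in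
    \<open>a\<close>.\<close>
  have d3: "2 * (1 - s^3) \<le> 3 * (1 - s^2)"
  proof -
    have "3 * (1 - s^2) - 2 * (1 - s^3) = (1 - s)^2 * (1 + 2 * s)"
      by (simp add: power3_eq_cube power2_eq_square algebra_simps)
    moreover have "(1 - s)^2 * (1 + 2 * s) \<ge> 0" using s by simp
    ultimately show ?thesis by linarith
  qed
  have d5: "1 - s^5 \<le> 2 * (1 - s^4)"
  proof -
    have "2 * (1 - s^4) - (1 - s^5) = (1 - s) * (1 + s + s^2 + s^3 - s^4)"
      by (simp add: eval_nat_numeral algebra_simps)
    moreover have "(1 - s) * (1 + s + s^2 + s^3 - s^4) \<ge> 0"
    proof (rule mult_nonneg_nonneg)
      show "0 \<le> 1 + s + s^2 + s^3 - s^4" using s sk[of 4] sk[of 2] sk[of 3] by linarith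
    qed (use s in simp)
    ultimately show ?thesis by linarith
  qed
  have bs: "\<bar>(1 - s^3) * b\<bar> \<le> 1/2 * ((1 - s^2) * a)"
  proof -
    have "\<bar>(1 - s^3) * b\<bar> = (1 - s^3) * \<bar>b\<bar>" using sk[of 3] by (simp add: abs_mult)
    also have "\<dots> \<le> (3/2 * (1 - s^2)) * (a / 3)"
      using d3 ba a sk[of 3] sk[of 2] by (intro mult_mono) auto
    also have "\<dots> = 1/2 * ((1 - s^2) * a)" by (simp add: field_simps)
    finally show ?thesis .
  qed
  have sa: "(1 - s^2) * a \<ge> 0" using sk[of 2] a by simp
  have N1: "N s \<le> N 1"
  proof -
    have 1: "72 * ((1 - s^2) * a) + 96 * ((1 - s^3) * b) \<ge> 0"
      using bs sa by (simp only: abs_le_iff) linarith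
    have 2: "60 * ((1 - s^4) * a^2) + 54 * ((1 - s^5) * (a * b)) \<ge> 0"
    proof -
      have "a * - b \<le> a * (a / 3)" using ba a by (intro mult_left_mono) (auto simp: abs_le_iff)
      then have "(1 - s^5) * (a * - b) \<le> (1 - s^5) * (a * (a / 3))" by (rule mult_left_mono) (use sk[of 5] in simp)
      also have "\<dots> \<le> 2 * (1 - s^4) * (a * (a / 3))" by (rule mult_right_mono) (use d5 a in simp_all)
      finally have "3 * ((1 - s^5) * (a * - b)) \<le> 2 * ((1 - s^4) * a^2)"
        by (simp add: power2_eq_square algebra_simps)
      moreover have "(1 - s^4) * a^2 \<ge> 0" using sk[of 4] by simp
      ultimately show ?thesis by simp
    qed
    have 3: "6 * ((1 - s^6) * a^3) + 3 * ((1 - s^6) * b^2) \<ge> 0" using sk[of 6] a by simp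
    have "N 1 - N s = (72 * ((1 - s^2) * a) + 96 * ((1 - s^3) * b)) + (60 * ((1 - s^4) * a^2)
      + 54 * ((1 - s^5) * (a * b))) + (6 * ((1 - s^6) * a^3) + 3 * ((1 - s^6) * b^2))"
      by (simp add: N_def algebra_simps)
    then show ?thesis using 1 2 3 by linarith
  qed
  have X1: "0 < X 1" using ba a3 by (simp add: X_def abs_le_iff)
  have Xs: "X 1 \<le> X s"
  proof -
    have "X s - X 1 = (1 - s^2) * a - (1 - s^3) * b" by (simp add: X_def algebra_simps)
    then show ?thesis using bs sa by (simp only: abs_le_iff) linarith
  qed
  have U: "12 + 48 * a - 24 * b > 0" using ba a by (simp add: abs_le_iff)
  have "N s * (1 - 4 * a - 8 * b) \<le> N 1 * (1 - 4 * a - 8 * b)" using N1 Y by (intro mult_right_mono) auto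
  also have "\<dots> < (12 + 48 * a - 24 * b) * (X 1)^2"
    using cubic_core[OF a a3 disc] by (simp add: N_def X_def mult_ac)
  also have "\<dots> \<le> (12 + 48 * a - 24 * b) * (X s)^2"
    using U Xs X1 by (intro mult_left_mono power_mono) auto
  finally show ?thesis
    unfolding eN eX eU eY using Y X1 Xs by (simp add: divide_less_eq less_divide_eq mult_ac)
qed

section \<open>Lyapunov functions in posynomial form\<close>

text \<open>Zero sums of the exponents make the function invariant under scaling of
  \<open>u\<close>. The zero sums of \<open>a k * c k i\<close> say that the gradient at the origin
  of the logarithmic coordinates vanishes, so by convexity constant vectors are minimisers. The
  indices are pairs because the cubic function has one monomial for each pair of colours.\<close>

definition lyapunov :: "nat \<Rightarrow> nat \<Rightarrow> real \<Rightarrow> (nat \<times> nat) set \<Rightarrow> (nat \<times> nat \<Rightarrow> real)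
    \<Rightarrow> (nat \<times> nat \<Rightarrow> nat \<Rightarrow> real) \<Rightarrow> bool" where
  "lyapunov q d w I a c \<longleftrightarrow> finite I \<and> (\<forall>k\<in>I. a k \<ge> 0) \<and> (\<forall>k\<in>I. (\<Sum>i\<in>{1..q}. c k i) = 0)
     \<and> (\<forall>i\<in>{1..q}. (\<Sum>k\<in>I. a k * c k i) = 0)
     \<and> (\<forall>u. (\<forall>i\<in>{1..q}. u i > 0) \<and> (\<exists>i\<in>{1..q}. u i \<noteq> u 1) \<longrightarrow>
           posynomial q I a c (\<lambda>i. real d * ln (message q w u i)) < posynomial q I a c (\<lambda>i. ln (u i)))"

lemma posynomial_cong:
  "(\<And>i. i \<in> {1..q} \<Longrightarrow> x i = y i) \<Longrightarrow> posynomial q I a c x = posynomial q I a c y"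
  unfolding posynomial_def by (intro sum.cong arg_cong2[where f = "(*)"] arg_cong[where f = exp]) auto

lemma posynomial_shift:
  assumes "\<And>k. k \<in> I \<Longrightarrow> (\<Sum>i\<in>{1..q}. c k i) = 0"
  shows "posynomial q I a c (\<lambda>i. x i + r) = posynomial q I a c x"
  unfolding posynomial_def
proof (rule sum.cong[OF refl])
  fix k assume "k \<in> I"
  then have "(\<Sum>i\<in>{1..q}. c k i * (x i + r)) = (\<Sum>i\<in>{1..q}. c k i * x i)"
    using assms[of k] by (simp add: distrib_left sum.distrib flip: sum_distrib_right)
  then show "a k * exp (\<Sum>i\<in>{1..q}. c k i * (x i + r)) = a k * exp (\<Sum>i\<in>{1..q}. c k i * x i)"
    by simp
qed

lemma message_cong: "(\<And>i. i \<in> {1..q} \<Longrightarrow> u i = v i) \<Longrightarrow> message q w u j = message q w v j"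
  unfolding message_def by (intro sum.cong) auto

lemma message_scale: "message q w (\<lambda>i. r * u i) j = r * message q w u j"
  unfolding message_def by (simp add: sum_distrib_left mult_ac)

lemma message_pos:
  assumes "\<And>i. i \<in> {1..q} \<Longrightarrow> u i > 0" "q > 0" "w > 0"
  shows "message q w u j > 0"
  unfolding message_def using assms by (intro sum_pos) auto

lemma message_normalized:
  assumes "i \<in> {1..q}" "(\<Sum>j\<in>{1..q}. u j) = real q" "w > 0"
  shows "message q w u i = (real q - 1 + w) * (1 + (1 - w) / (real q - 1 + w) * (1 - u i))"
proof -
  have "real q - 1 + w > 0" using assms by auto
  then show ?thesis using assms by (simp add: message_eq field_simps)
qed

text \<open>It suffices to compare the two values at vectors of mean one, since both are invariant under scaling.\<close>

lemma lyapunovI: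
  assumes I: "finite I" "\<forall>k\<in>I. a k \<ge> 0" "\<forall>k\<in>I. (\<Sum>i\<in>{1..q}. c k i) = 0"
    "\<forall>i\<in>{1..q}. (\<Sum>k\<in>I. a k * c k i) = 0" and q: "q > 0" and w: "w > 0" "w < 1"
    and less: "\<And>u. (\<And>i. i \<in> {1..q} \<Longrightarrow> u i > 0) \<Longrightarrow> (\<Sum>i\<in>{1..q}. u i) = real q \<Longrightarrow> \<exists>i\<in>{1..q}. u i \<noteq> 1 \<Longrightarrow>
      posynomial q I a c (\<lambda>i. real d * ln (1 + (1 - w) / (real q - 1 + w) * (1 - u i)))
        < posynomial q I a c (\<lambda>i. ln (u i))"
  shows "lyapunov q d w I a c"
  unfolding lyapunov_def
proof (intro conjI I allI impI)
  fix u :: "nat \<Rightarrow> real"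
  assume u: "(\<forall>i\<in>{1..q}. u i > 0) \<and> (\<exists>i\<in>{1..q}. u i \<noteq> u 1)"
  define S where "S = (\<Sum>i\<in>{1..q}. u i)"
  have S: "S > 0" unfolding S_def using u q by (intro sum_pos) auto
  define r where "r = real q / S"
  have r: "r > 0" using S q by (simp add: r_def)
  define y where "y = (\<lambda>i. r * u i)"
  have "(\<Sum>i\<in>{1..q}. y i) = r * S" unfolding y_def S_def by (rule sum_distrib_left[symmetric])
  then have y: "\<And>i. i \<in> {1..q} \<Longrightarrow> y i > 0" "(\<Sum>i\<in>{1..q}. y i) = real q"
    using u r S by (auto simp: y_def r_def)
  have "\<exists>i\<in>{1..q}. y i \<noteq> 1"
  proof (rule ccontr)
    assume "\<not> ?thesis"
    then have "\<forall>i\<in>{1..q}. u i = 1 / r" using r by (auto simp: y_def field_simps)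
    moreover have "1 \<in> {1..q}" using q by simp
    ultimately show False using u by metis
  qed
  note L = less[OF y this]
  have m: "real q - 1 + w > 0" using q w by (cases q) auto
  have "ln (message q w u i) = ln (1 + (1 - w) / (real q - 1 + w) * (1 - y i)) + (ln (real q - 1 + w) - ln r)"
    if "i \<in> {1..q}" for i
  proof -
    have 1: "r * message q w u i = (real q - 1 + w) * (1 + (1 - w) / (real q - 1 + w) * (1 - y i))"
      using message_normalized[OF that y(2) w(1)] by (simp add: y_def message_scale)
    have p: "message q w u i > 0" using u q w by (intro message_pos) auto
    then have "(1 + (1 - w) / (real q - 1 + w) * (1 - y i)) > 0"
      using 1 r m by (metis mult_pos_pos zero_less_mult_pos)
    then have "ln r + ln (message q w u i) = ln (real q - 1 + w) + ln (1 + (1 - w) / (real q - 1 + w) * (1 - y i))"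
      using arg_cong[OF 1, of ln] r m p by (simp add: ln_mult)
    then show ?thesis by simp
  qed
  then have "posynomial q I a c (\<lambda>i. real d * ln (message q w u i)) =
      posynomial q I a c (\<lambda>i. real d * ln (1 + (1 - w) / (real q - 1 + w) * (1 - y i)) + real d * (ln (real q - 1 + w) - ln r))"
    by (intro posynomial_cong) (simp add: distrib_left)
  also have "\<dots> = posynomial q I a c (\<lambda>i. real d * ln (1 + (1 - w) / (real q - 1 + w) * (1 - y i)))"
    using I by (intro posynomial_shift) auto
  also have "\<dots> < posynomial q I a c (\<lambda>i. ln (y i))" by (rule L)
  also have "\<dots> = posynomial q I a c (\<lambda>i. ln (u i) + ln r)"
    by (intro posynomial_cong) (use u r in \<open>force simp: y_def ln_mult_pos\<close>)
  also have "\<dots> = posynomial q I a c (\<lambda>i. ln (u i))" using I by (intro posynomial_shift) auto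
  finally show "posynomial q I a c (\<lambda>i. real d * ln (message q w u i)) < posynomial q I a c (\<lambda>i. ln (u i))" .
qed

text \<open>The threshold enters here: \<open>w \<ge> 1 - q / (d + 1)\<close> is equivalent to
  \<open>(1 - w) * d \<le> q - 1 + w\<close>.\<close>

lemma message_coefficient_bound:
  fixes w :: real
  assumes "1 - real q / (real d + 1) \<le> w" "w < 1" "w > 0" "q > 0" "d > 0"
  shows "0 < (1 - w) / (real q - 1 + w)" "(1 - w) / (real q - 1 + w) \<le> 1 / real d"
proof -
  have m: "real q - 1 + w > 0" using assms by (cases q) auto
  then show "0 < (1 - w) / (real q - 1 + w)" using assms by simp
  have "(1 - w) * (real d + 1) \<le> real q" using assms by (simp add: field_simps)
  then have "(1 - w) * real d \<le> real q - 1 + w" by (simp add: algebra_simps)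
  then show "(1 - w) / (real q - 1 + w) \<le> 1 / real d" using m assms by (simp add: field_simps)
qed

lemma lyapunov_power:
  assumes q: "q \<in> {3, 4}" and d: "d \<ge> q"
    and w: "1 - real q / (real d + 1) \<le> w" "w < 1" "w > 0"
  shows "\<exists>I a c. lyapunov q d w I a c"
proof -
  define \<theta> where "\<theta> = 3 * (real d + 1) / (2 * real d)"
  define c :: "nat \<times> nat \<Rightarrow> nat \<Rightarrow> real" where "c k i = \<theta> * (if i = fst k then 1 else 0) - \<theta> / q" for k i
  \<comment> \<open>The second component is a dummy that fits single colours into the index type of
    \<open>lyapunov\<close>.\<close>
  define I :: "(nat \<times> nat) set" where "I = (\<lambda>k. (k, 0)) ` {1..q}"
  have qd: "q > 0" "d > 0" using q d by auto
  have K: "\<theta> * real d = 3 * (real d + 1) / 2" using qd by (simp add: \<theta>_def)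
  have pos: "posynomial q I (\<lambda>_. 1) c x = (\<Sum>k\<in>{1..q}. exp (\<theta> * x k - \<theta> / q * (\<Sum>j\<in>{1..q}. x j)))" for x
  proof -
    have "(\<Sum>i\<in>{1..q}. c (k, 0) i * x i) = \<theta> * x k - \<theta> / q * (\<Sum>j\<in>{1..q}. x j)" if "k \<in> {1..q}" for k
    proof -
      have "(\<Sum>i\<in>{1..q}. c (k, 0) i * x i) = (\<Sum>i\<in>{1..q}. (if i = k then \<theta> * x i else 0) - \<theta> / q * x i)"
        by (intro sum.cong) (auto simp: c_def left_diff_distrib)
      then show ?thesis using that by (simp add: sum_subtractf sum.delta sum_distrib_left)
    qed
    then show ?thesis unfolding posynomial_def I_def
      by (subst sum.reindex) (auto simp: inj_on_def intro!: sum.cong)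
  qed
  have "lyapunov q d w I (\<lambda>_. 1) c"
  proof (rule lyapunovI)
    show "finite I" by (simp add: I_def)
    show "\<forall>k\<in>I. (\<Sum>i\<in>{1..q}. c k i) = 0"
      using qd by (auto simp: I_def c_def sum_subtractf simp flip: sum_distrib_left)
    show "\<forall>i\<in>{1..q}. (\<Sum>k\<in>I. 1 * c k i) = 0"
      unfolding I_def using qd
      by (subst sum.reindex) (auto simp: inj_on_def c_def sum_subtractf simp flip: sum_distrib_left)
  next
    fix u :: "nat \<Rightarrow> real"
    assume u: "\<And>i. i \<in> {1..q} \<Longrightarrow> u i > 0" "(\<Sum>i\<in>{1..q}. u i) = real q" "\<exists>i\<in>{1..q}. u i \<noteq> 1"
    define t where "t = (1 - w) / (real q - 1 + w)"
    have t: "0 < t" "t \<le> 1 / real d" using message_coefficient_bound[OF w qd] by (auto simp: t_def)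
    have "\<theta> * (real d * x) - \<theta> / q * (\<Sum>j\<in>{1..q}. real d * z j)
        = \<theta> * real d * x - \<theta> * real d / q * (\<Sum>j\<in>{1..q}. z j)" for x and z :: "nat \<Rightarrow> real"
      by (simp flip: sum_distrib_left)
    then show "posynomial q I (\<lambda>_. 1) c (\<lambda>i. real d * ln (1 + (1 - w) / (real q - 1 + w) * (1 - u i)))
        < posynomial q I (\<lambda>_. 1) c (\<lambda>i. ln (u i))"
      using power_lyapunov[OF q d t u] unfolding pos t_def[symmetric] K by (simp only: \<theta>_def)
  qed (use w qd in auto)
  then show ?thesis by blast
qed

lemma lyapunov_cubic:
  assumes w: "w < 1" "w > 0"
  shows "\<exists>I a c. lyapunov 3 2 w I a c"
proof -
  define c :: "nat \<times> nat \<Rightarrow> nat \<Rightarrow> real"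
    where "c k i = (if i = fst k then 1 else 0) + 2 * (if i = snd k then 1 else 0) - 1" for k i
  \<comment> \<open>The monomial for \<open>(i, j)\<close> is \<open>u i * (u j)^2\<close> over the
    product of all three weights. A cube arises both from the sum of cubes and from the product of
    the two sums, hence the coefficient 2 on the diagonal.\<close>
  define a :: "nat \<times> nat \<Rightarrow> real" where "a k = (if fst k = snd k then 2 else 1)" for k
  define I :: "(nat \<times> nat) set" where "I = {1..3} \<times> {1..3}"
  have S: "(\<Sum>k\<in>I. f k) = (\<Sum>i\<in>{1..3}. \<Sum>j\<in>{1..3}. f (i, j))" for f :: "nat \<times> nat \<Rightarrow> real"
    unfolding I_def by (simp add: sum.cartesian_product)
  have pos: "posynomial 3 I a c (\<lambda>i. ln (x i)) = ((x 1^3 + x 2^3 + x 3^3) + (x 1 + x 2 + x 3) * (x 1^2 + x 2^2 + x 3^2))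
      / (x 1 * x 2 * x 3)" if x: "x 1 > 0" "x 2 > 0" "x 3 > 0" for x
  proof -
    define e where "e = x 1 * x 2 * x 3"
    have "exp (\<Sum>m\<in>{1..3}. c (i, j) m * ln (x m)) = x i * x j ^ 2 / e"
      if "i \<in> {1..3}" "j \<in> {1..3}" for i j
    proof -
      have ij: "i = 1 \<or> i = 2 \<or> i = 3" "j = 1 \<or> j = 2 \<or> j = 3" using that by auto
      then have p: "x i > 0" "x j > 0" using x by auto
      have "(\<Sum>m\<in>{1..3}. c (i, j) m * ln (x m)) = ln (x i) + 2 * ln (x j) - (ln (x 1) + ln (x 2) + ln (x 3))"
        using ij unfolding sum_upto_3 c_def by auto
      then show ?thesis using x p by (simp add: exp_diff exp_add exp_double e_def)
    qed
    then have "posynomial 3 I a c (\<lambda>i. ln (x i)) = (\<Sum>i\<in>{1..3}. \<Sum>j\<in>{1..3}. a (i, j) * (x i * x j ^ 2)) / e"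
      unfolding posynomial_def S sum_divide_distrib by (intro sum.cong refl) simp
    also have "(\<Sum>i\<in>{1..3}. \<Sum>j\<in>{1..3}. a (i, j) * (x i * x j ^ 2))
        = (x 1^3 + x 2^3 + x 3^3) + (x 1 + x 2 + x 3) * (x 1^2 + x 2^2 + x 3^2)"
      unfolding sum_upto_3 a_def by (simp add: power3_eq_cube power2_eq_square algebra_simps)
    finally show ?thesis unfolding e_def .
  qed
  have "lyapunov 3 2 w I a c"
  proof (rule lyapunovI)
    show "finite I" by (simp add: I_def)
    show "\<forall>k\<in>I. 0 \<le> a k" by (simp add: a_def)
    show "\<forall>k\<in>I. (\<Sum>i\<in>{1..3}. c k i) = 0"
      by (auto simp: I_def c_def sum_subtractf sum.distrib simp flip: sum_distrib_left)
    show "\<forall>i\<in>{1..3}. (\<Sum>k\<in>I. a k * c k i) = 0"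
    proof
      fix i :: nat assume "i \<in> {1..3}"
      then have "i = 1 \<or> i = 2 \<or> i = 3" by auto
      then show "(\<Sum>k\<in>I. a k * c k i) = 0" unfolding S sum_upto_3 a_def c_def by auto
    qed
  next
    fix u :: "nat \<Rightarrow> real"
    assume u: "\<And>i. i \<in> {1..3} \<Longrightarrow> u i > 0" "(\<Sum>i\<in>{1..3}. u i) = real 3" "\<exists>i\<in>{1..3}. u i \<noteq> 1"
    define t where "t = (1 - w) / (real 3 - 1 + w)"
    have t: "0 < t" "t \<le> 1 / 2" using message_coefficient_bound[of 3 2 w] w by (auto simp: t_def)
    define v where "v i = 1 + t * (1 - u i)" for i
    have u': "u 1 > 0" "u 2 > 0" "u 3 > 0" "u 1 + u 2 + u 3 = 3" using u(1,2) unfolding sum_upto_3 by auto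
    have ne: "u 1 \<noteq> 1 \<or> u 2 \<noteq> 1 \<or> u 3 \<noteq> 1"
    proof -
      from u(3) obtain i :: nat where i: "i \<in> {1..3}" "u i \<noteq> 1" by blast
      then have "i = 1 \<or> i = 2 \<or> i = 3" by auto
      then show ?thesis using i(2) by auto
    qed
    have vpos: "v i > 0" if "u i < 3" for i
    proof -
      have "t * (u i - 1) \<le> 1/2 * 2 - t * (3 - u i)" using t by (simp add: algebra_simps)
      moreover have "t * (3 - u i) > 0" using t that by simp
      ultimately show ?thesis by (simp add: v_def algebra_simps)
    qed
    have v': "v 1 > 0" "v 2 > 0" "v 3 > 0" using u' by (auto intro!: vpos)
    have "posynomial 3 I a c (\<lambda>i. real 2 * ln (v i)) = posynomial 3 I a c (\<lambda>i. ln (v i ^ 2))"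
    proof (rule posynomial_cong)
      fix i :: nat assume "i \<in> {1..3}"
      then have "i = 1 \<or> i = 2 \<or> i = 3" by auto
      then show "real 2 * ln (v i) = ln (v i ^ 2)" using v' by (auto simp: ln_realpow)
    qed
    also have "\<dots> = ((v 1^6 + v 2^6 + v 3^6) + (v 1^2 + v 2^2 + v 3^2) * (v 1^4 + v 2^4 + v 3^4)) / (v 1 * v 2 * v 3)^2"
      using v' by (subst pos) (simp_all add: power_mult_distrib flip: power_mult)
    also have "\<dots> < ((u 1^3 + u 2^3 + u 3^3) + (u 1 + u 2 + u 3) * (u 1^2 + u 2^2 + u 3^2)) / (u 1 * u 2 * u 3)"
    proof -
      have e: "1 + 2 * t * ((1 - u i) / 2) = v i" "1 - 2 * ((1 - u i) / 2) = u i" for i by (simp_all add: v_def field_simps)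
      have "(1 - u 1) / 2 + (1 - u 2) / 2 + (1 - u 3) / 2 = 0" using u'(4) by (simp flip: add_divide_distrib)
      moreover have "(1 - u 1) / 2 < 1/2" "(1 - u 2) / 2 < 1/2" "(1 - u 3) / 2 < 1/2" using u' by auto
      moreover have "(1 - u 1) / 2 \<noteq> 0 \<or> (1 - u 2) / 2 \<noteq> 0 \<or> (1 - u 3) / 2 \<noteq> 0" using ne by simp
      moreover have "0 < 2 * t" "2 * t \<le> 1" using t by auto
      ultimately show ?thesis by (rule cubic_lyapunov[of "(1 - u 1) / 2" "(1 - u 2) / 2" "(1 - u 3) / 2" "2 * t", unfolded e])
    qed
    also have "\<dots> = posynomial 3 I a c (\<lambda>i. ln (u i))" using u' by (subst pos) auto
    finally show "posynomial 3 I a c (\<lambda>i. real 2 * ln (1 + (1 - w) / (real 3 - 1 + w) * (1 - u i)))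
        < posynomial 3 I a c (\<lambda>i. ln (u i))" by (simp only: v_def t_def)
  qed (use w in auto)
  then show ?thesis by blast
qed

section \<open>Uniform contraction of messages\<close>

text \<open>Vectors are functions on all of \<open>nat\<close>; pinning the coordinates outside
  \<open>A\<close> to 0 makes the box a product of compact sets, to which Tychonoff applies.\<close>

lemma compact_box:
  "compact {x :: nat \<Rightarrow> real. (\<forall>i\<in>A. \<bar>x i\<bar> \<le> B) \<and> (\<forall>i. i \<notin> A \<longrightarrow> x i = 0)}"
proof -
  have "compactin (product_topology (\<lambda>i::nat. euclidean :: real topology) UNIV)
     (PiE UNIV (\<lambda>i. if i \<in> A then {-B..B} else {0}))"
    by (subst compactin_PiE) auto
  then have "compact (PiE UNIV (\<lambda>i. if i \<in> A then {-B..B} else {0}) :: (nat \<Rightarrow> real) set)"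
    by (simp add: euclidean_product_topology)
  moreover have "(PiE UNIV (\<lambda>i. if i \<in> A then {-B..B} else {0}) :: (nat \<Rightarrow> real) set) =
     {x. (\<forall>i\<in>A. \<bar>x i\<bar> \<le> B) \<and> (\<forall>i. i \<notin> A \<longrightarrow> x i = 0)}"
    by (auto simp: PiE_def Pi_def abs_le_iff split: if_splits)
  ultimately show ?thesis by simp
qed

text \<open>A function that depends only on the differences of finitely many coordinates attains its minimum
  over a closed condition of the same kind, once these differences are bounded.\<close>

lemma uniform_gap:
  fixes G H :: "(nat \<Rightarrow> real) \<Rightarrow> real"
  assumes q: "1 \<le> q"
    and cont: "continuous_on UNIV G" "continuous_on UNIV H"
    and shift: "\<And>x r. G (\<lambda>i. x i + r) = G x" "\<And>x r. H (\<lambda>i. x i + r) = H x"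
    and local: "\<And>x y. (\<And>i. i \<in> {1..q} \<Longrightarrow> x i = y i) \<Longrightarrow> G x = G y"
      "\<And>x y. (\<And>i. i \<in> {1..q} \<Longrightarrow> x i = y i) \<Longrightarrow> H x = H y"
    and pos: "\<And>x. H x \<ge> 0 \<Longrightarrow> G x > 0"
  shows "\<exists>\<delta>>0. \<forall>x. (\<forall>i\<in>{1..q}. \<forall>j\<in>{1..q}. x i - x j \<le> B) \<longrightarrow> H x \<ge> 0 \<longrightarrow> G x \<ge> \<delta>"
proof -
  define Q where "Q = {x. (\<forall>i\<in>{1..q}. \<bar>x i\<bar> \<le> B) \<and> (\<forall>i. i \<notin> {1..q} \<longrightarrow> x i = 0)} \<inter> {x. 0 \<le> H x}"
  have cl: "closed {x. 0 \<le> H x}" by (rule closed_Collect_le[OF continuous_on_const cont(2)])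
  have Q: "compact Q"
    unfolding Q_def by (rule compact_Int_closed[OF compact_box[of "{1..q}" B] cl])
  obtain \<delta> where \<delta>: "\<delta> > 0" "\<And>x. x \<in> Q \<Longrightarrow> G x \<ge> \<delta>"
  proof (cases "Q = {}")
    case True
    show ?thesis by (rule that[of 1]) (simp_all add: True)
  next
    case False
    obtain x0 where x0: "x0 \<in> Q" "\<forall>x\<in>Q. G x0 \<le> G x"
      using continuous_attains_inf[OF Q False continuous_on_subset[OF cont(1) subset_UNIV]] by (elim bexE)
    show ?thesis
    proof (rule that[of "G x0"])
      show "G x0 > 0" using x0(1) by (intro pos) (simp add: Q_def)
      show "G x0 \<le> G x" if "x \<in> Q" for x using x0(2) that by blast
    qed
  qed
  show ?thesis
  proof (intro exI[of _ \<delta>] conjI \<delta>(1) allI impI)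
    fix x assume x: "\<forall>i\<in>{1..q}. \<forall>j\<in>{1..q}. x i - x j \<le> B" "0 \<le> H x"
    \<comment> \<open>Shifting the first coordinate to 0 turns the bound on differences into a bound
      on each coordinate, so the shifted point lies in the box.\<close>
    define y where "y i = (if i \<in> {1..q} then x i + - x 1 else 0)" for i
    have "G y = G (\<lambda>i. x i + - x 1)" by (rule local) (simp add: y_def)
    also have "\<dots> = G x" by (rule shift(1)[of x "- x 1"])
    finally have G: "G y = G x" .
    have "H y = H (\<lambda>i. x i + - x 1)" by (rule local(2)) (simp add: y_def)
    also have "\<dots> = H x" by (rule shift(2)[of x "- x 1"])
    finally have H: "H y = H x" .
    have "\<bar>y i\<bar> \<le> B" if "i \<in> {1..q}" for i
      using x(1)[rule_format, of i 1] x(1)[rule_format, of 1 i] that q by (auto simp: y_def abs_le_iff)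
    then have "y \<in> Q" using x(2) H by (auto simp: Q_def y_def)
    then show "\<delta> \<le> G x" using \<delta>(2)[of y] G by simp
  qed
qed

lemma continuous_posynomial: "continuous_on UNIV (posynomial q I a c)"
  unfolding posynomial_def
  by (intro continuous_intros continuous_on_product_coordinates)

text \<open>Jensen for \<open>exp\<close> with equal weights. The logarithm of a product of
  \<open>d\<close> messages is the mean of the logarithms of their \<open>d\<close>-th powers, which
  are the \<open>x z\<close>.\<close>

lemma posynomial_product:
  assumes C: "finite C" "card C = d" "d > 0" and a: "\<And>k. k \<in> I \<Longrightarrow> a k \<ge> 0"
    and le: "\<And>z. z \<in> C \<Longrightarrow> posynomial q I a c (x z) \<le> t"
  shows "posynomial q I a c (\<lambda>i. (\<Sum>z\<in>C. x z i) / real d) \<le> t"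
proof -
  have "posynomial q I a c (\<lambda>i. (\<Sum>z\<in>C. x z i) / real d)
      = (\<Sum>k\<in>I. a k * exp (\<Sum>z\<in>C. (1 / real d) *\<^sub>R (\<Sum>i\<in>{1..q}. c k i * x z i)))"
    unfolding posynomial_def
  proof (rule sum.cong[OF refl])
    fix k assume "k \<in> I"
    have "(\<Sum>i\<in>{1..q}. c k i * ((\<Sum>z\<in>C. x z i) / real d)) = (\<Sum>i\<in>{1..q}. \<Sum>z\<in>C. c k i * x z i / real d)"
      by (simp add: sum_distrib_left sum_divide_distrib)
    also have "\<dots> = (\<Sum>z\<in>C. \<Sum>i\<in>{1..q}. c k i * x z i / real d)" by (rule sum.swap)
    also have "\<dots> = (\<Sum>z\<in>C. (1 / real d) *\<^sub>R (\<Sum>i\<in>{1..q}. c k i * x z i))"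
      by (simp add: sum_divide_distrib)
    finally show "a k * exp (\<Sum>i\<in>{1..q}. c k i * ((\<Sum>z\<in>C. x z i) / real d))
        = a k * exp (\<Sum>z\<in>C. (1 / real d) *\<^sub>R (\<Sum>i\<in>{1..q}. c k i * x z i))" by simp
  qed
  also have "\<dots> \<le> (\<Sum>k\<in>I. a k * (\<Sum>z\<in>C. (1 / real d) * exp (\<Sum>i\<in>{1..q}. c k i * x z i)))"
    using C a by (intro sum_mono mult_left_mono convex_on_sum[OF _ _ exp_convex]) auto
  also have "\<dots> = (\<Sum>z\<in>C. (1 / real d) * posynomial q I a c (x z))"
    unfolding posynomial_def sum_distrib_left by (subst sum.swap) (simp add: mult_ac)
  also have "\<dots> \<le> (\<Sum>z\<in>C. (1 / real d) * t)"
    using le by (intro sum_mono mult_left_mono) auto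
  also have "\<dots> = t" using C by simp
  finally show ?thesis .
qed

text \<open>With \<open>S\<close> the sum of the weights, \<open>message q w u i \<le> S\<close> and
  \<open>message q w u j \<ge> w * S\<close>. Thus the logarithmic differences of a message are
  bounded whatever \<open>u\<close> is, which provides the compact domain for
  \<open>uniform_gap\<close>.\<close>

lemma message_ratio:
  assumes u: "\<And>i. i \<in> {1..q} \<Longrightarrow> u i > 0" and w: "0 < w" "w < 1" and i: "i \<in> {1..q}" "j \<in> {1..q}"
  shows "w * message q w u i \<le> message q w u j"
proof -
  have S: "u j \<le> (\<Sum>j\<in>{1..q}. u j)" using member_le_sum[of j "{1..q}" u] u i by (simp add: less_imp_le)
  have "(1 - w) * u j \<le> (1 - w) * (\<Sum>j\<in>{1..q}. u j)" using S w by (intro mult_left_mono) auto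
  moreover have "w * ((1 - w) * u i) \<ge> 0" using u[OF i(1)] w by simp
  ultimately show ?thesis using i by (simp add: message_eq algebra_simps)
qed

text \<open>\<open>P n\<close> is meant for messages out of a subtree whose boundary lies
  \<open>n\<close> levels below, and the tree argument uses only these four properties. It concerns
  messages rather than weight vectors because a boundary vector has zero entries, whereas its
  message has the entries \<open>w\<close> and 1.\<close>

lemma message_contraction:
  assumes L: "lyapunov q d w I a c" and d: "d > 0" and q: "q > 0" and w: "0 < w" "w < 1" and \<epsilon>: "\<epsilon> > 0"
  obtains P :: "nat \<Rightarrow> (nat \<Rightarrow> real) \<Rightarrow> bool" and N :: nat where
    "\<And>m. (\<And>i. i \<in> {1..q} \<Longrightarrow> m i > 0) \<Longrightarrow> (\<And>i j. i \<in> {1..q} \<Longrightarrow> j \<in> {1..q} \<Longrightarrow> w * m i \<le> m j) \<Longrightarrow> P 0 m"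
    "\<And>n (C :: 'b set) m. finite C \<Longrightarrow> card C = d \<Longrightarrow> (\<And>z. z \<in> C \<Longrightarrow> P n (m z)) \<Longrightarrow>
        P (Suc n) (message q w (\<lambda>i. \<Prod>z\<in>C. m z i))"
    "\<And>n m i. P n m \<Longrightarrow> i \<in> {1..q} \<Longrightarrow> m i > 0"
    "\<And>n m i j. n \<ge> N \<Longrightarrow> P n m \<Longrightarrow> i \<in> {1..q} \<Longrightarrow> j \<in> {1..q} \<Longrightarrow> ln (m i) - ln (m j) \<le> \<epsilon>"
proof -
  define \<Lambda> where "\<Lambda> = posynomial q I a c"
  \<comment> \<open>In logarithmic coordinates, \<open>T\<close> sends \<open>u\<close> to the
    \<open>d\<close>-th power of its message.\<close>
  define T where "T x i = real d * ln (message q w (\<lambda>i. exp (x i)) i)" for x i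
  define B where "B = real d * - ln w"
  define \<Lambda>0 where "\<Lambda>0 = (\<Sum>k\<in>I. a k)"
  note L' = L[unfolded lyapunov_def]
  have shift: "\<Lambda> (\<lambda>i. x i + r) = \<Lambda> x" for x r
    unfolding \<Lambda>_def using L' by (intro posynomial_shift) auto
  have loc: "\<Lambda> x = \<Lambda> y" if "\<And>i. i \<in> {1..q} \<Longrightarrow> x i = y i" for x y
    unfolding \<Lambda>_def using that by (rule posynomial_cong)
  have cont: "continuous_on UNIV \<Lambda>" unfolding \<Lambda>_def by (rule continuous_posynomial)
  \<comment> \<open>From \<open>exp y \<ge> 1 + y\<close>: the linear terms vanish by the gradient
    condition in \<open>lyapunov\<close>.\<close>
  have lower: "\<Lambda>0 \<le> \<Lambda> x" for x
  proof -
    have "(\<Sum>k\<in>I. a k * (1 + (\<Sum>i\<in>{1..q}. c k i * x i))) \<le> \<Lambda> x"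
      unfolding \<Lambda>_def posynomial_def using L' by (intro sum_mono mult_left_mono exp_ge_add_one_self) auto
    moreover have "(\<Sum>k\<in>I. a k * (1 + (\<Sum>i\<in>{1..q}. c k i * x i))) = \<Lambda>0 + (\<Sum>i\<in>{1..q}. (\<Sum>k\<in>I. a k * c k i) * x i)"
      unfolding \<Lambda>0_def sum_distrib_right
      by (subst sum.swap) (simp add: distrib_left sum.distrib sum_distrib_left mult_ac)
    ultimately show ?thesis using L' by simp
  qed
  have Tcont: "continuous_on UNIV (\<lambda>x. \<Lambda> (T x))"
  proof (rule continuous_on_compose2[OF cont])
    have "message q w (\<lambda>i. exp (x i)) i \<noteq> 0" for x i
      using message_pos[of q "\<lambda>i. exp (x i)" w i] q w by simp
    then show "continuous_on UNIV T"
      unfolding T_def[abs_def]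
      by (intro continuous_on_coordinatewise_then_product continuous_intros)
         (auto simp: message_def intro!: continuous_intros continuous_on_product_coordinates)
  qed auto
  have Tshift: "\<Lambda> (T (\<lambda>i. x i + r)) = \<Lambda> (T x)" for x r
  proof -
    have "T (\<lambda>i. x i + r) i = T x i + real d * r" for i
    proof -
      have p: "message q w (\<lambda>i. exp (x i)) i > 0" using q w by (intro message_pos) auto
      have "(\<lambda>i. exp (x i + r)) = (\<lambda>i. exp r * exp (x i))" by (simp add: exp_add mult.commute)
      then have "message q w (\<lambda>i. exp (x i + r)) i = exp r * message q w (\<lambda>i. exp (x i)) i"
        by (simp only: message_scale)
      then show ?thesis using p by (simp add: T_def ln_mult algebra_simps)
    qed
    then have "T (\<lambda>i. x i + r) = (\<lambda>i. T x i + real d * r)" by (intro ext)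
    then have "\<Lambda> (T (\<lambda>i. x i + r)) = \<Lambda> (\<lambda>i. T x i + real d * r)" by (rule arg_cong)
    also have "\<dots> = \<Lambda> (T x)" by (rule shift[of "T x" "real d * r"])
    finally show ?thesis .
  qed
  have Tloc: "\<Lambda> (T x) = \<Lambda> (T y)" if "\<And>i. i \<in> {1..q} \<Longrightarrow> x i = y i" for x y
  proof -
    have "message q w (\<lambda>i. exp (x i)) j = message q w (\<lambda>i. exp (y i)) j" for j
      by (rule message_cong) (simp add: that)
    then show ?thesis by (simp add: T_def[abs_def])
  qed
  have strict: "\<Lambda> (T x) < \<Lambda> x" if "i \<in> {1..q}" "x i \<noteq> x 1" for x i
  proof -
    have "(\<forall>i\<in>{1..q}. 0 < exp (x i)) \<and> (\<exists>i\<in>{1..q}. exp (x i) \<noteq> exp (x 1))" using that by auto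
    from L'[THEN conjunct2, THEN conjunct2, THEN conjunct2, THEN conjunct2, THEN spec, THEN mp, OF this]
    have "posynomial q I a c (\<lambda>i. real d * ln (message q w (\<lambda>i. exp (x i)) i))
       < posynomial q I a c (\<lambda>i. ln (exp (x i)))" .
    then show ?thesis by (simp add: \<Lambda>_def T_def[abs_def])
  qed
  have \<Lambda>const: "\<Lambda> x = \<Lambda>0" if "\<And>i. i \<in> {1..q} \<Longrightarrow> x i = x 1" for x
  proof -
    have "\<Lambda> x = \<Lambda> (\<lambda>i. 0 + x 1)"
    proof (rule loc)
      fix i assume "i \<in> {1..q}"
      from that[OF this] show "x i = 0 + x 1" by simp
    qed
    also have "\<dots> = \<Lambda> (\<lambda>i. 0)" by (rule shift[of "\<lambda>i. 0" "x 1"])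
    also have "\<dots> = \<Lambda>0" by (simp add: \<Lambda>_def posynomial_def \<Lambda>0_def)
    finally show ?thesis .
  qed
  have weak: "\<Lambda> (T x) \<le> \<Lambda> x" for x
  proof (cases "\<forall>i\<in>{1..q}. x i = x 1")
    case True
    have "message q w (\<lambda>i. exp (x i)) i = message q w (\<lambda>i. exp (x i)) 1" if "i \<in> {1..q}" for i
    proof -
      have "x i = x 1" using True that by blast
      moreover have "1 \<in> {1..q}" using q by simp
      ultimately show ?thesis using that by (simp add: message_eq)
    qed
    then have "T x i = T x 1" if "i \<in> {1..q}" for i using that by (simp only: T_def)
    then have "\<Lambda> (T x) = \<Lambda>0" by (rule \<Lambda>const)
    then show ?thesis using lower by simp
  next
    case False
    then obtain i where "i \<in> {1..q}" "x i \<noteq> x 1" by blast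
    from strict[OF this] show ?thesis by simp
  qed
  define spread where "spread x = (\<Sum>i\<in>{1..q}. \<Sum>j\<in>{1..q}. \<bar>x i - x j\<bar>)" for x :: "nat \<Rightarrow> real"
  have sprcont: "continuous_on UNIV spread"
    unfolding spread_def by (intro continuous_intros continuous_on_product_coordinates)
  have sprloc: "spread x = spread y" if "\<And>i. i \<in> {1..q} \<Longrightarrow> x i = y i" for x y
    unfolding spread_def using that by (intro sum.cong) auto
  have q1: "1 \<le> q" "1 \<in> {1..q}" using q by auto
  \<comment> \<open>The first gap: a function value within \<open>\<delta>1\<close> of the minimum
    \<open>\<Lambda>0\<close> forces the coordinates to be nearly equal.\<close>
  have "\<exists>\<delta>>0. \<forall>x. (\<forall>i\<in>{1..q}. \<forall>j\<in>{1..q}. x i - x j \<le> B) \<longrightarrow> 0 \<le> spread x - d * \<epsilon> \<longrightarrow> \<delta> \<le> \<Lambda> x - \<Lambda>0"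
  proof (rule uniform_gap[OF q1(1), of "\<lambda>x. \<Lambda> x - \<Lambda>0" "\<lambda>x. spread x - d * \<epsilon>" B])
    fix x assume s: "0 \<le> spread x - d * \<epsilon>"
    have "\<exists>i\<in>{1..q}. x i \<noteq> x 1"
    proof (rule ccontr)
      assume a: "\<not> ?thesis"
      have "\<bar>x i - x j\<bar> = 0" if "i \<in> {1..q}" "j \<in> {1..q}" for i j
      proof -
        have "x i = x 1" "x j = x 1" using a that by blast+
        then show ?thesis by simp
      qed
      then have "spread x = 0" unfolding spread_def by (intro sum.neutral ballI)
      moreover have "real d * \<epsilon> > 0" using \<epsilon> d by simp
      ultimately show False using s by linarith
    qed
    then obtain i where "i \<in> {1..q}" "x i \<noteq> x 1" by blast
    from strict[OF this] lower[of "T x"] show "0 < \<Lambda> x - \<Lambda>0" by linarith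
  next
    show "continuous_on UNIV (\<lambda>x. \<Lambda> x - \<Lambda>0)" by (intro continuous_on_diff cont continuous_on_const)
    show "continuous_on UNIV (\<lambda>x. spread x - d * \<epsilon>)" by (intro continuous_on_diff sprcont continuous_on_const)
    show "\<Lambda> (\<lambda>i. x i + r) - \<Lambda>0 = \<Lambda> x - \<Lambda>0" for x r by (rule arg_cong2[where f = "(-)", OF shift[of x r] refl])
    show "spread (\<lambda>i. x i + r) - d * \<epsilon> = spread x - d * \<epsilon>" for x r by (simp add: spread_def)
    fix x y :: "nat \<Rightarrow> real" assume xy: "\<And>i. i \<in> {1..q} \<Longrightarrow> x i = y i"
    show "\<Lambda> x - \<Lambda>0 = \<Lambda> y - \<Lambda>0" by (rule arg_cong2[where f = "(-)", OF loc[OF xy] refl])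
    show "spread x - d * \<epsilon> = spread y - d * \<epsilon>" by (rule arg_cong2[where f = "(-)", OF sprloc[OF xy] refl])
  qed
  then obtain \<delta>1 where \<delta>1: "\<delta>1 > 0" "\<forall>x. (\<forall>i\<in>{1..q}. \<forall>j\<in>{1..q}. x i - x j \<le> B) \<longrightarrow> 0 \<le> spread x - d * \<epsilon> \<longrightarrow> \<delta>1 \<le> \<Lambda> x - \<Lambda>0"
    by (elim exE conjE)
  \<comment> \<open>The second gap: while the value is at least
    \<open>\<Lambda>0 + \<delta>1 / 2\<close>, each step lowers it by a fixed amount
    \<open>\<delta>2\<close>.\<close>
  have "\<exists>\<delta>>0. \<forall>x. (\<forall>i\<in>{1..q}. \<forall>j\<in>{1..q}. x i - x j \<le> B) \<longrightarrow> 0 \<le> \<Lambda> x - (\<Lambda>0 + \<delta>1 / 2) \<longrightarrow> \<delta> \<le> \<Lambda> x - \<Lambda> (T x)"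
  proof (rule uniform_gap[OF q1(1), of "\<lambda>x. \<Lambda> x - \<Lambda> (T x)" "\<lambda>x. \<Lambda> x - (\<Lambda>0 + \<delta>1 / 2)" B])
    fix x assume s: "0 \<le> \<Lambda> x - (\<Lambda>0 + \<delta>1 / 2)"
    have "\<exists>i\<in>{1..q}. x i \<noteq> x 1"
    proof (rule ccontr)
      assume "\<not> ?thesis"
      then have "\<Lambda> x = \<Lambda>0" by (intro \<Lambda>const) blast
      with s \<delta>1(1) show False by simp
    qed
    then obtain i where "i \<in> {1..q}" "x i \<noteq> x 1" by blast
    from strict[OF this] show "0 < \<Lambda> x - \<Lambda> (T x)" by linarith
  next
    show "\<Lambda> (\<lambda>i. x i + r) - \<Lambda> (T (\<lambda>i. x i + r)) = \<Lambda> x - \<Lambda> (T x)" for x r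
      by (rule arg_cong2[where f = "(-)", OF shift[of x r] Tshift[of x r]])
    show "\<Lambda> (\<lambda>i. x i + r) - (\<Lambda>0 + \<delta>1 / 2) = \<Lambda> x - (\<Lambda>0 + \<delta>1 / 2)" for x r
      by (rule arg_cong2[where f = "(-)", OF shift[of x r] refl])
    show "continuous_on UNIV (\<lambda>x. \<Lambda> x - \<Lambda> (T x))" by (intro continuous_on_diff cont Tcont)
    show "continuous_on UNIV (\<lambda>x. \<Lambda> x - (\<Lambda>0 + \<delta>1 / 2))" by (intro continuous_on_diff cont continuous_on_const)
    fix x y :: "nat \<Rightarrow> real" assume xy: "\<And>i. i \<in> {1..q} \<Longrightarrow> x i = y i"
    show "\<Lambda> x - \<Lambda> (T x) = \<Lambda> y - \<Lambda> (T y)" by (rule arg_cong2[where f = "(-)", OF loc[OF xy] Tloc[OF xy]])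
    show "\<Lambda> x - (\<Lambda>0 + \<delta>1 / 2) = \<Lambda> y - (\<Lambda>0 + \<delta>1 / 2)" by (rule arg_cong2[where f = "(-)", OF loc[OF xy] refl])
  qed
  then obtain \<delta>2 where \<delta>2: "\<delta>2 > 0" "\<forall>x. (\<forall>i\<in>{1..q}. \<forall>j\<in>{1..q}. x i - x j \<le> B) \<longrightarrow> 0 \<le> \<Lambda> x - (\<Lambda>0 + \<delta>1 / 2) \<longrightarrow> \<delta>2 \<le> \<Lambda> x - \<Lambda> (T x)"
    by (elim exE conjE)
  \<comment> \<open>With a vacuous condition \<open>H = 0\<close>, a positive lower bound for
    \<open>exp (- \<Lambda> x)\<close> is an upper bound for \<open>\<Lambda>\<close>, the starting
    value of the descent.\<close>
  have "\<exists>\<delta>>0. \<forall>x. (\<forall>i\<in>{1..q}. \<forall>j\<in>{1..q}. x i - x j \<le> B) \<longrightarrow> (0::real) \<le> 0 \<longrightarrow> \<delta> \<le> exp (- \<Lambda> x)"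
  proof (rule uniform_gap[OF q1(1), of "\<lambda>x. exp (- \<Lambda> x)" "\<lambda>x. 0" B])
    show "continuous_on UNIV (\<lambda>x. exp (- \<Lambda> x))" by (intro continuous_on_exp continuous_on_minus cont)
    show "exp (- \<Lambda> (\<lambda>i. x i + r)) = exp (- \<Lambda> x)" for x r
      by (rule arg_cong[where f = "\<lambda>y. exp (- y)", OF shift[of x r]])
    fix x y :: "nat \<Rightarrow> real" assume xy: "\<And>i. i \<in> {1..q} \<Longrightarrow> x i = y i"
    show "exp (- \<Lambda> x) = exp (- \<Lambda> y)" by (rule arg_cong[where f = "\<lambda>y. exp (- y)", OF loc[OF xy]])
  qed simp_all
  then obtain \<delta>3 where \<delta>3: "\<delta>3 > 0" "\<forall>x. (\<forall>i\<in>{1..q}. \<forall>j\<in>{1..q}. x i - x j \<le> B) \<longrightarrow> (0::real) \<le> 0 \<longrightarrow> \<delta>3 \<le> exp (- \<Lambda> x)"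
    by (elim exE conjE)
  define T0 where "T0 = - ln \<delta>3"
  have T0: "\<Lambda> x \<le> T0" if "\<And>i j. i \<in> {1..q} \<Longrightarrow> j \<in> {1..q} \<Longrightarrow> x i - x j \<le> B" for x
  proof -
    have "\<delta>3 \<le> exp (- \<Lambda> x)" by (rule \<delta>3(2)[rule_format]) (use that in auto)
    then have "ln \<delta>3 \<le> ln (exp (- \<Lambda> x))" using \<delta>3(1) by (subst ln_le_cancel_iff) auto
    then have "ln \<delta>3 \<le> - \<Lambda> x" by simp
    then show ?thesis by (simp add: T0_def)
  qed
  \<comment> \<open>The level guaranteed after \<open>n\<close> steps: a descent by
    \<open>\<delta>2\<close> per step until the target below \<open>\<Lambda>0 + \<delta>1\<close>
    is reached.\<close>
  define t where "t n = max (\<Lambda>0 + \<delta>1 / 2) (T0 - real n * \<delta>2)" for n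
  define P where "P n m \<longleftrightarrow> (\<forall>i\<in>{1..q}. m i > 0) \<and> (\<forall>i\<in>{1..q}. \<forall>j\<in>{1..q}. w * m i \<le> m j)
      \<and> \<Lambda> (\<lambda>i. real d * ln (m i)) \<le> t n" for n m
  have bound: "real d * ln (m i) - real d * ln (m j) \<le> B"
    if "\<forall>i\<in>{1..q}. m i > 0" "\<forall>i\<in>{1..q}. \<forall>j\<in>{1..q}. w * m i \<le> m j" "i \<in> {1..q}" "j \<in> {1..q}" for m i j
  proof -
    have "ln (w * m i) \<le> ln (m j)" using that w by (subst ln_le_cancel_iff) auto
    moreover have "ln (w * m i) = ln w + ln (m i)" using that w by (intro ln_mult_pos) auto
    ultimately have "ln (m i) - ln (m j) \<le> - ln w" by linarith
    then have "real d * (ln (m i) - ln (m j)) \<le> real d * - ln w" by (intro mult_left_mono) auto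
    then show ?thesis by (simp add: B_def algebra_simps)
  qed
  obtain N :: nat where N: "real N * \<delta>2 > T0 - \<Lambda>0 - \<delta>1 / 2"
    using reals_Archimedean3[OF \<delta>2(1)] by blast
  show ?thesis
  proof (rule that[of P N])
    fix m assume "\<And>i. i \<in> {1..q} \<Longrightarrow> m i > 0" "\<And>i j. i \<in> {1..q} \<Longrightarrow> j \<in> {1..q} \<Longrightarrow> w * m i \<le> m j"
    then have m: "\<forall>i\<in>{1..q}. m i > 0" "\<forall>i\<in>{1..q}. \<forall>j\<in>{1..q}. w * m i \<le> m j" by auto
    have "\<Lambda> (\<lambda>i. real d * ln (m i)) \<le> T0" by (rule T0) (rule bound[OF m])
    then show "P 0 m" using m by (simp add: P_def t_def)
  next
    fix n m i assume "P n m" "i \<in> {1..q}" then show "m i > 0" by (simp add: P_def)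
  next
    fix n m i j assume n: "N \<le> n" "P n m" and ij: "i \<in> {1..q}" "j \<in> {1..q}"
    have "real N * \<delta>2 \<le> real n * \<delta>2" using n \<delta>2 by (intro mult_right_mono) auto
    then have "t n = \<Lambda>0 + \<delta>1 / 2" using N by (simp add: t_def)
    then have "\<Lambda> (\<lambda>i. real d * ln (m i)) - \<Lambda>0 < \<delta>1" using n(2) \<delta>1(1) by (simp add: P_def)
    moreover have "\<forall>i\<in>{1..q}. \<forall>j\<in>{1..q}. real d * ln (m i) - real d * ln (m j) \<le> B"
      using bound[of m] n(2) unfolding P_def by blast
    ultimately have "\<not> 0 \<le> spread (\<lambda>i. real d * ln (m i)) - d * \<epsilon>"
      using \<delta>1(2)[THEN spec, of "\<lambda>i. real d * ln (m i)"] by linarith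
    then have "spread (\<lambda>i. real d * ln (m i)) - d * \<epsilon> < 0" by simp
    moreover have "\<bar>real d * ln (m i) - real d * ln (m j)\<bar> \<le> spread (\<lambda>i. real d * ln (m i))"
    proof -
      have "\<bar>real d * ln (m i) - real d * ln (m j)\<bar> \<le> (\<Sum>j\<in>{1..q}. \<bar>real d * ln (m i) - real d * ln (m j)\<bar>)"
        using ij by (intro member_le_sum) auto
      also have "\<dots> \<le> spread (\<lambda>i. real d * ln (m i))"
        unfolding spread_def using ij by (intro member_le_sum) (auto intro!: sum_nonneg)
      finally show ?thesis .
    qed
    ultimately have "real d * (ln (m i) - ln (m j)) \<le> real d * \<epsilon>" by (simp add: algebra_simps abs_le_iff)
    then show "ln (m i) - ln (m j) \<le> \<epsilon>" using d by simp
  next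
    fix n and C :: "'b set" and m
    assume C: "finite C" "card C = d" and Pm: "\<And>z. z \<in> C \<Longrightarrow> P n (m z)"
    define u where "u i = (\<Prod>z\<in>C. m z i)" for i
    have mp: "m z i > 0" if "z \<in> C" "i \<in> {1..q}" for z i using Pm[OF that(1)] that(2) by (simp add: P_def)
    have up: "u i > 0" if "i \<in> {1..q}" for i unfolding u_def using mp that by (intro prod_pos) auto
    \<comment> \<open>The logarithm of the product, written as the mean demanded by
      \<open>posynomial_product\<close>.\<close>
    define x where "x i = (\<Sum>z\<in>C. real d * ln (m z i)) / real d" for i
    have xu: "x i = ln (u i)" if "i \<in> {1..q}" for i
    proof -
      have "ln (u i) = (\<Sum>z\<in>C. ln (m z i))" unfolding u_def by (rule ln_prod) (use C mp[OF _ that] in force)+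
      then show ?thesis using d by (simp add: x_def flip: sum_distrib_left)
    qed
    have "\<Lambda> x \<le> t n"
      unfolding \<Lambda>_def x_def using C d L' Pm
      by (intro posynomial_product) (auto simp: P_def \<Lambda>_def)
    have xB: "x i - x j \<le> B" if "i \<in> {1..q}" "j \<in> {1..q}" for i j
    proof -
      have "x i - x j = (\<Sum>z\<in>C. real d * ln (m z i) - real d * ln (m z j)) / real d"
        by (simp add: x_def sum_subtractf diff_divide_distrib)
      also have "\<dots> \<le> (\<Sum>z\<in>C. B) / real d"
        using Pm that by (intro divide_right_mono sum_mono bound) (auto simp: P_def)
      also have "\<dots> = B" using C d by simp
      finally show ?thesis .
    qed
    have "\<Lambda> (T x) \<le> t (Suc n)"
    proof (cases "\<Lambda> x - (\<Lambda>0 + \<delta>1 / 2) \<ge> 0")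
      case True
      then have "\<Lambda> x - \<Lambda> (T x) \<ge> \<delta>2" using \<delta>2(2) xB by blast
      moreover have "t n - \<delta>2 \<le> t (Suc n)" using \<delta>2(1) by (auto simp: t_def max_def algebra_simps)
      ultimately show ?thesis using \<open>\<Lambda> x \<le> t n\<close> by linarith
    next
      case False
      then show ?thesis using weak[of x] by (simp add: t_def)
    qed
    moreover have "T x i = real d * ln (message q w u i)" for i
    proof -
      have "message q w (\<lambda>i. exp (x i)) i = message q w u i"
        by (rule message_cong) (simp add: xu up)
      then show ?thesis by (simp add: T_def)
    qed
    then have "T x = (\<lambda>i. real d * ln (message q w u i))" by (rule ext)
    ultimately have "\<Lambda> (\<lambda>i. real d * ln (message q w u i)) \<le> t (Suc n)" by (simp only:)
    moreover have "message q w u i > 0" for i using up q w by (intro message_pos) auto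
    moreover have "w * message q w u i \<le> message q w u j" if "i \<in> {1..q}" "j \<in> {1..q}" for i j
      using up w that by (intro message_ratio) auto
    ultimately show "P (Suc n) (message q w (\<lambda>i. \<Prod>z\<in>C. m z i))"
      by (simp add: P_def u_def[abs_def])
  qed
qed

section \<open>Levels and balls in the rooted regular tree\<close>

locale rooted_tree =
  fixes V :: "'a set" and E :: "'a set set" and d :: nat and r :: 'a
  assumes tree: "infinite_regular_tree (d + 1) V E" and root: "r \<in> V" and d: "d \<ge> 1"
begin

abbreviation adj :: "'a \<Rightarrow> 'a \<Rightarrow> bool" where "adj u v \<equiv> {u, v} \<in> E"

lemma adjD: assumes "adj u v" shows "u \<in> V" "v \<in> V" "u \<noteq> v"
proof -
  have e: "{u, v} \<subseteq> V" "card {u, v} = 2"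
    using tree assms unfolding infinite_regular_tree_def tree_graph_def simple_graph_def by auto
  then show "u \<in> V" "v \<in> V" "u \<noteq> v" by auto
qed

lemma adj_sym: "adj u v \<longleftrightarrow> adj v u" by (simp add: insert_commute)

lemma no_cycle: "walk V E xs \<Longrightarrow> distinct xs \<Longrightarrow> length xs \<ge> 3 \<Longrightarrow> \<not> adj (last xs) (hd xs)"
  using tree unfolding infinite_regular_tree_def tree_graph_def graph_cycle_def by blast

definition walk_to :: "'a \<Rightarrow> nat \<Rightarrow> bool" where
  "walk_to v n \<longleftrightarrow> (\<exists>xs. walk V E xs \<and> hd xs = r \<and> last xs = v \<and> length xs = Suc n)"

definition level :: "'a \<Rightarrow> nat" where "level v = (LEAST n. walk_to v n)"

lemma walk_to_level: assumes "v \<in> V" shows "walk_to v (level v)"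
proof -
  obtain xs where xs: "walk V E xs" "hd xs = r" "last xs = v"
    using tree root assms unfolding infinite_regular_tree_def tree_graph_def connected_graph_def by blast
  then have "walk_to v (length xs - 1)" unfolding walk_to_def walk_def by (intro exI[of _ xs]) auto
  then show ?thesis unfolding level_def by (rule LeastI)
qed

lemma level_le: "walk_to v n \<Longrightarrow> level v \<le> n"
  unfolding level_def by (rule Least_le)

lemma level_root [simp]: "level r = 0"
proof -
  have "walk_to r 0" unfolding walk_to_def walk_def using root by (intro exI[of _ "[r]"]) auto
  then show ?thesis using level_le by fastforce
qed

lemma level_0D: assumes "v \<in> V" "level v = 0" shows "v = r"
  using walk_to_level[OF assms(1)] assms(2) unfolding walk_to_def by (auto simp: length_Suc_conv)

lemma level_adj: assumes "adj u v" shows "level v \<le> Suc (level u)"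
proof -
  obtain xs where xs: "walk V E xs" "hd xs = r" "last xs = u" "length xs = Suc (level u)"
    using walk_to_level[of u] adjD[OF assms] unfolding walk_to_def by auto
  then have "walk_to v (Suc (level u))"
    unfolding walk_to_def walk_def using adjD[OF assms] assms
    by (intro exI[of _ "xs @ [v]"]) (auto simp: successively_append_iff)
  then show ?thesis by (rule level_le)
qed

lemma parent_exists: assumes "v \<in> V" "v \<noteq> r" shows "\<exists>u. adj u v \<and> level v = Suc (level u)"
proof -
  obtain xs where xs: "walk V E xs" "hd xs = r" "last xs = v" "length xs = Suc (level v)"
    using walk_to_level[OF assms(1)] unfolding walk_to_def by auto
  obtain n where n: "level v = Suc n" using level_0D assms by (cases "level v") auto
  define ys where "ys = butlast xs"
  have "xs \<noteq> []" using xs(1) by (simp add: walk_def)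
  from append_butlast_last_id[OF this] have "xs = ys @ [v]" using xs(3) by (simp add: ys_def)
  moreover have "length ys = Suc n" using xs(4) n by (simp add: ys_def)
  moreover from this have "ys \<noteq> []" by auto
  ultimately have ys: "xs = ys @ [v]" "ys \<noteq> []" "length ys = Suc n" by auto
  then have w: "walk V E ys" "adj (last ys) v" "hd ys = r"
    using xs unfolding walk_def by (auto simp: successively_append_iff)
  then have "walk_to (last ys) n" unfolding walk_to_def using ys by blast
  then have "level (last ys) \<le> n" by (rule level_le)
  moreover have "level v \<le> Suc (level (last ys))" using w(2) by (rule level_adj)
  ultimately show ?thesis using n w(2) by (intro exI[of _ "last ys"]) auto
qed

text \<open>Two vertices of equal level cannot be joined by a path that avoids the levels below and at
  theirs: extending such a path towards the root at both ends eventually closes a cycle.\<close>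

lemma no_upper_path:
  assumes "walk V E xs" "distinct xs" "length xs \<ge> 2"
    and "level (hd xs) = n" "level (last xs) = n" "\<forall>v \<in> set (butlast (tl xs)). level v > n"
  shows False
  using assms
proof (induction n arbitrary: xs)
  case 0
  have "hd xs \<in> V" "last xs \<in> V" using 0 by (auto simp: walk_def)
  then have "hd xs = r" "last xs = r" using 0 level_0D by auto
  moreover have "hd xs \<noteq> last xs"
    using 0(2,3) by (cases xs) (auto split: if_splits)
  ultimately show False by simp
next
  case (Suc n)
  define a where "a = hd xs"
  define b where "b = last xs"
  have xs: "xs = a # tl xs" "xs \<noteq> []" "tl xs \<noteq> []" using Suc(4) by (cases xs; auto simp: a_def)+
  have ab: "a \<in> V" "b \<in> V" "level a = Suc n" "level b = Suc n" using Suc xs by (auto simp: walk_def a_def b_def)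
  have lev: "level v > n" if "v \<in> set xs" for v
  proof -
    have "tl xs = butlast (tl xs) @ [b]"
      using append_butlast_last_id[OF xs(3)] last_tl[of xs] xs(3) by (simp add: b_def)
    then have "xs = a # butlast (tl xs) @ [b]" using xs(1) by metis
    then have "set xs = set (a # butlast (tl xs) @ [b])" by (rule arg_cong)
    then have "v = a \<or> v = b \<or> v \<in> set (butlast (tl xs))" using that by auto
    then show ?thesis using ab Suc(7) by auto
  qed
  obtain p where p: "adj p a" "level a = Suc (level p)" using parent_exists[of a] ab by force
  obtain p' where p': "adj p' b" "level b = Suc (level p')" using parent_exists[of b] ab by force
  have pl: "level p = n" "level p' = n" "p \<in> V" "p' \<in> V" using p p' ab adjD by auto
  then have nin: "p \<notin> set xs" "p' \<notin> set xs" using lev[of p] lev[of p'] pl(1,2) by auto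
  have w1: "walk V E (p # xs)"
    using Suc(2) p(1) pl xs(2) unfolding walk_def by (auto simp: successively_Cons a_def)
  show False
  proof (cases "p = p'")
    case True
    have "adj (last (p # xs)) (hd (p # xs))" using p'(1) True xs by (simp add: b_def adj_sym)
    then show False using no_cycle[of "p # xs"] w1 Suc(3,4) nin by simp
  next
    case False
    have w2: "walk V E (p # xs @ [p'])"
      using w1 p'(1) pl xs(2) unfolding walk_def
      by (auto simp: successively_append_iff successively_Cons b_def adj_sym hd_append)
    show False
    proof (rule Suc.IH[OF w2])
      show "distinct (p # xs @ [p'])" using Suc(3) nin False by auto
      show "\<forall>v\<in>set (butlast (tl (p # xs @ [p']))). n < level v" using lev by auto
    qed (use pl in auto)
  qed
qed

lemma level_adj_neq: assumes "adj u v" shows "level u \<noteq> level v"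
proof
  assume "level u = level v"
  then show False using no_upper_path[of "[u, v]" "level u"] assms adjD[OF assms] by (auto simp: walk_def)
qed

lemma level_adj_cases: assumes "adj u v" shows "level v = Suc (level u) \<or> level u = Suc (level v)"
  using level_adj[OF assms] level_adj[of v u] level_adj_neq[OF assms] assms by (auto simp: adj_sym)

lemma parent_unique: assumes "adj u v" "adj u' v" "level v = Suc (level u)" "level v = Suc (level u')" shows "u = u'"
proof (rule ccontr)
  assume "u \<noteq> u'"
  then show False using no_upper_path[of "[u, v, u']" "level u"] assms adjD[OF assms(1)] adjD[OF assms(2)]
    by (auto simp: walk_def adj_sym)
qed

definition children :: "'a \<Rightarrow> 'a set" where "children v = {u. adj v u \<and> level u = Suc (level v)}"

definition parent :: "'a \<Rightarrow> 'a" where "parent v = (THE u. adj u v \<and> level v = Suc (level u))"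

lemma parent: assumes "v \<in> V" "v \<noteq> r" shows "adj (parent v) v" "level v = Suc (level (parent v))"
proof -
  have "\<exists>!u. adj u v \<and> level v = Suc (level u)" using parent_exists[OF assms] parent_unique by blast
  from theI'[OF this] show "adj (parent v) v" "level v = Suc (level (parent v))" unfolding parent_def by auto
qed

lemma children_iff: "u \<in> children v \<longleftrightarrow> u \<in> V \<and> u \<noteq> r \<and> parent u = v"
proof
  assume u: "u \<in> children v"
  then have "u \<in> V" "u \<noteq> r" using adjD unfolding children_def by auto
  then show "u \<in> V \<and> u \<noteq> r \<and> parent u = v"
    using u parent[of u] parent_unique[of "parent u" u v] unfolding children_def by auto
next
  assume "u \<in> V \<and> u \<noteq> r \<and> parent u = v"
  then show "u \<in> children v" using parent[of u] unfolding children_def by auto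
qed

lemma neighbours: "finite {u \<in> V. adj u v}" "card {u \<in> V. adj u v} = d + 1" if "v \<in> V"
proof -
  show c: "card {u \<in> V. adj u v} = d + 1" using tree that unfolding infinite_regular_tree_def by auto
  then show "finite {u \<in> V. adj u v}" by (intro card_ge_0_finite) simp
qed

lemma finite_children: "v \<in> V \<Longrightarrow> finite (children v)"
  using adjD by (intro finite_subset[OF _ neighbours(1)[of v]]) (auto simp: children_def adj_sym)

lemma card_children: assumes "v \<in> V" "v \<noteq> r" shows "card (children v) = d"
proof -
  have "{u \<in> V. adj u v} = insert (parent v) (children v)"
  proof (intro equalityI subsetI)
    fix u assume u: "u \<in> {u \<in> V. adj u v}"
    then consider "level v = Suc (level u)" | "level u = Suc (level v)" using level_adj_cases by blast
    then show "u \<in> insert (parent v) (children v)"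
      by cases (use u parent[OF assms] parent_unique in \<open>auto simp: children_def adj_sym\<close>)
  next
    fix u assume "u \<in> insert (parent v) (children v)"
    then show "u \<in> {u \<in> V. adj u v}" using parent[OF assms] adjD by (auto simp: children_def adj_sym)
  qed
  moreover have "parent v \<notin> children v" using parent[OF assms] by (auto simp: children_def)
  ultimately show ?thesis using neighbours(2)[OF assms(1)] finite_children[OF assms(1)] by simp
qed

lemma children_nonempty: assumes "v \<in> V" shows "children v \<noteq> {}"
proof (cases "v = r")
  case False
  then show ?thesis using card_children[OF assms False] d by auto
next
  case True
  have "{u \<in> V. adj u r} \<noteq> {}" using neighbours(2)[OF root] by (metis add_is_0 card.empty one_neq_zero)
  then obtain u where u: "u \<in> V" "adj u r" by auto
  then have "u \<in> children r" using level_adj_cases[OF u(2)] by (auto simp: children_def adj_sym)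
  then show ?thesis using True by auto
qed

definition sphere :: "nat \<Rightarrow> 'a set" where "sphere n = {v \<in> V. level v = n}"

definition tball :: "nat \<Rightarrow> 'a set" where "tball n = {v \<in> V. level v \<le> n}"

lemma sphere_0: "sphere 0 = {r}"
  using level_0D root by (auto simp: sphere_def)

lemma sphere_Suc: "sphere (Suc n) = (\<Union>v\<in>sphere n. children v)"
proof (intro equalityI subsetI)
  fix u assume u: "u \<in> sphere (Suc n)"
  then have "u \<in> V" "u \<noteq> r" by (auto simp: sphere_def)
  then show "u \<in> (\<Union>v\<in>sphere n. children v)"
    using u parent[of u] adjD by (auto simp: sphere_def children_iff)
next
  fix u assume "u \<in> (\<Union>v\<in>sphere n. children v)"
  then show "u \<in> sphere (Suc n)" using adjD by (auto simp: sphere_def children_def)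
qed

lemma finite_sphere: "finite (sphere n)"
proof (induction n)
  case (Suc n)
  then show ?case unfolding sphere_Suc by (intro finite_UN_I finite_children) (auto simp: sphere_def)
qed (simp add: sphere_0)

lemma tball_0: "tball 0 = {r}" using sphere_0 by (simp add: tball_def sphere_def)

lemma tball_Suc: "tball (Suc n) = tball n \<union> sphere (Suc n)" "tball n \<inter> sphere (Suc n) = {}"
  by (auto simp: tball_def sphere_def)

lemma tball_subset: "tball n \<subseteq> V" by (auto simp: tball_def)

lemma finite_tball: "finite (tball n)"
  by (induction n) (auto simp: tball_0 tball_Suc finite_sphere)

lemma sphere_subset_tball: "sphere n \<subseteq> tball n" by (auto simp: tball_def sphere_def)

lemma tball_mono: "m \<le> n \<Longrightarrow> tball m \<subseteq> tball n" by (auto simp: tball_def)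

lemma finite_subset_tball: assumes "finite A" "A \<subseteq> V" shows "\<exists>n. A \<subseteq> tball n"
proof -
  obtain n where "\<forall>v\<in>A. level v \<le> n" using finite_imageI[OF assms(1), of level] by (auto simp: finite_nat_set_iff_bounded_le)
  then show ?thesis using assms(2) by (intro exI[of _ n]) (auto simp: tball_def)
qed

lemma bdry_tball: "bdry V E (tball n) = sphere n"
proof (intro equalityI subsetI)
  fix u assume "u \<in> bdry V E (tball n)"
  then obtain v where "u \<in> tball n" "v \<in> V" "v \<notin> tball n" "adj u v" by (auto simp: bdry_def)
  then show "u \<in> sphere n" using level_adj[of u v] by (auto simp: tball_def sphere_def)
next
  fix u assume u: "u \<in> sphere n"
  then obtain v where "v \<in> children u" using children_nonempty by (auto simp: sphere_def)
  then show "u \<in> bdry V E (tball n)"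
    using u adjD by (auto simp: bdry_def tball_def sphere_def children_def intro!: bexI[of _ v])
qed

lemma induced_tball_Suc:
  "induced_edges E (tball (Suc n)) = induced_edges E (tball n) \<union> (\<lambda>u. {parent u, u}) ` sphere (Suc n)"
  "induced_edges E (tball n) \<inter> (\<lambda>u. {parent u, u}) ` sphere (Suc n) = {}"
proof -
  have s: "u \<in> V" "u \<noteq> r" "adj (parent u) u" "parent u \<in> sphere n" if "u \<in> sphere (Suc n)" for u
  proof -
    show u: "u \<in> V" "u \<noteq> r" using that by (auto simp: sphere_def)
    show "adj (parent u) u" using parent[OF u] by simp
    then show "parent u \<in> sphere n" using parent[OF u] adjD that by (auto simp: sphere_def)
  qed
  show "induced_edges E (tball (Suc n)) = induced_edges E (tball n) \<union> (\<lambda>u. {parent u, u}) ` sphere (Suc n)"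
  proof (intro equalityI subsetI)
    fix e assume e: "e \<in> induced_edges E (tball (Suc n))"
    then have "card e = 2"
      using tree unfolding induced_edges_def infinite_regular_tree_def tree_graph_def simple_graph_def by auto
    then obtain u v where uv: "e = {u, v}" by (auto simp: card_2_iff)
    then have uv': "adj u v" "u \<in> tball (Suc n)" "v \<in> tball (Suc n)" using e by (auto simp: induced_edges_def)
    have *: "{u, v} \<in> induced_edges E (tball n) \<union> (\<lambda>u. {parent u, u}) ` sphere (Suc n)"
      if "adj u v" "u \<in> tball (Suc n)" "v \<in> tball (Suc n)" "level v = Suc (level u)" for u v
    proof (cases "v \<in> tball n")
      case True
      then show ?thesis using that by (auto simp: induced_edges_def tball_def)
    next
      case False
      then have v: "v \<in> sphere (Suc n)" using that by (auto simp: tball_def sphere_def)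
      then have "parent v = u" using s[OF v] that parent[of v] parent_unique by blast
      then show ?thesis using v by auto
    qed
    show "e \<in> induced_edges E (tball n) \<union> (\<lambda>u. {parent u, u}) ` sphere (Suc n)"
      using level_adj_cases[OF uv'(1)]
    proof
      assume "level v = Suc (level u)"
      from *[OF uv' this] show ?thesis unfolding uv .
    next
      assume l: "level u = Suc (level v)"
      have e: "{u, v} = {v, u}" by (rule insert_commute)
      have "adj v u" using uv'(1) unfolding e .
      from *[OF this uv'(3,2) l] show ?thesis unfolding uv e .
    qed
  next
    fix e assume "e \<in> induced_edges E (tball n) \<union> (\<lambda>u. {parent u, u}) ` sphere (Suc n)"
    then show "e \<in> induced_edges E (tball (Suc n))"
    proof
      assume "e \<in> (\<lambda>u. {parent u, u}) ` sphere (Suc n)"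
      then obtain u where "u \<in> sphere (Suc n)" "e = {parent u, u}" by blast
      then show ?thesis using s[of u] by (auto simp: induced_edges_def sphere_def tball_def)
    qed (auto simp: induced_edges_def tball_Suc)
  qed
  show "induced_edges E (tball n) \<inter> (\<lambda>u. {parent u, u}) ` sphere (Suc n) = {}"
    by (auto simp: induced_edges_def tball_def sphere_def)
qed

lemma inj_parent_edge: "inj_on (\<lambda>u. {parent u, u}) (sphere (Suc n))"
proof (rule inj_onI)
  fix u v assume u: "u \<in> sphere (Suc n)" and v: "v \<in> sphere (Suc n)" and e: "{parent u, u} = {parent v, v}"
  have "u \<in> V" "u \<noteq> r" using u by (auto simp: sphere_def)
  then have "level (parent u) = n" using u parent[of u] by (simp add: sphere_def)
  moreover have "level v = Suc n" using v by (simp add: sphere_def)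
  ultimately have "v \<noteq> parent u" by auto
  then show "u = v" using e by (auto simp: doubleton_eq_iff)
qed

lemma finite_induced: "finite (induced_edges E (tball n))"
  by (rule finite_subset[of _ "Pow (tball n)"]) (auto simp: induced_edges_def finite_tball)

end

section \<open>Cylinder sets and the Gibbs condition\<close>

definition cyl :: "nat \<Rightarrow> 'a set \<Rightarrow> 'a set \<Rightarrow> ('a \<Rightarrow> nat) \<Rightarrow> ('a \<Rightarrow> nat) set" where
  "cyl q V S \<sigma> = {\<psi> \<in> colourings q V. restrict \<psi> S = \<sigma>}"

lemma restrict_colourings: "\<psi> \<in> colourings q V \<Longrightarrow> S \<subseteq> V \<Longrightarrow> restrict \<psi> S \<in> colourings q S"
  unfolding colourings_def by (auto simp: PiE_def Pi_def)

lemma finite_colourings: "finite S \<Longrightarrow> finite (colourings q S)"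
  unfolding colourings_def by (intro finite_PiE) auto

lemma colourings_restrict_id: "\<psi> \<in> colourings q S \<Longrightarrow> restrict \<psi> S = \<psi>"
  unfolding colourings_def by (auto simp: PiE_restrict)

lemma space_cylinder_algebra: "space (cylinder_algebra q V W) = colourings q V"
  unfolding cylinder_algebra_def by (intro space_measure_of) auto

lemma sets_cylinder_algebra:
  "sets (cylinder_algebra q V W) = sigma_sets (colourings q V)
     {cyl q V U \<phi> | U \<phi>. finite U \<and> U \<subseteq> W \<and> \<phi> \<in> colourings q U}"
  unfolding cylinder_algebra_def cyl_def by (intro sets_measure_of) auto

lemma cyl_sets: "finite S \<Longrightarrow> S \<subseteq> W \<Longrightarrow> \<sigma> \<in> colourings q S \<Longrightarrow> cyl q V S \<sigma> \<in> sets (cylinder_algebra q V W)"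
  unfolding sets_cylinder_algebra by (intro sigma_sets.Basic) blast

lemma cylinder_algebra_mono: "W \<subseteq> W' \<Longrightarrow> sets (cylinder_algebra q V W) \<subseteq> sets (cylinder_algebra q V W')"
  unfolding sets_cylinder_algebra by (intro sigma_sets_mono') blast

lemma cyl_disjoint: "disjoint_family_on (cyl q V S) T"
  unfolding disjoint_family_on_def cyl_def by auto

lemma measure_Union_cyl:
  assumes M: "prob_space M" "sets M = sets (cylinder_algebra q V V)"
    and S: "finite S" "S \<subseteq> V" and T: "T \<subseteq> colourings q S"
  shows "measure M (\<Union>\<tau>\<in>T. cyl q V S \<tau>) = (\<Sum>\<tau>\<in>T. measure M (cyl q V S \<tau>))"
proof -
  interpret prob_space M by fact
  have "finite T" using T finite_colourings[OF S(1)] by (rule finite_subset)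
  moreover have "cyl q V S ` T \<subseteq> sets M" using T S unfolding M(2) by (auto intro!: cyl_sets)
  ultimately show ?thesis using cyl_disjoint by (rule finite_measure_finite_Union)
qed

lemma cyl_eq_Union:
  assumes "S' \<subseteq> S" "S \<subseteq> V"
  shows "cyl q V S' \<sigma> = (\<Union>\<tau>\<in>{\<tau> \<in> colourings q S. restrict \<tau> S' = \<sigma>}. cyl q V S \<tau>)"
proof (intro equalityI subsetI)
  fix \<psi> assume \<psi>: "\<psi> \<in> cyl q V S' \<sigma>"
  have "restrict (restrict \<psi> S) S' = restrict \<psi> S'" using assms by (simp add: Int_absorb1)
  then have "restrict \<psi> S \<in> {\<tau> \<in> colourings q S. restrict \<tau> S' = \<sigma>}" "\<psi> \<in> cyl q V S (restrict \<psi> S)"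
    using \<psi> assms by (auto simp: cyl_def intro: restrict_colourings)
  then show "\<psi> \<in> (\<Union>\<tau>\<in>{\<tau> \<in> colourings q S. restrict \<tau> S' = \<sigma>}. cyl q V S \<tau>)" by blast
next
  fix \<psi> assume "\<psi> \<in> (\<Union>\<tau>\<in>{\<tau> \<in> colourings q S. restrict \<tau> S' = \<sigma>}. cyl q V S \<tau>)"
  then have "\<psi> \<in> colourings q V" "restrict (restrict \<psi> S) S' = \<sigma>" by (auto simp: cyl_def)
  then show "\<psi> \<in> cyl q V S' \<sigma>" using assms by (simp add: cyl_def Int_absorb1)
qed

lemma measure_cyl_eq_sum:
  assumes M: "prob_space M" "sets M = sets (cylinder_algebra q V V)"
    and S: "finite S" "S' \<subseteq> S" "S \<subseteq> V"
  shows "measure M (cyl q V S' \<sigma>) = (\<Sum>\<tau> | \<tau> \<in> colourings q S \<and> restrict \<tau> S' = \<sigma>. measure M (cyl q V S \<tau>))"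
  unfolding cyl_eq_Union[OF S(2,3)] by (rule measure_Union_cyl[OF M S(1,3)]) auto

text \<open>The empty set is added to the cylinders because two of them may be disjoint.\<close>

definition cyls :: "nat \<Rightarrow> 'a set \<Rightarrow> 'a set \<Rightarrow> ('a \<Rightarrow> nat) set set" where
  "cyls q V W = insert {} {cyl q V U \<phi> | U \<phi>. finite U \<and> U \<subseteq> W \<and> \<phi> \<in> colourings q U}"

lemma sets_cylinder_algebra': "sets (cylinder_algebra q V W) = sigma_sets (colourings q V) (cyls q V W)"
  unfolding sets_cylinder_algebra cyls_def
  by (intro sigma_sets_eqI) (auto intro: sigma_sets.Basic sigma_sets.Empty)

lemma cyls_Pow: "cyls q V W \<subseteq> Pow (colourings q V)"
  unfolding cyls_def cyl_def by auto

text \<open>A nonempty intersection is the cylinder over \<open>S \<union> S'\<close> through any of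
  its points.\<close>

lemma Int_stable_cyls:
  assumes "W \<subseteq> V"
  shows "Int_stable (cyls q V W)"
proof (rule Int_stableI)
  fix A B assume AB: "A \<in> cyls q V W" "B \<in> cyls q V W"
  show "A \<inter> B \<in> cyls q V W"
  proof (cases "A \<inter> B = {}")
    case True
    then show ?thesis by (simp add: cyls_def)
  next
    case False
    then obtain S \<sigma> S' \<sigma>' where S: "finite S" "S \<subseteq> W" "\<sigma> \<in> colourings q S" "A = cyl q V S \<sigma>"
      and S': "finite S'" "S' \<subseteq> W" "\<sigma>' \<in> colourings q S'" "B = cyl q V S' \<sigma>'"
      using AB unfolding cyls_def by blast
    obtain \<psi> where \<psi>: "\<psi> \<in> colourings q V" "restrict \<psi> S = \<sigma>" "restrict \<psi> S' = \<sigma>'"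
      using False unfolding S S' by (auto simp: cyl_def)
    have eq: "A \<inter> B = cyl q V (S \<union> S') (restrict \<psi> (S \<union> S'))"
      unfolding S S' cyl_def using \<psi>(2,3) by (auto simp: restrict_def fun_eq_iff) metis+
    have "S \<union> S' \<subseteq> V" using S S' assms by blast
    then have "restrict \<psi> (S \<union> S') \<in> colourings q (S \<union> S')"
      using \<psi>(1) by (intro restrict_colourings)
    moreover have "finite (S \<union> S')" "S \<union> S' \<subseteq> W" using S S' by auto
    ultimately show ?thesis unfolding eq cyls_def by blast
  qed
qed

lemma cylinder_algebra_measure_eqI:
  assumes M: "prob_space M" "sets M = sets (cylinder_algebra q V V)"
    and N: "prob_space N" "sets N = sets (cylinder_algebra q V V)"
    and eq: "\<And>S \<sigma>. finite S \<Longrightarrow> S \<subseteq> V \<Longrightarrow> \<sigma> \<in> colourings q S \<Longrightarrow>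
      measure M (cyl q V S \<sigma>) = measure N (cyl q V S \<sigma>)"
  shows "M = N"
proof -
  interpret M: prob_space M by fact
  interpret N: prob_space N by fact
  have sp: "space M = colourings q V" using sets_eq_imp_space_eq[OF M(2)] by (simp add: space_cylinder_algebra)
  show ?thesis
  proof (rule measure_eqI_generator_eq[where E = "cyls q V V" and \<Omega> = "colourings q V" and A = "\<lambda>_. colourings q V"])
    fix X assume "X \<in> cyls q V V"
    then show "emeasure M X = emeasure N X"
      using eq unfolding cyls_def by (auto simp: M.emeasure_eq_measure N.emeasure_eq_measure)
  next
    have "cyl q V {} (\<lambda>_. undefined) = colourings q V" by (auto simp: cyl_def)
    moreover have "(\<lambda>_. undefined) \<in> colourings q {}" by (simp add: colourings_def)
    ultimately show "range (\<lambda>_::nat. colourings q V) \<subseteq> cyls q V V" unfolding cyls_def by blast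
    show "emeasure M (colourings q V) \<noteq> \<infinity>" using M.emeasure_space_1 unfolding sp by simp
  qed (use M N in \<open>simp_all add: Int_stable_cyls cyls_Pow sets_cylinder_algebra'\<close>)
qed

lemma inner_part_props:
  assumes "U \<subseteq> V"
  shows "bdry V E U \<subseteq> U" "bdry V E U \<subseteq> V - inner_part V E U" "inner_part V E U \<subseteq> U"
  using assms by (auto simp: bdry_def inner_part_def)

lemma finite_cond_prob_cong:
  assumes "U \<subseteq> V" "restrict \<phi> U = \<tau>"
  shows "finite_cond_prob q w V E U \<phi> = finite_cond_prob q w V E U \<tau>"
proof -
  have "\<phi> v = \<tau> v" if "v \<in> bdry V E U" for v
    using that assms inner_part_props(1)[OF assms(1), of E] by (auto simp: restrict_def)
  moreover have "restrict \<tau> U = \<tau>" using assms(2) by auto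
  ultimately show ?thesis unfolding finite_cond_prob_def assms(2) by simp
qed

text \<open>The Gibbs condition determines the conditional probability \<open>g\<close> of the
  colouring \<open>\<sigma>\<close> of \<open>U\<close> only at points that themselves restrict to
  \<open>\<sigma>\<close>, not on the whole boundary cylinder \<open>A\<close>. But where
  \<open>g > \<gamma> \<sigma>\<close> within \<open>A\<close>, the event
  \<open>cyl q V U \<sigma>\<close> has measure zero, so \<open>g\<close> integrates to 0 there and
  that part of \<open>A\<close> is null. This gives upper bounds for all \<open>\<sigma>\<close>,
  and they are equalities because both sides add up to the measure of \<open>A\<close>.\<close>

lemma gibbs_cylinder:
  assumes G: "gibbs_measure q w V E M" and U: "finite U" "U \<subseteq> V" and w: "w > 0"
    and \<tau>: "\<tau> \<in> colourings q U"
  defines "D \<equiv> bdry V E U"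
  shows "measure M (cyl q V U \<tau>) = finite_cond_prob q w V E U \<tau> * measure M (cyl q V D (restrict \<tau> D))"
proof -
  define F where "F = cylinder_algebra q V (V - inner_part V E U)"
  define \<gamma> where "\<gamma> = finite_cond_prob q w V E U"
  have M: "prob_space M" "sets M = sets (cylinder_algebra q V V)" using G by (auto simp: gibbs_measure_def)
  interpret prob_space M by fact
  have sp: "space M = colourings q V" using sets_eq_imp_space_eq[OF M(2)] by (simp add: space_cylinder_algebra)
  have sub: "subalgebra M F"
    unfolding subalgebra_def F_def sp space_cylinder_algebra M(2)
    by (intro conjI refl cylinder_algebra_mono Diff_subset)
  interpret finite_measure_subalgebra M F by unfold_locales (rule sub)
  have D: "D \<subseteq> U" "D \<subseteq> V - inner_part V E U" "finite D" "D \<subseteq> V"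
    using inner_part_props[OF U(2), of E] U finite_subset unfolding D_def by blast+
  define A where "A = cyl q V D (restrict \<tau> D)"
  have AF: "A \<in> sets F" unfolding A_def F_def using D \<tau> by (intro cyl_sets restrict_colourings) (auto intro: restrict_colourings)
  then have AM: "A \<in> sets M" using sub by (auto simp: subalgebra_def)
  define T where "T = {\<sigma> \<in> colourings q U. restrict \<sigma> D = restrict \<tau> D}"
  have Tfin: "finite T" unfolding T_def using finite_colourings[OF U(1)] by simp
  define W where "W \<sigma> = potts_weight w (induced_edges E U) \<sigma>" for \<sigma>
  have Wpos: "W \<sigma> > 0" for \<sigma> using w by (simp add: W_def potts_weight_def)
  have \<tau>T: "\<tau> \<in> T" using \<tau> by (simp add: T_def)
  have \<gamma>: "\<gamma> \<sigma> = W \<sigma> / (\<Sum>\<sigma>\<in>T. W \<sigma>)" if "\<sigma> \<in> T" for \<sigma>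
  proof -
    have "(\<forall>v\<in>D. \<rho> v = \<sigma> v) \<longleftrightarrow> restrict \<rho> D = restrict \<tau> D" for \<rho>
    proof -
      have "(\<forall>v\<in>D. \<rho> v = \<sigma> v) \<longleftrightarrow> restrict \<rho> D = restrict \<sigma> D" by (auto simp: restrict_def fun_eq_iff)
      then show ?thesis using that by (simp add: T_def)
    qed
    then have "{\<rho>. \<rho> \<in> colourings q U \<and> (\<forall>v\<in>bdry V E U. \<rho> v = \<sigma> v)} = T" by (simp add: T_def D_def)
    moreover have "restrict \<sigma> U = \<sigma>" using that unfolding T_def by (auto intro: colourings_restrict_id)
    ultimately show ?thesis by (simp add: \<gamma>_def finite_cond_prob_def W_def)
  qed
  have Wsum: "(\<Sum>\<sigma>\<in>T. W \<sigma>) > 0" using Tfin \<tau>T Wpos by (intro sum_pos) auto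
  have \<gamma>pos: "\<gamma> \<sigma> > 0" if "\<sigma> \<in> T" for \<sigma> using \<gamma>[OF that] Wpos Wsum by simp
  have \<gamma>sum: "(\<Sum>\<sigma>\<in>T. \<gamma> \<sigma>) = 1" using \<gamma> Wsum by (simp flip: sum_divide_distrib)
  have cU: "cyl q V U \<sigma> \<in> sets M" if "\<sigma> \<in> T" for \<sigma>
    unfolding M(2) using that U by (intro cyl_sets) (auto simp: T_def)
  have AU: "A = (\<Union>\<sigma>\<in>T. cyl q V U \<sigma>)" unfolding A_def T_def by (rule cyl_eq_Union[OF D(1) U(2)])
  have le: "measure M (cyl q V U \<sigma>) \<le> \<gamma> \<sigma> * measure M A" if \<sigma>: "\<sigma> \<in> T" for \<sigma>
  proof -
    define f where "f = indicat_real (cyl q V U \<sigma>)"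
    define g where "g = real_cond_exp M F f"
    have fint: "integrable M f" unfolding f_def using cU[OF \<sigma>] by (simp add: integrable_real_indicator less_top[symmetric])
    have gint: "integrable M g" unfolding g_def using fint by (rule real_cond_exp_int)
    have gsint: "set_integrable M B g" if "B \<in> sets M" for B
      unfolding set_integrable_def by (rule integrable_mult_indicator[OF that gint])
    have cint: "set_integrable M B (\<lambda>_. \<gamma> \<sigma>)" if "B \<in> sets M" for B
      unfolding set_integrable_def by (rule integrable_mult_indicator[OF that]) simp
    have gF: "g \<in> borel_measurable F" unfolding g_def by simp
    have setint: "(LINT x:B|M. g x) = measure M (B \<inter> cyl q V U \<sigma>)" if "B \<in> sets F" for B
    proof -
      have "B \<in> sets M" using that sub by (auto simp: subalgebra_def)
      have "(LINT x:B|M. g x) = (LINT x:B|M. f x)" unfolding g_def using real_cond_exp_intA[OF fint that] by simp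
      also have "\<dots> = (LINT x|M. indicat_real (B \<inter> cyl q V U \<sigma>) x)"
        unfolding set_lebesgue_integral_def f_def by (simp add: indicator_inter_arith)
      also have "\<dots> = measure M (B \<inter> cyl q V U \<sigma>)"
        using \<open>B \<in> sets M\<close> cU[OF \<sigma>] by (simp add: integral_indicator)
      finally show ?thesis .
    qed
    have "AE \<phi> in M. real_cond_exp M F (indicat_real (cyl q V U (restrict \<phi> U))) \<phi> = \<gamma> \<phi>"
      using G U unfolding gibbs_measure_def F_def \<gamma>_def cyl_def by blast
    then have ae: "AE \<phi> in M. \<phi> \<in> cyl q V U \<sigma> \<longrightarrow> g \<phi> = \<gamma> \<sigma>"
    proof (rule AE_mp, intro AE_I2 impI)
      fix \<phi> assume 1: "real_cond_exp M F (indicat_real (cyl q V U (restrict \<phi> U))) \<phi> = \<gamma> \<phi>" and "\<phi> \<in> cyl q V U \<sigma>"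
      then have r: "restrict \<phi> U = \<sigma>" by (simp add: cyl_def)
      have "\<gamma> \<phi> = \<gamma> \<sigma>" unfolding \<gamma>_def by (rule finite_cond_prob_cong[OF U(2) r])
      then show "g \<phi> = \<gamma> \<sigma>" using 1 unfolding g_def f_def r by simp
    qed
    define B where "B = {\<phi> \<in> space F. \<gamma> \<sigma> < g \<phi>} \<inter> A"
    have BF: "B \<in> sets F" unfolding B_def using gF AF by (intro sets.Int) measurable
    then have BM: "B \<in> sets M" using sub by (auto simp: subalgebra_def)
    have "AE \<phi> in M. \<phi> \<notin> B \<inter> cyl q V U \<sigma>"
      using ae by (rule AE_mp) (intro AE_I2, auto simp: B_def)
    then have B0: "measure M (B \<inter> cyl q V U \<sigma>) = 0"
      using BM cU[OF \<sigma>] by (subst prob_eq_0) auto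
    have "\<gamma> \<sigma> * measure M B = (LINT x:B|M. \<gamma> \<sigma>)" using BM by (simp add: set_integral_const)
    also have "\<dots> \<le> (LINT x:B|M. g x)"
      by (rule set_integral_mono[OF cint[OF BM] gsint[OF BM]]) (auto simp: B_def)
    also have "\<dots> = 0" using setint[OF BF] B0 by simp
    finally have "measure M B = 0" using \<gamma>pos[OF \<sigma>] by (simp add: mult_le_0_iff measure_le_0_iff)
    then have "AE \<phi> in M. \<phi> \<notin> B" using BM by (subst (asm) prob_eq_0) auto
    then have gle: "AE \<phi> in M. \<phi> \<in> A \<longrightarrow> g \<phi> \<le> \<gamma> \<sigma>"
      by (rule AE_mp) (intro AE_I2, auto simp: B_def F_def space_cylinder_algebra sp)
    have "measure M (cyl q V U \<sigma>) = measure M (A \<inter> cyl q V U \<sigma>)"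
      using AU \<sigma> by (intro arg_cong[where f = "measure M"]) auto
    also have "\<dots> = (LINT x:A|M. g x)" using setint[OF AF] by simp
    also have "\<dots> \<le> (LINT x:A|M. \<gamma> \<sigma>)"
    proof (rule set_integral_mono_AE)
      show "set_integrable M A g" "set_integrable M A (\<lambda>_. \<gamma> \<sigma>)" using AM by (rule gsint, rule cint)
      show "AE x\<in>A in M. g x \<le> \<gamma> \<sigma>" using gle by simp
    qed
    also have "\<dots> = \<gamma> \<sigma> * measure M A" using AM by (simp add: set_integral_const)
    finally show ?thesis .
  qed
  have "measure M A = (\<Sum>\<sigma>\<in>T. measure M (cyl q V U \<sigma>))"
    unfolding AU by (rule measure_Union_cyl[OF M U]) (simp add: T_def)
  moreover have "(\<Sum>\<sigma>\<in>T. \<gamma> \<sigma> * measure M A) = measure M A"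
    unfolding sum_distrib_right[symmetric] \<gamma>sum by simp
  ultimately have "(\<Sum>\<sigma>\<in>T. \<gamma> \<sigma> * measure M A - measure M (cyl q V U \<sigma>)) = 0"
    unfolding sum_subtractf by linarith
  then have "\<forall>\<sigma>\<in>T. \<gamma> \<sigma> * measure M A - measure M (cyl q V U \<sigma>) = 0"
    using le Tfin by (subst (asm) sum_nonneg_eq_0_iff) auto
  then show ?thesis using \<tau>T by (auto simp: \<gamma>_def A_def)
qed

section \<open>Summation over the outer levels of a ball\<close>

context rooted_tree
begin

text \<open>Each edge is attributed to its endpoint farther from the root, which turns the weight of
  a ball into a product over the vertices other than the root.\<close>

lemma tball_edges:
  "induced_edges E (tball n) = (\<lambda>u. {parent u, u}) ` (tball n - {r})"
  "inj_on (\<lambda>u. {parent u, u}) (tball n - {r})"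
proof (induction n)
  case 0
  {
    case 1
    have "e = {}" if "e \<in> induced_edges E (tball 0)" "e \<noteq> {r}" for e using that by (auto simp: induced_edges_def tball_0)
    moreover have "card e = 2" if "e \<in> E" for e
      using that tree unfolding infinite_regular_tree_def tree_graph_def simple_graph_def by auto
    ultimately show ?case by (force simp: tball_0 induced_edges_def)
  next
    case 2
    show ?case by (simp add: tball_0)
  }
next
  case (Suc n)
  have t: "tball (Suc n) - {r} = (tball n - {r}) \<union> sphere (Suc n)"
    by (auto simp: tball_Suc sphere_def)
  {
    case 1
    show ?case unfolding t image_Un induced_tball_Suc(1) Suc(1) ..
  next
    case 2
    show ?case unfolding t
    proof (rule inj_on_Un[THEN iffD2], intro conjI Suc(2) inj_parent_edge)
      show "(\<lambda>u. {parent u, u}) ` (tball n - {r} - sphere (Suc n)) \<inter> (\<lambda>u. {parent u, u}) ` (sphere (Suc n) - (tball n - {r})) = {}"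
        (is "?A \<inter> ?B = {}")
      proof -
        have "?A \<inter> ?B \<subseteq> (\<lambda>u. {parent u, u}) ` (tball n - {r}) \<inter> (\<lambda>u. {parent u, u}) ` sphere (Suc n)"
          by (intro Int_mono image_mono Diff_subset)
        then show ?thesis using induced_tball_Suc(2)[of n] unfolding Suc(1) by (simp only: subset_empty)
      qed
    qed
  }
qed

lemma potts_weight_tball:
  "potts_weight w (induced_edges E (tball n)) \<sigma> = (\<Prod>v\<in>tball n - {r}. if \<sigma> v = \<sigma> (parent v) then w else 1)"
proof -
  have "{e \<in> induced_edges E (tball n). \<forall>u\<in>e. \<forall>v\<in>e. \<sigma> u = \<sigma> v}
      = (\<lambda>u. {parent u, u}) ` {v \<in> tball n - {r}. \<sigma> v = \<sigma> (parent v)}"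
  proof -
    have im: "{e \<in> f ` S. P e} = f ` {v \<in> S. P (f v)}" for f :: "'a \<Rightarrow> 'a set" and S P
      by (rule set_eqI) (simp only: mem_Collect_eq image_iff, blast)
    have "(\<forall>u\<in>{parent x, x}. \<forall>v\<in>{parent x, x}. \<sigma> u = \<sigma> v) \<longleftrightarrow> \<sigma> x = \<sigma> (parent x)" for x
      by auto
    then show ?thesis unfolding tball_edges(1) im by (simp only:)
  qed
  then have "num_mono (induced_edges E (tball n)) \<sigma> = card {v \<in> tball n - {r}. \<sigma> v = \<sigma> (parent v)}"
    unfolding num_mono_def by (simp only:) (intro card_image inj_on_subset[OF tball_edges(2)[of n]], auto)
  moreover have "(\<Prod>v\<in>tball n - {r}. if \<sigma> v = \<sigma> (parent v) then w else 1)
      = w ^ card {v \<in> tball n - {r}. \<sigma> v = \<sigma> (parent v)}"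
    using finite_tball[of n] by (simp add: prod.If_cases Int_def)
  ultimately show ?thesis by (simp add: potts_weight_def)
qed

lemma parent_in_tball: "v \<in> tball n - {r} \<Longrightarrow> parent v \<in> tball n"
  using parent[of v] adjD by (auto simp: tball_def)

lemma prod_sphere_Suc:
  fixes f :: "'a \<Rightarrow> real"
  shows "(\<Prod>u\<in>sphere (Suc n). f u) = (\<Prod>v\<in>sphere n. \<Prod>u\<in>children v. f u)"
  unfolding sphere_Suc
proof (rule prod.UNION_disjoint)
  show "finite (sphere n)" by (rule finite_sphere)
  show "\<forall>v\<in>sphere n. finite (children v)" by (auto simp: sphere_def intro: finite_children)
qed (auto simp: children_iff)

lemma potts_weight_Suc:
  "potts_weight w (induced_edges E (tball (Suc n))) \<sigma> = potts_weight w (induced_edges E (tball n)) \<sigma> *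
     (\<Prod>v\<in>sphere n. \<Prod>u\<in>children v. if \<sigma> u = \<sigma> v then w else 1)"
proof -
  have t: "tball (Suc n) - {r} = (tball n - {r}) \<union> sphere (Suc n)" "(tball n - {r}) \<inter> sphere (Suc n) = {}"
    by (auto simp: tball_Suc sphere_def tball_def)
  have "(\<Prod>u\<in>sphere (Suc n). if \<sigma> u = \<sigma> (parent u) then w else 1)
      = (\<Prod>v\<in>sphere n. \<Prod>u\<in>children v. if \<sigma> u = \<sigma> (parent u) then w else 1)"
    by (rule prod_sphere_Suc)
  also have "\<dots> = (\<Prod>v\<in>sphere n. \<Prod>u\<in>children v. if \<sigma> u = \<sigma> v then w else 1)"
    by (intro prod.cong) (auto simp: children_iff)
  finally show ?thesis
    unfolding potts_weight_tball t(1) using t(2) finite_tball finite_sphere by (subst prod.union_disjoint) auto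
qed

text \<open>A partition function of the ball of radius \<open>n\<close> with the inner ball of
  radius \<open>k\<close> frozen to \<open>\<alpha>\<close> and a factor \<open>F v\<close> at each
  vertex of the outer sphere. The factors allow the outer levels to be summed out one at a
  time.\<close>

definition partition_sum :: "nat \<Rightarrow> real \<Rightarrow> nat \<Rightarrow> nat \<Rightarrow> ('a \<Rightarrow> nat) \<Rightarrow> ('a \<Rightarrow> nat \<Rightarrow> real) \<Rightarrow> real" where
  "partition_sum q w k n \<alpha> F = (\<Sum>\<tau> | \<tau> \<in> colourings q (tball n) \<and> restrict \<tau> (tball k) = \<alpha>.
     potts_weight w (induced_edges E (tball n)) \<tau> * (\<Prod>v\<in>sphere n. F v (\<tau> v)))"

lemma sum_product_PiE:
  fixes f :: "'a \<Rightarrow> nat \<Rightarrow> real"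
  assumes "finite S"
  shows "(\<Sum>\<rho>\<in>colourings q S. \<Prod>u\<in>S. f u (\<rho> u)) = (\<Prod>u\<in>S. \<Sum>j\<in>{1..q}. f u j)"
  unfolding colourings_def using assms by (subst prod_sum_PiE) auto

lemma colouring_union_bij:
  assumes "A \<inter> B = {}"
  shows "bij_betw (\<lambda>(\<tau>, \<rho>) x. if x \<in> A then \<tau> x else \<rho> x) (colourings q A \<times> colourings q B) (colourings q (A \<union> B))"
  by (rule bij_betwI[where g = "\<lambda>\<sigma>. (restrict \<sigma> A, restrict \<sigma> B)"])
     (use assms in \<open>auto simp: colourings_def PiE_def Pi_def extensional_def restrict_def fun_eq_iff split: if_splits\<close>)

lemma partition_sum_Suc:
  assumes "k \<le> n"
  shows "partition_sum q w k (Suc n) \<alpha> F = partition_sum q w k n \<alpha> (\<lambda>v i. \<Prod>u\<in>children v. message q w (F u) i)"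
proof -
  let ?W = "\<lambda>n. potts_weight w (induced_edges E (tball n))"
  define g where "g = (\<lambda>(\<tau>, \<rho>) x. if x \<in> tball n then \<tau> x else \<rho> x :: nat)"
  define A where "A = {\<tau>. \<tau> \<in> colourings q (tball n) \<and> restrict \<tau> (tball k) = \<alpha>}"
  define C where "C = colourings q (sphere (Suc n))"
  define B where "B = {\<tau>. \<tau> \<in> colourings q (tball (Suc n)) \<and> restrict \<tau> (tball k) = \<alpha>}"
  have kn: "tball k \<subseteq> tball n" using assms by (rule tball_mono)
  have b: "bij_betw g (colourings q (tball n) \<times> C) (colourings q (tball (Suc n)))"
    unfolding g_def C_def tball_Suc(1) by (rule colouring_union_bij[OF tball_Suc(2)])
  have res: "restrict (g p) (tball k) = restrict (fst p) (tball k)" for p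
    using kn by (auto simp: g_def restrict_def fun_eq_iff split: prod.splits)
  have bij: "bij_betw g (A \<times> C) B"
    unfolding bij_betw_def
  proof
    show "inj_on g (A \<times> C)" using b by (auto simp: bij_betw_def A_def intro: inj_on_subset)
    have "g ` (A \<times> C) = {\<tau> \<in> g ` (colourings q (tball n) \<times> C). restrict \<tau> (tball k) = \<alpha>}"
      by (auto simp: A_def res image_iff)
    also have "\<dots> = B" using b by (auto simp: bij_betw_def B_def)
    finally show "g ` (A \<times> C) = B" .
  qed
  have sph: "v \<in> tball n" "v \<notin> sphere (Suc n)" if "v \<in> sphere n" for v using that by (auto simp: sphere_def tball_def)
  have chi: "u \<in> sphere (Suc n)" "u \<notin> tball n" if "v \<in> sphere n" "u \<in> children v" for u v
    using that by (auto simp: sphere_Suc) (auto simp: children_def sphere_def tball_def)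
  have Wg: "?W (Suc n) (g (\<tau>, \<rho>)) = ?W n \<tau> * (\<Prod>u\<in>sphere (Suc n). if \<rho> u = \<tau> (parent u) then w else 1)" for \<tau> \<rho>
  proof -
    have 1: "?W n (g (\<tau>, \<rho>)) = ?W n \<tau>"
      unfolding potts_weight_tball by (intro prod.cong) (auto simp: g_def parent_in_tball)
    have "(\<Prod>v\<in>sphere n. \<Prod>u\<in>children v. if g (\<tau>, \<rho>) u = g (\<tau>, \<rho>) v then w else 1)
        = (\<Prod>v\<in>sphere n. \<Prod>u\<in>children v. if \<rho> u = \<tau> (parent u) then w else 1)"
      using sph chi by (intro prod.cong) (auto simp: g_def children_iff)
    also have "\<dots> = (\<Prod>u\<in>sphere (Suc n). if \<rho> u = \<tau> (parent u) then w else 1)"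
      by (rule prod_sphere_Suc[symmetric])
    finally show ?thesis unfolding potts_weight_Suc 1 by simp
  qed
  have "partition_sum q w k (Suc n) \<alpha> F = (\<Sum>p\<in>A \<times> C. ?W (Suc n) (g p) * (\<Prod>u\<in>sphere (Suc n). F u (g p u)))"
    unfolding partition_sum_def B_def[symmetric] by (rule sum.reindex_bij_betw[OF bij, symmetric])
  also have "\<dots> = (\<Sum>\<tau>\<in>A. \<Sum>\<rho>\<in>C. ?W (Suc n) (g (\<tau>, \<rho>)) * (\<Prod>u\<in>sphere (Suc n). F u (g (\<tau>, \<rho>) u)))"
    by (simp add: sum.cartesian_product)
  also have "\<dots> = (\<Sum>\<tau>\<in>A. \<Sum>\<rho>\<in>C. ?W n \<tau> * (\<Prod>u\<in>sphere (Suc n). (if \<rho> u = \<tau> (parent u) then w else 1) * F u (\<rho> u)))"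
  proof (intro sum.cong refl)
    fix \<tau> \<rho>
    have "(\<Prod>u\<in>sphere (Suc n). F u (g (\<tau>, \<rho>) u)) = (\<Prod>u\<in>sphere (Suc n). F u (\<rho> u))"
      by (intro prod.cong) (auto simp: g_def sphere_def tball_def)
    then show "?W (Suc n) (g (\<tau>, \<rho>)) * (\<Prod>u\<in>sphere (Suc n). F u (g (\<tau>, \<rho>) u))
      = ?W n \<tau> * (\<Prod>u\<in>sphere (Suc n). (if \<rho> u = \<tau> (parent u) then w else 1) * F u (\<rho> u))"
      unfolding Wg by (simp add: prod.distrib)
  qed
  also have "\<dots> = (\<Sum>\<tau>\<in>A. ?W n \<tau> * (\<Prod>u\<in>sphere (Suc n). message q w (F u) (\<tau> (parent u))))"
  proof (intro sum.cong refl)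
    fix \<tau>
    have "(\<Sum>\<rho>\<in>C. \<Prod>u\<in>sphere (Suc n). (if \<rho> u = \<tau> (parent u) then w else 1) * F u (\<rho> u))
        = (\<Prod>u\<in>sphere (Suc n). message q w (F u) (\<tau> (parent u)))"
      unfolding C_def message_def
      by (rule sum_product_PiE[OF finite_sphere, where f = "\<lambda>u j. (if j = \<tau> (parent u) then w else 1) * F u j"])
    then show "(\<Sum>\<rho>\<in>C. ?W n \<tau> * (\<Prod>u\<in>sphere (Suc n). (if \<rho> u = \<tau> (parent u) then w else 1) * F u (\<rho> u)))
      = ?W n \<tau> * (\<Prod>u\<in>sphere (Suc n). message q w (F u) (\<tau> (parent u)))"
      by (simp flip: sum_distrib_left)
  qed
  also have "\<dots> = partition_sum q w k n \<alpha> (\<lambda>v i. \<Prod>u\<in>children v. message q w (F u) i)"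
    unfolding partition_sum_def A_def[symmetric]
  proof (intro sum.cong refl arg_cong2[where f = "(*)"])
    fix \<tau>
    have "(\<Prod>u\<in>sphere (Suc n). message q w (F u) (\<tau> (parent u)))
        = (\<Prod>v\<in>sphere n. \<Prod>u\<in>children v. message q w (F u) (\<tau> (parent u)))"
      by (rule prod_sphere_Suc)
    also have "\<dots> = (\<Prod>v\<in>sphere n. \<Prod>u\<in>children v. message q w (F u) (\<tau> v))"
      by (intro prod.cong) (auto simp: children_iff)
    finally show "(\<Prod>u\<in>sphere (Suc n). message q w (F u) (\<tau> (parent u)))
        = (\<Prod>v\<in>sphere n. \<Prod>u\<in>children v. message q w (F u) (\<tau> v))" .
  qed
  finally show ?thesis .
qed

text \<open>The weight vector of a vertex \<open>j\<close> levels above the boundary colouring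
  \<open>\<eta>\<close>; at the boundary it is the indicator of the prescribed colour.\<close>

primrec field :: "nat \<Rightarrow> real \<Rightarrow> ('a \<Rightarrow> nat) \<Rightarrow> nat \<Rightarrow> 'a \<Rightarrow> nat \<Rightarrow> real" where
  "field q w \<eta> 0 v i = (if i = \<eta> v then 1 else 0)"
| "field q w \<eta> (Suc j) v i = (\<Prod>u\<in>children v. message q w (field q w \<eta> j u) i)"

lemma partition_sum_field:
  "partition_sum q w k (k + j) \<alpha> (field q w \<eta> i) = partition_sum q w k k \<alpha> (field q w \<eta> (i + j))"
proof (induction j arbitrary: i)
  case (Suc j)
  have "(\<lambda>v c. \<Prod>u\<in>children v. message q w (field q w \<eta> i u) c) = field q w \<eta> (Suc i)"
    by (intro ext) simp
  then show ?case using Suc[of "Suc i"] partition_sum_Suc[of k "k + j" q w \<alpha> "field q w \<eta> i"] by simp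
qed simp

lemma partition_sum_top:
  assumes "\<alpha> \<in> colourings q (tball k)"
  shows "partition_sum q w k k \<alpha> F = potts_weight w (induced_edges E (tball k)) \<alpha> * (\<Prod>v\<in>sphere k. F v (\<alpha> v))"
proof -
  have "{\<tau>. \<tau> \<in> colourings q (tball k) \<and> restrict \<tau> (tball k) = \<alpha>} = {\<alpha>}"
    using assms colourings_restrict_id by auto
  then show ?thesis unfolding partition_sum_def by simp
qed

lemma mult_ite: "x * (if P then 1 else 0) = (if P then x else 0)" for x :: real
  by simp

lemma partition_sum_boundary:
  assumes \<eta>: "\<eta> \<in> colourings q (sphere n)"
  shows "partition_sum q w k n \<alpha> (field q w \<eta> 0) =
    (\<Sum>\<tau> | \<tau> \<in> colourings q (tball n) \<and> restrict \<tau> (tball k) = \<alpha> \<and> restrict \<tau> (sphere n) = \<eta>.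
       potts_weight w (induced_edges E (tball n)) \<tau>)"
proof -
  have "(\<Prod>v\<in>sphere n. field q w \<eta> 0 v (\<tau> v)) = (if restrict \<tau> (sphere n) = \<eta> then 1 else 0)" for \<tau>
  proof (cases "restrict \<tau> (sphere n) = \<eta>")
    case True
    have "\<tau> v = \<eta> v" if "v \<in> sphere n" for v
      using fun_cong[OF True, of v] that by simp
    then have "(\<Prod>v\<in>sphere n. field q w \<eta> 0 v (\<tau> v)) = (\<Prod>v\<in>sphere n. 1)" by (intro prod.cong) simp_all
    then show ?thesis by (simp only: True prod.neutral_const simp_thms if_True)
  next
    case False
    have "\<exists>v\<in>sphere n. \<tau> v \<noteq> \<eta> v"
    proof (rule ccontr)
      assume "\<not> ?thesis"
      then have "restrict \<tau> (sphere n) = restrict \<eta> (sphere n)" by (intro restrict_ext) blast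
      then show False using False unfolding colourings_restrict_id[OF \<eta>] by contradiction
    qed
    then have "(\<Prod>v\<in>sphere n. field q w \<eta> 0 v (\<tau> v)) = 0"
      by (intro prod_zero finite_sphere) auto
    then show ?thesis by (simp only: False if_False)
  qed
  note F = this
  define A where "A = {\<tau>. \<tau> \<in> colourings q (tball n) \<and> restrict \<tau> (tball k) = \<alpha>}"
  have Afin: "finite A" unfolding A_def using finite_colourings[OF finite_tball] by simp
  have "{\<tau>. \<tau> \<in> colourings q (tball n) \<and> restrict \<tau> (tball k) = \<alpha> \<and> restrict \<tau> (sphere n) = \<eta>}
      = {\<tau> \<in> A. restrict \<tau> (sphere n) = \<eta>}" unfolding A_def by blast
  moreover have "partition_sum q w k n \<alpha> (field q w \<eta> 0)
      = (\<Sum>\<tau>\<in>A. if restrict \<tau> (sphere n) = \<eta> then potts_weight w (induced_edges E (tball n)) \<tau> else 0)"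
    unfolding partition_sum_def A_def[symmetric] F by (rule sum.cong[OF refl]) (rule mult_ite)
  ultimately show ?thesis by (simp only: sum.inter_filter[OF Afin])
qed

end

section \<open>Uniqueness\<close>

context rooted_tree
begin

text \<open>The boundary of \<open>tball n\<close> is \<open>sphere n\<close>, so
  \<open>gibbs_cylinder\<close> expresses the law on the inner ball as an average, over the
  colouring of the sphere, of finite conditional probabilities.\<close>

lemma gibbs_ball:
  assumes G: "gibbs_measure q w V E M" and w: "w > 0" and kn: "k \<le> n"
  shows "measure M (cyl q V (tball k) \<alpha>) = (\<Sum>\<eta>\<in>colourings q (sphere n). measure M (cyl q V (sphere n) \<eta>) *
     (partition_sum q w k n \<alpha> (field q w \<eta> 0) /
       (\<Sum>\<beta>\<in>colourings q (tball k). partition_sum q w k n \<beta> (field q w \<eta> 0))))"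
proof -
  let ?W = "potts_weight w (induced_edges E (tball n))"
  have M: "prob_space M" "sets M = sets (cylinder_algebra q V V)" using G by (auto simp: gibbs_measure_def)
  define A where "A = {\<tau>. \<tau> \<in> colourings q (tball n) \<and> restrict \<tau> (tball k) = \<alpha>}"
  have Afin: "finite A" unfolding A_def using finite_colourings[OF finite_tball] by simp
  define Z where "Z \<eta> = (\<Sum>\<beta>\<in>colourings q (tball k). partition_sum q w k n \<beta> (field q w \<eta> 0))" for \<eta>
  have fin: "finite (colourings q (sphere n))" by (intro finite_colourings finite_sphere)
  have Z: "Z \<eta> = (\<Sum>\<tau> | \<tau> \<in> colourings q (tball n) \<and> restrict \<tau> (sphere n) = \<eta>. ?W \<tau>)"
    if "\<eta> \<in> colourings q (sphere n)" for \<eta>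
  proof -
    have "Z \<eta> = (\<Sum>\<beta>\<in>colourings q (tball k).
        \<Sum>\<tau> | \<tau> \<in> {\<tau>. \<tau> \<in> colourings q (tball n) \<and> restrict \<tau> (sphere n) = \<eta>} \<and> restrict \<tau> (tball k) = \<beta>. ?W \<tau>)"
      unfolding Z_def partition_sum_boundary[OF that] by (intro sum.cong) auto
    also have "\<dots> = (\<Sum>\<tau> | \<tau> \<in> colourings q (tball n) \<and> restrict \<tau> (sphere n) = \<eta>. ?W \<tau>)"
    proof (rule sum.group)
      show "(\<lambda>\<tau>. restrict \<tau> (tball k)) ` {\<tau>. \<tau> \<in> colourings q (tball n) \<and> restrict \<tau> (sphere n) = \<eta>} \<subseteq> colourings q (tball k)"
        using tball_mono[OF kn] by (auto intro: restrict_colourings)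
    qed (simp_all add: finite_colourings finite_tball)
    finally show ?thesis .
  qed
  have cyl: "measure M (cyl q V (tball n) \<tau>) = ?W \<tau> / Z (restrict \<tau> (sphere n)) * measure M (cyl q V (sphere n) (restrict \<tau> (sphere n)))"
    if \<tau>: "\<tau> \<in> colourings q (tball n)" for \<tau>
  proof -
    have r: "restrict \<tau> (sphere n) \<in> colourings q (sphere n)" by (rule restrict_colourings[OF \<tau> sphere_subset_tball])
    have "{\<sigma>. \<sigma> \<in> colourings q (tball n) \<and> (\<forall>v\<in>sphere n. \<sigma> v = \<tau> v)}
       = {\<sigma>. \<sigma> \<in> colourings q (tball n) \<and> restrict \<sigma> (sphere n) = restrict \<tau> (sphere n)}"
    proof -
      have "(\<forall>v\<in>sphere n. \<sigma> v = \<tau> v) \<longleftrightarrow> restrict \<sigma> (sphere n) = restrict \<tau> (sphere n)" for \<sigma>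
        by (metis restrict_apply' restrict_ext)
      then show ?thesis by (simp only:)
    qed
    then have "finite_cond_prob q w V E (tball n) \<tau> = ?W \<tau> / Z (restrict \<tau> (sphere n))"
      unfolding finite_cond_prob_def bdry_tball Z[OF r] by (simp add: colourings_restrict_id[OF \<tau>])
    then show ?thesis
      using gibbs_cylinder[OF G finite_tball tball_subset w \<tau>] unfolding bdry_tball by simp
  qed
  have "measure M (cyl q V (tball k) \<alpha>) = (\<Sum>\<tau>\<in>A. measure M (cyl q V (tball n) \<tau>))"
    unfolding A_def by (rule measure_cyl_eq_sum[OF M finite_tball tball_mono[OF kn] tball_subset])
  also have "\<dots> = (\<Sum>\<eta>\<in>colourings q (sphere n). \<Sum>\<tau> | \<tau> \<in> A \<and> restrict \<tau> (sphere n) = \<eta>. measure M (cyl q V (tball n) \<tau>))"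
    using sphere_subset_tball by (intro sum.group[symmetric] Afin fin) (auto simp: A_def intro!: restrict_colourings)
  also have "\<dots> = (\<Sum>\<eta>\<in>colourings q (sphere n). measure M (cyl q V (sphere n) \<eta>) *
     (partition_sum q w k n \<alpha> (field q w \<eta> 0) / Z \<eta>))"
  proof (intro sum.cong refl)
    fix \<eta> assume \<eta>: "\<eta> \<in> colourings q (sphere n)"
    have "(\<Sum>\<tau> | \<tau> \<in> A \<and> restrict \<tau> (sphere n) = \<eta>. measure M (cyl q V (tball n) \<tau>))
        = (\<Sum>\<tau> | \<tau> \<in> A \<and> restrict \<tau> (sphere n) = \<eta>. ?W \<tau> / Z \<eta> * measure M (cyl q V (sphere n) \<eta>))"
      by (intro sum.cong) (auto simp: A_def cyl)
    also have "\<dots> = (\<Sum>\<tau> | \<tau> \<in> A \<and> restrict \<tau> (sphere n) = \<eta>. ?W \<tau>) / Z \<eta> * measure M (cyl q V (sphere n) \<eta>)"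
      by (simp add: sum_distrib_right sum_divide_distrib)
    also have "(\<Sum>\<tau> | \<tau> \<in> A \<and> restrict \<tau> (sphere n) = \<eta>. ?W \<tau>) = partition_sum q w k n \<alpha> (field q w \<eta> 0)"
      unfolding partition_sum_boundary[OF \<eta>] A_def by (intro sum.cong) auto
    finally show "(\<Sum>\<tau> | \<tau> \<in> A \<and> restrict \<tau> (sphere n) = \<eta>. measure M (cyl q V (tball n) \<tau>))
      = measure M (cyl q V (sphere n) \<eta>) * (partition_sum q w k n \<alpha> (field q w \<eta> 0) / Z \<eta>)" by (simp only: mult.commute)
  qed
  finally show ?thesis unfolding Z_def .
qed

lemma sum_measure_cyl:
  assumes M: "prob_space M" "sets M = sets (cylinder_algebra q V V)" and S: "finite S" "S \<subseteq> V"
  shows "(\<Sum>\<tau>\<in>colourings q S. measure M (cyl q V S \<tau>)) = 1"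
proof -
  interpret prob_space M by fact
  have "(\<Union>\<tau>\<in>colourings q S. cyl q V S \<tau>) = colourings q V"
    using S(2) by (auto simp: cyl_def intro: restrict_colourings)
  also have "\<dots> = space M" using sets_eq_imp_space_eq[OF M(2)] by (simp add: space_cylinder_algebra)
  finally show ?thesis using measure_Union_cyl[OF M S, of "colourings q S"] prob_space by simp
qed

lemma card_children_le: "v \<in> V \<Longrightarrow> card (children v) \<le> d + 1"
  unfolding neighbours(2)[symmetric]
  by (intro card_mono neighbours(1)) (use adjD in \<open>auto simp: children_def insert_commute\<close>)

lemma ratio_le:
  fixes x y A B K :: real
  assumes "x \<ge> 0" "A > 0" "B > 0" "y * A \<le> K * B"
  shows "x * y / B \<le> K * (x / A)"
proof -
  have "y * A / (A * B) \<le> K * B / (A * B)" using assms by (intro divide_right_mono) auto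
  then have "y / B \<le> K / A" using assms by simp
  from mult_left_mono[OF this assms(1)] show ?thesis by (simp add: mult_ac)
qed

text \<open>The comparison is with the free boundary distribution on the ball. When the conditioning
  is far away, the fields on \<open>sphere k\<close> hardly depend on the colour, so the factor
  \<open>H\<close> nearly cancels between numerator and denominator, uniformly in
  \<open>\<eta>\<close>.\<close>

lemma gibbs_ball_upper:
  assumes G: "gibbs_measure q w V E M" and L: "lyapunov q d w I a c"
    and q: "q > 0" and w: "0 < w" "w < 1" and \<alpha>: "\<alpha> \<in> colourings q (tball k)" and \<kappa>: "\<kappa> > 0"
  shows "measure M (cyl q V (tball k) \<alpha>) \<le> exp \<kappa> *
     (potts_weight w (induced_edges E (tball k)) \<alpha> / (\<Sum>\<beta>\<in>colourings q (tball k). potts_weight w (induced_edges E (tball k)) \<beta>))"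
proof -
  let ?W = "potts_weight w (induced_edges E (tball k))"
  have M: "prob_space M" "sets M = sets (cylinder_algebra q V V)" using G by (auto simp: gibbs_measure_def)
  \<comment> \<open>An error \<open>\<epsilon>\<close> is incurred for every child of every vertex
    of \<open>sphere k\<close>. The root has \<open>d + 1\<close> children, so \<open>d + 1\<close>
    bounds the number of children everywhere.\<close>
  define \<epsilon> where "\<epsilon> = \<kappa> / (real (card (sphere k) + 1) * real (d + 1))"
  have \<epsilon>: "\<epsilon> > 0" using \<kappa> by (simp add: \<epsilon>_def)
  have d0: "d > 0" using d by simp
  obtain P and N :: nat where
    P0: "\<And>m. (\<And>i. i \<in> {1..q} \<Longrightarrow> m i > 0) \<Longrightarrow> (\<And>i j. i \<in> {1..q} \<Longrightarrow> j \<in> {1..q} \<Longrightarrow> w * m i \<le> m j) \<Longrightarrow> P 0 m"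
    and PS: "\<And>n (C :: 'a set) m. finite C \<Longrightarrow> card C = d \<Longrightarrow> (\<And>z. z \<in> C \<Longrightarrow> P n (m z)) \<Longrightarrow>
        P (Suc n) (message q w (\<lambda>i. \<Prod>z\<in>C. m z i))"
    and Ppos: "\<And>n m i. P n m \<Longrightarrow> i \<in> {1..q} \<Longrightarrow> m i > 0"
    and Pln: "\<And>n m i j. n \<ge> N \<Longrightarrow> P n m \<Longrightarrow> i \<in> {1..q} \<Longrightarrow> j \<in> {1..q} \<Longrightarrow> ln (m i) - ln (m j) \<le> \<epsilon>"
  proof (rule message_contraction[OF L d0 q w \<epsilon>, where 'b = 'a], goal_cases)
    case (1 P N)
    show ?case by (rule 1(1)[of P N]) (fact 1)+
  qed
  \<comment> \<open>The children of \<open>sphere k\<close> have level \<open>k + 1\<close>, and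
    their messages then come from \<open>N\<close> levels above the boundary.\<close>
  define n where "n = k + Suc N"
  have Wpos: "?W \<beta> > 0" for \<beta> using w by (simp add: potts_weight_def)
  have "colourings q (tball k) \<noteq> {}" using \<alpha> by auto
  then have Wsum: "(\<Sum>\<beta>\<in>colourings q (tball k). ?W \<beta>) > 0"
    using Wpos finite_colourings[OF finite_tball] by (intro sum_pos) auto
  have ratio: "partition_sum q w k n \<alpha> (field q w \<eta> 0) / (\<Sum>\<beta>\<in>colourings q (tball k). partition_sum q w k n \<beta> (field q w \<eta> 0))
      \<le> exp \<kappa> * (?W \<alpha> / (\<Sum>\<beta>\<in>colourings q (tball k). ?W \<beta>))" if \<eta>: "\<eta> \<in> colourings q (sphere n)" for \<eta>
  proof -
    \<comment> \<open>The root is excluded because the contraction requires exactly \<open>d\<close>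
      children.\<close>
    have PF: "P j (message q w (field q w \<eta> j u))" if "u \<in> V" "u \<noteq> r" "level u + j = n" for j u
      using that
    proof (induction j arbitrary: u)
      case 0
      then have "\<eta> u \<in> {1..q}" using \<eta> by (auto simp: colourings_def sphere_def PiE_def Pi_def)
      then have m: "message q w (field q w \<eta> 0 u) i = (if i = \<eta> u then w else 1)" for i
        unfolding message_def by (simp add: if_distrib[of "\<lambda>x. _ * x"] sum.delta cong: if_cong)
      have "message q w (field q w \<eta> 0 u) = (\<lambda>i. if i = \<eta> u then w else 1)" by (rule ext) (rule m)
      then show ?case by (simp only:) (rule P0; use w mult_le_one[of w w] in auto)
    next
      case (Suc j)
      have f: "field q w \<eta> (Suc j) u = (\<lambda>i. \<Prod>z\<in>children u. message q w (field q w \<eta> j z) i)" by (rule ext) simp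
      show ?case unfolding f
      proof (rule PS)
        show "finite (children u)" "card (children u) = d" using Suc finite_children card_children by auto
        fix z assume "z \<in> children u"
        then show "P j (message q w (field q w \<eta> j z))"
          using Suc adjD by (intro Suc.IH) (auto simp: children_def)
      qed
    qed
    define h where "h v i = field q w \<eta> (Suc N) v i" for v i
    have h: "h v i > 0" "h v i \<le> exp (real (d + 1) * \<epsilon>) * h v j"
      if v: "v \<in> sphere k" and ij: "i \<in> {1..q}" "j \<in> {1..q}" for v i j
    proof -
      have vV: "v \<in> V" using v by (simp add: sphere_def)
      have PC: "P N (message q w (field q w \<eta> N u))" if "u \<in> children v" for u
        using that v adjD by (intro PF) (auto simp: children_def sphere_def n_def)
      have pos: "message q w (field q w \<eta> N u) i > 0" if "u \<in> children v" "i \<in> {1..q}" for u i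
        by (rule Ppos[OF PC[OF that(1)] that(2)])
      have hv: "h v i = (\<Prod>u\<in>children v. message q w (field q w \<eta> N u) i)" for i by (simp add: h_def)
      show p: "h v i > 0" unfolding hv using pos ij by (intro prod_pos) auto
      have le: "message q w (field q w \<eta> N u) i \<le> exp \<epsilon> * message q w (field q w \<eta> N u) j" if u: "u \<in> children v" for u
      proof -
        have "ln (message q w (field q w \<eta> N u) i) \<le> \<epsilon> + ln (message q w (field q w \<eta> N u) j)"
          using Pln[OF order_refl PC[OF u] ij] by simp
        then have "exp (ln (message q w (field q w \<eta> N u) i)) \<le> exp (\<epsilon> + ln (message q w (field q w \<eta> N u) j))" by simp
        then show ?thesis using pos[OF u] ij by (simp add: exp_add)
      qed
      have "h v i \<le> (\<Prod>u\<in>children v. exp \<epsilon> * message q w (field q w \<eta> N u) j)"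
        unfolding hv using pos ij le by (intro prod_mono) (auto intro: less_imp_le)
      also have "\<dots> = exp (real (card (children v)) * \<epsilon>) * h v j"
        unfolding hv by (simp add: prod.distrib exp_of_nat_mult)
      also have "\<dots> \<le> exp (real (d + 1) * \<epsilon>) * h v j"
      proof (rule mult_right_mono)
        have "real (card (children v)) \<le> real (d + 1)" using card_children_le[OF vV] by (simp only: of_nat_le_iff)
        then show "exp (real (card (children v)) * \<epsilon>) \<le> exp (real (d + 1) * \<epsilon>)"
          using \<epsilon> by (simp add: mult_right_mono)
        show "0 \<le> h v j" unfolding hv using pos ij by (intro prod_nonneg) (auto intro: less_imp_le)
      qed
      finally show "h v i \<le> exp (real (d + 1) * \<epsilon>) * h v j" .
    qed
    define H where "H \<beta> = (\<Prod>v\<in>sphere k. h v (\<beta> v))" for \<beta>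
    have col: "\<beta> v \<in> {1..q}" if "\<beta> \<in> colourings q (tball k)" "v \<in> sphere k" for \<beta> v
      using that sphere_subset_tball[of k] by (auto simp: colourings_def PiE_def Pi_def)
    have Hpos: "H \<beta> > 0" if "\<beta> \<in> colourings q (tball k)" for \<beta>
      unfolding H_def using h(1) col[OF that] by (intro prod_pos) blast
    have Hle: "H \<alpha> \<le> exp \<kappa> * H \<beta>" if \<beta>: "\<beta> \<in> colourings q (tball k)" for \<beta>
    proof -
      have "H \<alpha> \<le> (\<Prod>v\<in>sphere k. exp (real (d + 1) * \<epsilon>) * h v (\<beta> v))"
        unfolding H_def
      proof (rule prod_mono)
        fix v assume v: "v \<in> sphere k"
        show "0 \<le> h v (\<alpha> v) \<and> h v (\<alpha> v) \<le> exp (real (d + 1) * \<epsilon>) * h v (\<beta> v)"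
          using h[OF v col[OF \<alpha> v] col[OF \<beta> v]] by simp
      qed
      also have "\<dots> = exp (real (card (sphere k)) * (real (d + 1) * \<epsilon>)) * H \<beta>"
        unfolding H_def by (simp only: prod.distrib prod_constant exp_of_nat_mult)
      also have "\<dots> \<le> exp \<kappa> * H \<beta>"
      proof (rule mult_right_mono)
        have "real (card (sphere k)) * (real (d + 1) * \<epsilon>) \<le> real (card (sphere k) + 1) * (real (d + 1) * \<epsilon>)"
          using \<epsilon> by (intro mult_right_mono) auto
        also have "\<dots> = \<kappa>" by (simp add: \<epsilon>_def)
        finally show "exp (real (card (sphere k)) * (real (d + 1) * \<epsilon>)) \<le> exp \<kappa>" by simp
      qed (use Hpos[OF \<beta>] in simp)
      finally show ?thesis .
    qed
    have ps: "partition_sum q w k n \<beta> (field q w \<eta> 0) = ?W \<beta> * H \<beta>" if "\<beta> \<in> colourings q (tball k)" for \<beta>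
      unfolding n_def partition_sum_field using partition_sum_top[OF that] by (simp add: H_def h_def del: field.simps)
    have sum0: "(\<Sum>\<beta>\<in>colourings q (tball k). ?W \<beta> * H \<beta>) > 0"
      using \<alpha> Wpos Hpos finite_colourings[OF finite_tball] by (intro sum_pos) auto
    have "H \<alpha> * (\<Sum>\<beta>\<in>colourings q (tball k). ?W \<beta>) \<le> (\<Sum>\<beta>\<in>colourings q (tball k). exp \<kappa> * (?W \<beta> * H \<beta>))"
      unfolding sum_distrib_left
    proof (rule sum_mono)
      fix \<beta> assume "\<beta> \<in> colourings q (tball k)"
      from mult_left_mono[OF Hle[OF this], of "?W \<beta>"] Wpos[of \<beta>]
      show "H \<alpha> * ?W \<beta> \<le> exp \<kappa> * (?W \<beta> * H \<beta>)" by (simp add: mult_ac)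
    qed
    then have le: "H \<alpha> * (\<Sum>\<beta>\<in>colourings q (tball k). ?W \<beta>) \<le> exp \<kappa> * (\<Sum>\<beta>\<in>colourings q (tball k). ?W \<beta> * H \<beta>)"
      by (simp only: sum_distrib_left)
    have "?W \<alpha> * H \<alpha> / (\<Sum>\<beta>\<in>colourings q (tball k). ?W \<beta> * H \<beta>) \<le> exp \<kappa> * (?W \<alpha> / (\<Sum>\<beta>\<in>colourings q (tball k). ?W \<beta>))"
      by (rule ratio_le[OF Wpos[THEN less_imp_le] Wsum sum0 le])
    moreover have "(\<Sum>\<beta>\<in>colourings q (tball k). partition_sum q w k n \<beta> (field q w \<eta> 0))
        = (\<Sum>\<beta>\<in>colourings q (tball k). ?W \<beta> * H \<beta>)" by (rule sum.cong[OF refl ps])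
    ultimately show ?thesis by (simp only: ps[OF \<alpha>])
  qed
  have "k \<le> n" by (simp add: n_def)
  have "measure M (cyl q V (tball k) \<alpha>) \<le> (\<Sum>\<eta>\<in>colourings q (sphere n). measure M (cyl q V (sphere n) \<eta>) *
     (exp \<kappa> * (?W \<alpha> / (\<Sum>\<beta>\<in>colourings q (tball k). ?W \<beta>))))"
    unfolding gibbs_ball[OF G w(1) \<open>k \<le> n\<close>] by (intro sum_mono mult_left_mono ratio) auto
  also have "\<dots> = exp \<kappa> * (?W \<alpha> / (\<Sum>\<beta>\<in>colourings q (tball k). ?W \<beta>))"
  proof -
    have "sphere n \<subseteq> V" by (auto simp: sphere_def)
    then show ?thesis
      by (simp only: sum_distrib_right[symmetric] sum_measure_cyl[OF M finite_sphere] mult_1)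
  qed
  finally show ?thesis .
qed

text \<open>Letting \<open>\<kappa>\<close> tend to 0 leaves a one-sided bound, which is an equality
  because both sides sum to one over the colourings of the ball.\<close>

lemma gibbs_ball_eq:
  assumes G: "gibbs_measure q w V E M" and L: "lyapunov q d w I a c"
    and q: "q > 0" and w: "0 < w" "w < 1" and \<alpha>: "\<alpha> \<in> colourings q (tball k)"
  shows "measure M (cyl q V (tball k) \<alpha>) =
     potts_weight w (induced_edges E (tball k)) \<alpha> / (\<Sum>\<beta>\<in>colourings q (tball k). potts_weight w (induced_edges E (tball k)) \<beta>)"
proof -
  have M: "prob_space M" "sets M = sets (cylinder_algebra q V V)" using G by (auto simp: gibbs_measure_def)
  define p where "p \<alpha> = potts_weight w (induced_edges E (tball k)) \<alpha> /
    (\<Sum>\<beta>\<in>colourings q (tball k). potts_weight w (induced_edges E (tball k)) \<beta>)" for \<alpha>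
  have fin: "finite (colourings q (tball k))" by (intro finite_colourings finite_tball)
  have Wsum: "(\<Sum>\<beta>\<in>colourings q (tball k). potts_weight w (induced_edges E (tball k)) \<beta>) > 0"
    using \<alpha> w fin by (intro sum_pos) (auto simp: potts_weight_def)
  have le: "measure M (cyl q V (tball k) \<alpha>) \<le> p \<alpha>" if \<alpha>: "\<alpha> \<in> colourings q (tball k)" for \<alpha>
  proof -
    have t: "((\<lambda>\<kappa>. exp \<kappa> * p \<alpha>) \<longlongrightarrow> exp 0 * p \<alpha>) (at_right 0)" by (intro tendsto_intros)
    have e: "\<forall>\<^sub>F \<kappa> in at_right 0. measure M (cyl q V (tball k) \<alpha>) \<le> exp \<kappa> * p \<alpha>"
      unfolding p_def by (rule eventually_at_right_less[THEN eventually_mono]) (rule gibbs_ball_upper[OF G L q w \<alpha>])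
    show ?thesis using tendsto_lowerbound[OF t e] by simp
  qed
  have "(\<Sum>\<alpha>\<in>colourings q (tball k). p \<alpha>) = 1" using Wsum by (simp add: p_def flip: sum_divide_distrib)
  then have "(\<Sum>\<alpha>\<in>colourings q (tball k). p \<alpha> - measure M (cyl q V (tball k) \<alpha>)) = 0"
    using sum_measure_cyl[OF M finite_tball tball_subset, of k] by (simp add: sum_subtractf)
  then have "\<forall>\<alpha>\<in>colourings q (tball k). p \<alpha> - measure M (cyl q V (tball k) \<alpha>) = 0"
    using le fin by (subst (asm) sum_nonneg_eq_0_iff) auto
  then show ?thesis using \<alpha> by (simp add: p_def)
qed

lemma gibbs_unique:
  assumes G: "gibbs_measure q w V E M" "gibbs_measure q w V E N" and L: "lyapunov q d w I a c"
    and q: "q > 0" and w: "0 < w" "w < 1"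
  shows "M = N"
proof -
  have M: "prob_space M" "sets M = sets (cylinder_algebra q V V)"
    and N: "prob_space N" "sets N = sets (cylinder_algebra q V V)" using G by (auto simp: gibbs_measure_def)
  show ?thesis
  proof (rule cylinder_algebra_measure_eqI[OF M N])
    fix S \<sigma> assume "finite S" "S \<subseteq> V"
    then obtain n where n: "S \<subseteq> tball n" using finite_subset_tball by blast
    show "measure M (cyl q V S \<sigma>) = measure N (cyl q V S \<sigma>)"
      unfolding measure_cyl_eq_sum[OF M finite_tball n tball_subset] measure_cyl_eq_sum[OF N finite_tball n tball_subset]
      using gibbs_ball_eq[OF G(1) L q w] gibbs_ball_eq[OF G(2) L q w] by (intro sum.cong) auto
  qed
qed

end

section \<open>Existence\<close>

context rooted_tree
begin

lemma adj_inner_part: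
  assumes "adj u v" "u \<in> inner_part V E U" "U \<subseteq> V"
  shows "v \<in> U"
  using assms adjD[OF assms(1)] by (auto simp: inner_part_def bdry_def)

lemma potts_weight_split:
  assumes U: "U \<subseteq> tball n"
  shows "potts_weight w (induced_edges E (tball n)) \<sigma> =
    potts_weight w (induced_edges E U) \<sigma> * potts_weight w (induced_edges E (tball n) - induced_edges E U) \<sigma>"
proof -
  let ?m = "\<lambda>F. {e \<in> F. \<forall>u\<in>e. \<forall>v\<in>e. \<sigma> u = \<sigma> v}"
  have "?m (induced_edges E (tball n)) = ?m (induced_edges E U) \<union> ?m (induced_edges E (tball n) - induced_edges E U)"
    using U by (auto simp: induced_edges_def)
  moreover have "finite (?m (induced_edges E U))" "finite (?m (induced_edges E (tball n) - induced_edges E U))"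
    using U by (auto intro!: finite_subset[OF _ finite_induced[of n]] simp: induced_edges_def)
  ultimately have "card (?m (induced_edges E (tball n)))
      = card (?m (induced_edges E U)) + card (?m (induced_edges E (tball n) - induced_edges E U))"
    by (simp only:) (rule card_Un_disjoint; blast)
  then show ?thesis unfolding potts_weight_def num_mono_def by (simp add: power_add)
qed

lemma potts_weight_cong:
  assumes "\<And>e v. e \<in> F \<Longrightarrow> v \<in> e \<Longrightarrow> \<sigma> v = \<tau> v"
  shows "potts_weight w F \<sigma> = potts_weight w F \<tau>"
proof -
  have "{e \<in> F. \<forall>u\<in>e. \<forall>v\<in>e. \<sigma> u = \<sigma> v} = {e \<in> F. \<forall>u\<in>e. \<forall>v\<in>e. \<tau> u = \<tau> v}"
  proof (intro Collect_cong conj_cong refl)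
    fix e assume "e \<in> F"
    then have "\<sigma> v = \<tau> v" if "v \<in> e" for v using assms that by blast
    then show "(\<forall>u\<in>e. \<forall>v\<in>e. \<sigma> u = \<sigma> v) \<longleftrightarrow> (\<forall>u\<in>e. \<forall>v\<in>e. \<tau> u = \<tau> v)" by (simp cong: ball_cong)
  qed
  then show ?thesis unfolding potts_weight_def num_mono_def by (simp only:)
qed

text \<open>Every edge meeting the inner part of \<open>U\<close> lies inside \<open>U\<close>; hence recolouring the inner part
  changes the weight only through the factor of \<open>U\<close>.\<close>

lemma sum_weights_recolour:
  assumes U: "U \<subseteq> tball n" and W: "W \<subseteq> tball n" "W \<inter> inner_part V E U = {}"
    and \<tau>: "\<tau> \<in> colourings q U" "\<tau>' \<in> colourings q U"
    and bd: "restrict \<tau> (bdry V E U) = restrict \<tau>' (bdry V E U)"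
  shows "(\<Sum>\<sigma> | \<sigma> \<in> colourings q (tball n) \<and> restrict \<sigma> U = \<tau> \<and> restrict \<sigma> W = \<rho>.
            potts_weight w (induced_edges E (tball n) - induced_edges E U) \<sigma>)
       = (\<Sum>\<sigma> | \<sigma> \<in> colourings q (tball n) \<and> restrict \<sigma> U = \<tau>' \<and> restrict \<sigma> W = \<rho>.
            potts_weight w (induced_edges E (tball n) - induced_edges E U) \<sigma>)"
proof -
  define I where "I = inner_part V E U"
  have UV: "U \<subseteq> V" using U tball_subset by blast
  have I: "I \<subseteq> U" "U - I \<subseteq> bdry V E U" unfolding I_def inner_part_def bdry_def by auto
  have bde: "\<tau> v = \<tau>' v" if "v \<in> U - I" for v
    using fun_cong[OF bd, of v] that I by auto
  define g where "g \<tau> \<sigma> v = (if v \<in> I then \<tau> v else \<sigma> v)" for \<tau> \<sigma> :: "'a \<Rightarrow> nat" and v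
  have step: "g \<tau>' \<sigma> \<in> {\<sigma>. \<sigma> \<in> colourings q (tball n) \<and> restrict \<sigma> U = \<tau>' \<and> restrict \<sigma> W = \<rho>}"
    "g \<tau> (g \<tau>' \<sigma>) = \<sigma>"
    if "\<sigma> \<in> colourings q (tball n)" "restrict \<sigma> U = \<tau>" "restrict \<sigma> W = \<rho>"
      "\<tau>' \<in> colourings q U" "\<And>v. v \<in> U - I \<Longrightarrow> \<tau> v = \<tau>' v" for \<sigma> \<tau> \<tau>'
  proof -
    have s: "\<sigma> v = \<tau> v" if "v \<in> U" for v using fun_cong[OF \<open>restrict \<sigma> U = \<tau>\<close>, of v] that by simp
    show "g \<tau> (g \<tau>' \<sigma>) = \<sigma>" using s I by (auto simp: g_def fun_eq_iff)
    have "g \<tau>' \<sigma> \<in> colourings q (tball n)"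
      using that(1,4) I U unfolding colourings_def g_def by (fastforce simp: PiE_def Pi_def extensional_def)
    moreover have "restrict (g \<tau>' \<sigma>) U = \<tau>'"
    proof
      fix v show "restrict (g \<tau>' \<sigma>) U v = \<tau>' v"
      proof (cases "v \<in> U")
        case True
        then show ?thesis using s[OF True] that(5)[of v] by (auto simp: g_def)
      next
        case False
        then show ?thesis using that(4) by (auto simp: colourings_def PiE_def extensional_def)
      qed
    qed
    moreover have "restrict (g \<tau>' \<sigma>) W = restrict \<sigma> W"
      using W(2) by (intro restrict_ext) (auto simp: g_def I_def)
    ultimately show "g \<tau>' \<sigma> \<in> {\<sigma>. \<sigma> \<in> colourings q (tball n) \<and> restrict \<sigma> U = \<tau>' \<and> restrict \<sigma> W = \<rho>}"
      using that(3) by blast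
  qed
  show ?thesis
  proof (rule sum.reindex_bij_witness[where i = "g \<tau>" and j = "g \<tau>'"])
    fix \<sigma> assume "\<sigma> \<in> {\<sigma>. \<sigma> \<in> colourings q (tball n) \<and> restrict \<sigma> U = \<tau> \<and> restrict \<sigma> W = \<rho>}"
    then have \<sigma>: "\<sigma> \<in> colourings q (tball n)" "restrict \<sigma> U = \<tau>" "restrict \<sigma> W = \<rho>" by auto
    from step[OF \<sigma> \<tau>(2) bde] show "g \<tau> (g \<tau>' \<sigma>) = \<sigma>"
      "g \<tau>' \<sigma> \<in> {\<sigma>. \<sigma> \<in> colourings q (tball n) \<and> restrict \<sigma> U = \<tau>' \<and> restrict \<sigma> W = \<rho>}" by auto
    show "potts_weight w (induced_edges E (tball n) - induced_edges E U) (g \<tau>' \<sigma>)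
        = potts_weight w (induced_edges E (tball n) - induced_edges E U) \<sigma>"
    proof (rule potts_weight_cong)
      fix e v assume e: "e \<in> induced_edges E (tball n) - induced_edges E U" and v: "v \<in> e"
      have "v \<notin> I"
      proof
        assume vI: "v \<in> I"
        have "card e = 2"
          using e tree unfolding induced_edges_def infinite_regular_tree_def tree_graph_def simple_graph_def by auto
        then obtain x y where "e = {x, y}" by (auto simp: card_2_iff)
        then obtain x where x: "e = {v, x}" using v by blast
        then have "x \<in> U" using adj_inner_part[of v x U] vI UV e by (auto simp: I_def induced_edges_def)
        then have "e \<in> induced_edges E U" using x vI I(1) e by (auto simp: induced_edges_def)
        then show False using e by simp
      qed
      then show "g \<tau>' \<sigma> v = \<sigma> v" by (simp add: g_def)
    qed
  next
    fix \<sigma> assume "\<sigma> \<in> {\<sigma>. \<sigma> \<in> colourings q (tball n) \<and> restrict \<sigma> U = \<tau>' \<and> restrict \<sigma> W = \<rho>}"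
    then have \<sigma>: "\<sigma> \<in> colourings q (tball n)" "restrict \<sigma> U = \<tau>'" "restrict \<sigma> W = \<rho>" by auto
    from step[OF \<sigma> \<tau>(1) bde[symmetric]] show "g \<tau>' (g \<tau> \<sigma>) = \<sigma>"
      "g \<tau> \<sigma> \<in> {\<sigma>. \<sigma> \<in> colourings q (tball n) \<and> restrict \<sigma> U = \<tau> \<and> restrict \<sigma> W = \<rho>}" by auto
  qed
qed

section \<open>From ball probabilities proportional to the Potts weight to the Gibbs
  condition\<close>

text \<open>For each fixed colouring \<open>\<tau>\<close> of \<open>U\<close> an explicit version
  of the conditional expectation is exhibited: the constant \<open>\<gamma> \<tau>\<close> on the
  cylinder of the boundary colours of \<open>\<tau>\<close>, and 0 elsewhere. It is measurable for
  the outer algebra since the boundary lies outside the inner part.\<close>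

lemma gibbs_measureI:
  assumes M: "prob_space M" "sets M = sets (cylinder_algebra q V V)" and w: "w > 0"
    and C: "\<And>n \<sigma>. \<sigma> \<in> colourings q (tball n) \<Longrightarrow>
      measure M (cyl q V (tball n) \<sigma>) = C n * potts_weight w (induced_edges E (tball n)) \<sigma>"
  shows "gibbs_measure q w V E M"
  unfolding gibbs_measure_def
proof (intro conjI M allI impI)
  fix U assume "finite U \<and> U \<subseteq> V"
  then have U: "finite U" "U \<subseteq> V" by auto
  interpret prob_space M by fact
  define D where "D = bdry V E U"
  define F where "F = cylinder_algebra q V (V - inner_part V E U)"
  define \<gamma> where "\<gamma> = finite_cond_prob q w V E U"
  have sp: "space M = colourings q V" using sets_eq_imp_space_eq[OF M(2)] by (simp add: space_cylinder_algebra)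
  have sub: "subalgebra M F"
    unfolding subalgebra_def F_def sp space_cylinder_algebra M(2)
    by (intro conjI refl cylinder_algebra_mono Diff_subset)
  interpret finite_measure_subalgebra M F by unfold_locales (rule sub)
  have D: "D \<subseteq> U" "D \<subseteq> V - inner_part V E U" "finite D" "D \<subseteq> V"
    using inner_part_props[OF U(2), of E] U finite_subset unfolding D_def by blast+
  have ae: "AE \<phi> in M. real_cond_exp M F (indicat_real (cyl q V U \<tau>)) \<phi> = \<gamma> \<tau> * indicat_real (cyl q V D (restrict \<tau> D)) \<phi>"
    if \<tau>: "\<tau> \<in> colourings q U" for \<tau>
  proof -
    define A where "A = cyl q V D (restrict \<tau> D)"
    define X where "X = cyl q V U \<tau>"
    have AF: "A \<in> sets F" unfolding A_def F_def by (intro cyl_sets D restrict_colourings[OF \<tau>])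
    then have AM: "A \<in> sets M" using sub by (auto simp: subalgebra_def)
    have XM: "X \<in> sets M" unfolding X_def M(2) by (intro cyl_sets U \<tau>)
    define T where "T = {\<sigma> \<in> colourings q U. restrict \<sigma> D = restrict \<tau> D}"
    define WU where "WU \<sigma> = potts_weight w (induced_edges E U) \<sigma>" for \<sigma>
    have Tfin: "finite T" unfolding T_def using finite_colourings[OF U(1)] by simp
    have WUpos: "WU \<sigma> > 0" for \<sigma> using w by (simp add: WU_def potts_weight_def)
    have \<tau>T: "\<tau> \<in> T" using \<tau> by (simp add: T_def)
    have Wsum: "(\<Sum>\<sigma>\<in>T. WU \<sigma>) > 0" using Tfin \<tau>T WUpos by (intro sum_pos) auto
    have \<gamma>: "\<gamma> \<tau> = WU \<tau> / (\<Sum>\<sigma>\<in>T. WU \<sigma>)"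
    proof -
      have "{\<rho>. \<rho> \<in> colourings q U \<and> (\<forall>v\<in>bdry V E U. \<rho> v = \<tau> v)} = T"
      proof -
        have "(\<forall>v\<in>bdry V E U. \<rho> v = \<tau> v) \<longleftrightarrow> restrict \<rho> (bdry V E U) = restrict \<tau> (bdry V E U)" for \<rho>
          by (metis restrict_apply' restrict_ext)
        then show ?thesis unfolding T_def D_def by (simp only:)
      qed
      then show ?thesis by (simp add: \<gamma>_def finite_cond_prob_def WU_def colourings_restrict_id[OF \<tau>])
    qed
    \<comment> \<open>On outer cylinders the identity is finite: all events are unions of cylinders
      over one large ball, whose weight splits into the edges inside \<open>U\<close> and the
      rest.\<close>
    have key0: "measure M (X \<inter> B) = \<gamma> \<tau> * measure M (A \<inter> B)" if basic: "B \<in> cyls q V (V - inner_part V E U)" for B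
    proof (cases "B = {}")
        case False
        then obtain S \<rho> where S: "finite S" "S \<subseteq> V - inner_part V E U" "\<rho> \<in> colourings q S" "B = cyl q V S \<rho>"
          using basic unfolding cyls_def by blast
        have "finite (U \<union> S)" "U \<union> S \<subseteq> V" using U S by auto
        then obtain n where n: "U \<union> S \<subseteq> tball n" using finite_subset_tball by meson
        define R where "R \<sigma>' = {\<sigma>. \<sigma> \<in> colourings q (tball n) \<and> restrict \<sigma> U = \<sigma>' \<and> restrict \<sigma> S = \<rho>}" for \<sigma>'
        define Wr where "Wr \<sigma> = potts_weight w (induced_edges E (tball n) - induced_edges E U) \<sigma>" for \<sigma>
        have m: "measure M (cyl q V U \<sigma>' \<inter> B) = C n * (WU \<sigma>' * (\<Sum>\<sigma>\<in>R \<tau>. Wr \<sigma>))" if \<sigma>': "\<sigma>' \<in> T" for \<sigma>'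
        proof -
          have "cyl q V U \<sigma>' \<inter> B = (\<Union>\<sigma>\<in>R \<sigma>'. cyl q V (tball n) \<sigma>)"
          proof (intro equalityI subsetI)
            fix \<psi> assume \<psi>: "\<psi> \<in> cyl q V U \<sigma>' \<inter> B"
            have "restrict (restrict \<psi> (tball n)) U = restrict \<psi> U" "restrict (restrict \<psi> (tball n)) S = restrict \<psi> S"
              using n by (auto simp: Int_absorb1)
            then have "restrict \<psi> (tball n) \<in> R \<sigma>'" "\<psi> \<in> cyl q V (tball n) (restrict \<psi> (tball n))"
              using \<psi> restrict_colourings[of \<psi> q V "tball n"] tball_subset unfolding S(4) by (auto simp: R_def cyl_def)
            then show "\<psi> \<in> (\<Union>\<sigma>\<in>R \<sigma>'. cyl q V (tball n) \<sigma>)" by blast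
          next
            fix \<psi> assume "\<psi> \<in> (\<Union>\<sigma>\<in>R \<sigma>'. cyl q V (tball n) \<sigma>)"
            then have "\<psi> \<in> colourings q V" "restrict (restrict \<psi> (tball n)) U = \<sigma>'" "restrict (restrict \<psi> (tball n)) S = \<rho>"
              by (auto simp: R_def cyl_def)
            moreover have "tball n \<inter> U = U" "tball n \<inter> S = S" using n by auto
            ultimately show "\<psi> \<in> cyl q V U \<sigma>' \<inter> B" unfolding S(4) cyl_def by simp
          qed
          also have "measure M \<dots> = (\<Sum>\<sigma>\<in>R \<sigma>'. measure M (cyl q V (tball n) \<sigma>))"
            by (rule measure_Union_cyl[OF M finite_tball tball_subset]) (auto simp: R_def)
          also have "\<dots> = (\<Sum>\<sigma>\<in>R \<sigma>'. C n * (WU \<sigma>' * Wr \<sigma>))"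
          proof (rule sum.cong[OF refl])
            fix \<sigma> assume \<sigma>: "\<sigma> \<in> R \<sigma>'"
            have "potts_weight w (induced_edges E U) \<sigma> = WU \<sigma>'"
              unfolding WU_def using \<sigma> by (intro potts_weight_cong) (auto simp: R_def induced_edges_def restrict_def)
            moreover have "U \<subseteq> tball n" using n by simp
            ultimately show "measure M (cyl q V (tball n) \<sigma>) = C n * (WU \<sigma>' * Wr \<sigma>)"
              using C[of \<sigma> n] \<sigma> potts_weight_split[of U n w \<sigma>] by (simp add: R_def Wr_def)
          qed
          also have "\<dots> = C n * (WU \<sigma>' * (\<Sum>\<sigma>\<in>R \<sigma>'. Wr \<sigma>))" by (simp add: sum_distrib_left)
          \<comment> \<open>\<open>S\<close> avoids the inner part of \<open>U\<close>, so
            recolouring that part respects the constraint \<open>\<rho>\<close>, and the outer sum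
            is the same for all \<open>\<sigma>'\<close> with these boundary colours.\<close>
          also have "(\<Sum>\<sigma>\<in>R \<sigma>'. Wr \<sigma>) = (\<Sum>\<sigma>\<in>R \<tau>. Wr \<sigma>)"
            unfolding R_def Wr_def
            by (rule sum_weights_recolour) (use n S(2) \<sigma>' \<tau> in \<open>auto simp: T_def D_def\<close>)
          finally show ?thesis .
        qed
        have "A = (\<Union>\<sigma>\<in>T. cyl q V U \<sigma>)" unfolding A_def T_def by (rule cyl_eq_Union[OF D(1) U(2)])
        then have AB: "A \<inter> B = (\<Union>\<sigma>\<in>T. cyl q V U \<sigma> \<inter> B)" by blast
        have BM: "B \<in> sets M" unfolding S(4) M(2) using S by (intro cyl_sets) auto
        have "measure M (A \<inter> B) = (\<Sum>\<sigma>\<in>T. measure M (cyl q V U \<sigma> \<inter> B))"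
          unfolding AB
        proof (rule finite_measure_finite_Union[OF Tfin])
          show "(\<lambda>\<sigma>. cyl q V U \<sigma> \<inter> B) ` T \<subseteq> events"
            using BM U by (auto simp: T_def M(2) intro!: sets.Int cyl_sets)
          show "disjoint_family_on (\<lambda>\<sigma>. cyl q V U \<sigma> \<inter> B) T"
            by (auto simp: disjoint_family_on_def cyl_def)
        qed
        also have "\<dots> = (\<Sum>\<sigma>\<in>T. C n * (WU \<sigma> * (\<Sum>\<sigma>\<in>R \<tau>. Wr \<sigma>)))" using m by (intro sum.cong) auto
        also have "\<dots> = C n * ((\<Sum>\<sigma>\<in>T. WU \<sigma>) * (\<Sum>\<sigma>\<in>R \<tau>. Wr \<sigma>))" by (simp only: sum_distrib_left[symmetric] sum_distrib_right[symmetric])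
        finally have "\<gamma> \<tau> * measure M (A \<inter> B) = C n * (WU \<tau> * (\<Sum>\<sigma>\<in>R \<tau>. Wr \<sigma>))"
          using Wsum by (simp add: \<gamma>)
        then show ?thesis using m[OF \<tau>T] by (simp add: X_def)
      qed simp
    have key: "measure M (X \<inter> B) = \<gamma> \<tau> * measure M (A \<inter> B)" if B: "B \<in> sets F" for B
      using B unfolding F_def sets_cylinder_algebra'
    proof (induction rule: sigma_sets_induct_disjoint[OF Int_stable_cyls[OF Diff_subset] cyls_Pow, consumes 1, case_names basic empty compl union])
      case (basic B)
      then show ?case by (rule key0)
    next
      case empty
      show ?case by simp
    next
      case (compl B)
      have BM: "B \<in> sets M" using compl(1) sub unfolding subalgebra_def F_def sets_cylinder_algebra' by blast
      have "measure M (X \<inter> (colourings q V - B)) = measure M X - measure M (X \<inter> B)"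
      proof -
        have "X \<inter> (colourings q V - B) = X - X \<inter> B" by (auto simp: X_def cyl_def)
        then show ?thesis using XM BM by (simp add: finite_measure_Diff)
      qed
      moreover have "measure M (A \<inter> (colourings q V - B)) = measure M A - measure M (A \<inter> B)"
      proof -
        have "A \<inter> (colourings q V - B) = A - A \<inter> B" by (auto simp: A_def cyl_def)
        then show ?thesis using AM BM by (simp add: finite_measure_Diff)
      qed
      \<comment> \<open>Complements need the identity for the whole space, which is the cylinder
        over the empty set.\<close>
      moreover have "measure M X = \<gamma> \<tau> * measure M A"
      proof -
        have "colourings q V = cyl q V {} (\<lambda>_. undefined)" "(\<lambda>_. undefined) \<in> colourings q {}"
          by (auto simp: cyl_def colourings_def)
        then have "colourings q V \<in> cyls q V (V - inner_part V E U)" unfolding cyls_def by blast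
        moreover have "X \<inter> colourings q V = X" "A \<inter> colourings q V = A" by (auto simp: X_def A_def cyl_def)
        ultimately show ?thesis using key0[of "colourings q V"] by simp
      qed
      ultimately show ?case using compl(2) by (simp add: right_diff_distrib)
    next
      case (union B)
      have BM: "B i \<in> sets M" for i using union(2) sub unfolding subalgebra_def F_def sets_cylinder_algebra' by blast
      have s: "(\<lambda>i. measure M (Y \<inter> B i)) sums measure M (Y \<inter> (\<Union>i. B i))" if "Y \<in> sets M" for Y
      proof -
        have "(\<lambda>i. measure M (Y \<inter> B i)) sums measure M (\<Union>i. Y \<inter> B i)"
          using that BM union(1) by (intro finite_measure_UNION) (auto simp: disjoint_family_on_def)
        then show ?thesis by simp
      qed
      have "(\<lambda>i. measure M (X \<inter> B i)) sums (\<gamma> \<tau> * measure M (A \<inter> (\<Union>i. B i)))"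
        unfolding union(3) by (rule sums_mult[OF s[OF AM]])
      then show ?case using s[OF XM] by (rule sums_unique2[rotated])
    qed
    have Xint: "integrable M (indicat_real X)" using XM by (simp add: integrable_real_indicator less_top[symmetric])
    have Aint: "integrable M (\<lambda>x. \<gamma> \<tau> * indicat_real A x)" using AM by (simp add: integrable_real_indicator less_top[symmetric])
    show ?thesis unfolding X_def[symmetric] A_def[symmetric]
    proof (rule real_cond_exp_charact)
      fix B assume B: "B \<in> sets F"
      then have BM: "B \<in> sets M" using sub by (auto simp: subalgebra_def)
      have "(LINT x:B|M. indicat_real X x) = measure M (X \<inter> B)"
        unfolding set_lebesgue_integral_def using XM BM
        by (simp add: indicator_inter_arith[symmetric] Int_commute)
      moreover have "(LINT x:B|M. \<gamma> \<tau> * indicat_real A x) = \<gamma> \<tau> * measure M (A \<inter> B)"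
      proof -
        have "(LINT x:B|M. \<gamma> \<tau> * indicat_real A x) = (LINT x|M. \<gamma> \<tau> * indicat_real (A \<inter> B) x)"
          unfolding set_lebesgue_integral_def by (intro Bochner_Integration.integral_cong) (auto simp: indicator_def)
        then show ?thesis using AM BM by simp
      qed
      ultimately show "(LINT x:B|M. indicat_real X x) = (LINT x:B|M. \<gamma> \<tau> * indicat_real A x)" using key[OF B] by (simp only:)
    next
      show "(\<lambda>x. \<gamma> \<tau> * indicat_real A x) \<in> borel_measurable F" using AF by measurable
    qed (use Xint Aint in auto)
  qed
  \<comment> \<open>There are finitely many \<open>\<tau>\<close>, so one null set serves all of
    them, and \<open>\<tau>\<close> may then be chosen depending on the point as its restriction to
    \<open>U\<close>.\<close>
  have "AE \<phi> in M. \<forall>\<tau>\<in>colourings q U. real_cond_exp M F (indicat_real (cyl q V U \<tau>)) \<phi> = \<gamma> \<tau> * indicat_real (cyl q V D (restrict \<tau> D)) \<phi>"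
    by (rule AE_finite_allI[OF finite_colourings[OF U(1)] ae])
  then have "AE \<phi> in M. real_cond_exp M F (indicat_real {\<psi> \<in> colourings q V. restrict \<psi> U = restrict \<phi> U}) \<phi> = \<gamma> \<phi>"
    using AE_space
  proof eventually_elim
    case (elim \<phi>)
    note a = elim(1)
    have \<phi>: "\<phi> \<in> colourings q V" using elim(2) unfolding sp .
    have "restrict (restrict \<phi> U) D = restrict \<phi> D" using D(1) by (simp add: Int_absorb1)
    then have "\<phi> \<in> cyl q V D (restrict (restrict \<phi> U) D)" using \<phi> by (simp add: cyl_def)
    then have "real_cond_exp M F (indicat_real (cyl q V U (restrict \<phi> U))) \<phi> = \<gamma> (restrict \<phi> U)"
      using a restrict_colourings[OF \<phi> U(2)] by simp
    also have "\<dots> = \<gamma> \<phi>" unfolding \<gamma>_def by (rule finite_cond_prob_cong[OF U(2) refl, symmetric])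
    finally show ?case unfolding cyl_def .
  qed
  then show "AE \<phi> in M. real_cond_exp M (cylinder_algebra q V (V - inner_part V E U))
      (indicat_real {\<psi> \<in> colourings q V. restrict \<psi> U = restrict \<phi> U}) \<phi> = finite_cond_prob q w V E U \<phi>"
    unfolding F_def \<gamma>_def .
qed

end

section \<open>Broadcasting colours by independent increments modulo \<open>q\<close>\<close>

lemma mod_add_eq_iff:
  fixes a b q x :: nat
  assumes "a < q" "b < q"
  shows "(a + x) mod q = b \<longleftrightarrow> x mod q = (b + q - a) mod q"
proof
  assume "(a + x) mod q = b"
  then have "(b + (q - a)) mod q = ((a + x) mod q + (q - a)) mod q" by (simp only:)
  also have "\<dots> = (a + x + (q - a)) mod q" by (rule mod_add_left_eq)
  also have "a + x + (q - a) = x + q" using assms by simp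
  finally show "x mod q = (b + q - a) mod q" using assms by simp
next
  assume x: "x mod q = (b + q - a) mod q"
  have "(a + x) mod q = (a + x mod q) mod q" by (rule mod_add_right_eq[symmetric])
  also have "\<dots> = (a + (b + q - a)) mod q" unfolding x by (rule mod_add_right_eq)
  also have "a + (b + q - a) = b + q" using assms by simp
  finally show "(a + x) mod q = b" using assms by simp
qed

text \<open>A Gibbs measure is obtained by adding up independent increments modulo \<open>q\<close> along the paths from
  the root: the increment \<open>0\<close>, which repeats the colour of the parent, has weight \<open>w\<close>, and every
  other one has weight \<open>1\<close>.\<close>

definition increment_pmf :: "nat \<Rightarrow> real \<Rightarrow> nat pmf" where
  "increment_pmf q w = embed_pmf (\<lambda>j. if j < q then (if j = 0 then w else 1) / (real q - 1 + w) else 0)"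

lemma pmf_increment:
  assumes "q > 0" "w > 0"
  shows "pmf (increment_pmf q w) j = (if j < q then (if j = 0 then w else 1) / (real q - 1 + w) else 0)"
  unfolding increment_pmf_def
proof (rule pmf_embed_pmf)
  let ?f = "\<lambda>j::nat. if j < q then (if j = 0 then w else 1) / (real q - 1 + w) else 0"
  have den: "real q - 1 + w > 0" using assms by (simp add: add_nonneg_pos)
  then show nn: "0 \<le> ?f j" for j using assms by (auto intro: divide_nonneg_pos)
  obtain k where k: "q = Suc k" using assms by (cases q) auto
  have "(\<Sum>j<q. if j = 0 then w else 1) = real q - 1 + w"
    unfolding k sum.lessThan_Suc_shift by simp
  then have s: "(\<Sum>j<q. ?f j) = 1" using den by (simp flip: sum_divide_distrib)
  have "(\<integral>\<^sup>+j. ennreal (?f j) \<partial>count_space UNIV) = (\<Sum>j<q. ennreal (?f j))"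
    by (rule nn_integral_count_space') auto
  also have "\<dots> = ennreal (\<Sum>j<q. ?f j)" by (rule sum_ennreal) (rule nn)
  finally show "(\<integral>\<^sup>+j. ennreal (?f j) \<partial>count_space UNIV) = 1" unfolding s by simp
qed

text \<open>Sample points are arbitrary naturals, so events are phrased through residues; on the
  support a residue class is a single atom.\<close>

lemma measure_pmf_residue:
  fixes p :: "nat pmf"
  assumes "set_pmf p \<subseteq> {..<q}" "h < q"
  shows "measure (measure_pmf p) {x. x mod q = h} = pmf p h"
proof -
  have "{x. x mod q = h} \<inter> set_pmf p = {h} \<inter> set_pmf p"
  proof -
    have "x mod q = x" if "x \<in> set_pmf p" for x using subsetD[OF assms(1) that] by simp
    then show ?thesis using assms(2) by auto
  qed
  then have "measure (measure_pmf p) {x. x mod q = h} = measure (measure_pmf p) {h}"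
    using measure_Int_set_pmf[of p "{x. x mod q = h}"] measure_Int_set_pmf[of p "{h}"] by simp
  then show ?thesis by (simp add: pmf.rep_eq)
qed

context rooted_tree
begin

definition spin_pmf :: "nat \<Rightarrow> real \<Rightarrow> 'a \<Rightarrow> nat pmf" where
  "spin_pmf q w v = (if v = r then pmf_of_set {..<q} else increment_pmf q w)"

definition spin_space :: "nat \<Rightarrow> real \<Rightarrow> ('a \<Rightarrow> nat) measure" where
  "spin_space q w = PiM V (\<lambda>v. measure_pmf (spin_pmf q w v))"

text \<open>The counter makes the recursion along parents primitive. The value is meaningful at
  \<open>n = level v\<close>, when the recursion ends at the root.\<close>

primrec residue_along :: "nat \<Rightarrow> ('a \<Rightarrow> nat) \<Rightarrow> nat \<Rightarrow> 'a \<Rightarrow> nat" where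
  "residue_along q \<omega> 0 v = \<omega> r mod q"
| "residue_along q \<omega> (Suc n) v = (residue_along q \<omega> n (parent v) + \<omega> v) mod q"

text \<open>\<open>Suc\<close> shifts the residues from 0 to \<open>q - 1\<close> to the colours
  from 1 to \<open>q\<close>.\<close>

definition spin_colouring :: "nat \<Rightarrow> ('a \<Rightarrow> nat) \<Rightarrow> 'a \<Rightarrow> nat" where
  "spin_colouring q \<omega> = restrict (\<lambda>v. Suc (residue_along q \<omega> (level v) v)) V"

text \<open>The increment that the colouring \<open>\<sigma>\<close> forces at \<open>v\<close>;
  adding \<open>q\<close> first keeps the subtraction of naturals from truncating.\<close>

definition colour_step :: "nat \<Rightarrow> ('a \<Rightarrow> nat) \<Rightarrow> 'a \<Rightarrow> nat" where
  "colour_step q \<sigma> v = (if v = r then \<sigma> r - 1 else ((\<sigma> v - 1) + q - (\<sigma> (parent v) - 1)) mod q)"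

lemma residue_along_less: "q > 0 \<Longrightarrow> residue_along q \<omega> n v < q"
  by (cases n) auto

lemma root_in_tball: "r \<in> tball n"
  using root by (simp add: tball_def)

text \<open>Colours and increments determine each other level by level, so an event about a ball
  becomes a conjunction of conditions on single independent coordinates.\<close>

lemma spin_colouring_eq_iff:
  assumes q: "q > 0" and \<sigma>: "\<sigma> \<in> colourings q (tball n)"
  shows "restrict (spin_colouring q \<omega>) (tball n) = \<sigma> \<longleftrightarrow> (\<forall>v\<in>tball n. \<omega> v mod q = colour_step q \<sigma> v)"
proof -
  let ?f = "\<lambda>v. residue_along q \<omega> (level v) v"
  have col: "1 \<le> \<sigma> v" "\<sigma> v \<le> q" if "v \<in> tball n" for v
    using \<sigma> that by (auto simp: colourings_def PiE_def Pi_def)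
  have "restrict (spin_colouring q \<omega>) (tball n) = \<sigma> \<longleftrightarrow> (\<forall>v\<in>tball n. spin_colouring q \<omega> v = \<sigma> v)"
    using colourings_restrict_id[OF \<sigma>] by (metis restrict_apply' restrict_ext)
  also have "\<dots> \<longleftrightarrow> (\<forall>v\<in>tball n. ?f v = \<sigma> v - 1)"
  proof (rule ball_cong[OF refl])
    fix v assume v: "v \<in> tball n"
    then have "v \<in> V" using tball_subset by blast
    then have "spin_colouring q \<omega> v = Suc (?f v)" by (simp add: spin_colouring_def)
    then show "spin_colouring q \<omega> v = \<sigma> v \<longleftrightarrow> ?f v = \<sigma> v - 1" using col(1)[OF v] by auto
  qed
  also have "\<dots> \<longleftrightarrow> (\<forall>v\<in>tball n. \<omega> v mod q = colour_step q \<sigma> v)"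
  proof -
    have rt: "?f r = \<sigma> r - 1 \<longleftrightarrow> \<omega> r mod q = colour_step q \<sigma> r" by (simp add: colour_step_def)
    have st: "?f v = \<sigma> v - 1 \<longleftrightarrow> \<omega> v mod q = colour_step q \<sigma> v"
      if v: "v \<in> tball n" "v \<noteq> r" and p: "?f (parent v) = \<sigma> (parent v) - 1" for v
    proof -
      have vV: "v \<in> V" using v tball_subset by blast
      have pt: "parent v \<in> tball n" using parent_in_tball v by simp
      have "?f v = (\<sigma> (parent v) - 1 + \<omega> v) mod q"
        unfolding parent(2)[OF vV v(2)] residue_along.simps p ..
      moreover have "\<sigma> (parent v) - 1 < q" "\<sigma> v - 1 < q"
        using col[OF pt] col[OF v(1)] by auto
      ultimately show ?thesis using mod_add_eq_iff v(2) by (simp add: colour_step_def)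
    qed
    show ?thesis
    proof
      assume a: "\<forall>v\<in>tball n. ?f v = \<sigma> v - 1"
      show "\<forall>v\<in>tball n. \<omega> v mod q = colour_step q \<sigma> v"
      proof
        fix v assume v: "v \<in> tball n"
        show "\<omega> v mod q = colour_step q \<sigma> v"
        proof (cases "v = r")
          case True
          then show ?thesis using a v rt by blast
        next
          case False
          then have "parent v \<in> tball n" using parent_in_tball v by simp
          then show ?thesis using a st[OF v False] v by blast
        qed
      qed
    next
      assume a: "\<forall>v\<in>tball n. \<omega> v mod q = colour_step q \<sigma> v"
      have "v \<in> tball n \<Longrightarrow> level v = k \<Longrightarrow> ?f v = \<sigma> v - 1" for k v
      proof (induction k arbitrary: v)
        case 0
        then have "v = r" using level_0D tball_subset by blast
        then show ?case using a rt root_in_tball by blast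
      next
        case (Suc k)
        then have vr: "v \<noteq> r" by auto
        have vV: "v \<in> V" using Suc.prems tball_subset by blast
        have "parent v \<in> tball n" using parent_in_tball Suc.prems vr by simp
        moreover have "level (parent v) = k" using parent(2)[OF vV vr] Suc.prems by simp
        ultimately show ?case using st[OF Suc.prems(1) vr Suc.IH] a Suc.prems by blast
      qed
      then show "\<forall>v\<in>tball n. ?f v = \<sigma> v - 1" by blast
    qed
  qed
  finally show ?thesis .
qed

lemma spin_event:
  assumes q: "q > 0" and \<sigma>: "\<sigma> \<in> colourings q (tball n)"
  shows "spin_colouring q -` cyl q V (tball n) \<sigma> \<inter> space (spin_space q w)
    = {\<omega> \<in> space (spin_space q w). \<forall>v\<in>tball n. \<omega> v \<in> {x. x mod q = colour_step q \<sigma> v}}"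
proof -
  have "spin_colouring q \<omega> \<in> colourings q V" for \<omega>
    using residue_along_less[OF q] by (auto simp: spin_colouring_def colourings_def Suc_le_eq)
  then show ?thesis using spin_colouring_eq_iff[OF q \<sigma>] unfolding cyl_def by auto
qed

lemma spin_event_sets:
  assumes "S \<subseteq> V" "finite S"
  shows "{\<omega> \<in> space (spin_space q w). \<forall>v\<in>S. \<omega> v \<in> X v} \<in> sets (spin_space q w)"
  unfolding spin_space_def using assms
  by (intro sets.sets_Collect_finite_All sets_Collect_single) auto

text \<open>Every cylinder is a finite union of cylinders over a ball, and the preimages of those
  are described by \<open>spin_event\<close>.\<close>

lemma measurable_spin_colouring:
  assumes q: "q > 0"
  shows "spin_colouring q \<in> measurable (spin_space q w) (cylinder_algebra q V V)"
  unfolding cylinder_algebra_def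
proof (rule measurable_measure_of)
  show "spin_colouring q \<in> space (spin_space q w) \<rightarrow> colourings q V"
    using residue_along_less[OF q] by (auto simp: spin_colouring_def colourings_def Suc_le_eq)
  fix Y assume "Y \<in> {{\<psi> \<in> colourings q V. restrict \<psi> U = \<phi>} | U \<phi>. finite U \<and> U \<subseteq> V \<and> \<phi> \<in> colourings q U}"
  then obtain U \<phi> where U: "finite U" "U \<subseteq> V" and Y: "Y = cyl q V U \<phi>" unfolding cyl_def by blast
  obtain n where n: "U \<subseteq> tball n" using finite_subset_tball[OF U] by blast
  define T where "T = {\<tau> \<in> colourings q (tball n). restrict \<tau> U = \<phi>}"
  have "finite T" unfolding T_def using finite_colourings[OF finite_tball] by simp
  have "Y = (\<Union>\<tau>\<in>T. cyl q V (tball n) \<tau>)" unfolding Y T_def by (rule cyl_eq_Union[OF n tball_subset])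
  then have "spin_colouring q -` Y \<inter> space (spin_space q w)
      = (\<Union>\<tau>\<in>T. spin_colouring q -` cyl q V (tball n) \<tau> \<inter> space (spin_space q w))" by blast
  also have "\<dots> \<in> sets (spin_space q w)"
  proof (rule sets.finite_UN[OF \<open>finite T\<close>])
    fix \<tau> assume "\<tau> \<in> T"
    then have "\<tau> \<in> colourings q (tball n)" by (simp add: T_def)
    then show "spin_colouring q -` cyl q V (tball n) \<tau> \<inter> space (spin_space q w) \<in> sets (spin_space q w)"
      unfolding spin_event[OF q \<open>\<tau> \<in> colourings q (tball n)\<close>] by (intro spin_event_sets tball_subset finite_tball)
  qed
  finally show "spin_colouring q -` Y \<inter> space (spin_space q w) \<in> sets (spin_space q w)" .
qed auto

lemma gibbs_exists:
  assumes q: "q > 0" and w: "w > 0"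
  shows "\<exists>M. gibbs_measure q w V E M"
proof (intro exI)
  let ?P = "spin_space q w"
  define M where "M = distr ?P (cylinder_algebra q V V) (spin_colouring q)"
  interpret product_prob_space "\<lambda>v. measure_pmf (spin_pmf q w v)" V
    by (intro product_prob_spaceI measure_pmf.prob_space_axioms)
  have P: "prob_space ?P" unfolding spin_space_def by (rule prob_space_PiM) (rule measure_pmf.prob_space_axioms)
  have sp: "set_pmf (spin_pmf q w v) \<subseteq> {..<q}" for v
  proof (cases "v = r")
    case True
    then show ?thesis using q by (simp add: spin_pmf_def set_pmf_of_set lessThan_empty_iff)
  next
    case False
    then show ?thesis by (auto simp: spin_pmf_def set_pmf_iff pmf_increment[OF q w] split: if_splits)
  qed
  \<comment> \<open>The root is uniform, and every other vertex contributes the normalisation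
    \<open>q - 1 + w\<close> of its increment.\<close>
  define c where "c n = 1 / real q * (1 / (real q - 1 + w)) ^ card (tball n - {r})" for n
  show "gibbs_measure q w V E M"
  proof (rule gibbs_measureI[where C = c])
    show "prob_space M" unfolding M_def by (rule prob_space.prob_space_distr[OF P measurable_spin_colouring[OF q]])
    show "sets M = sets (cylinder_algebra q V V)" by (simp add: M_def)
    fix n \<sigma> assume \<sigma>: "\<sigma> \<in> colourings q (tball n)"
    have col: "1 \<le> \<sigma> v" "\<sigma> v \<le> q" if "v \<in> tball n" for v
      using \<sigma> that by (auto simp: colourings_def PiE_def Pi_def)
    have cs: "colour_step q \<sigma> v < q" if "v \<in> tball n" for v
      using q col[OF root_in_tball[of n]] by (auto simp: colour_step_def)
    have "measure M (cyl q V (tball n) \<sigma>)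
        = measure ?P (spin_colouring q -` cyl q V (tball n) \<sigma> \<inter> space ?P)"
      unfolding M_def
      by (rule measure_distr[OF measurable_spin_colouring[OF q]]) (intro cyl_sets finite_tball tball_subset \<sigma>)
    also have "\<dots> = (\<Prod>v\<in>tball n. measure (measure_pmf (spin_pmf q w v)) {x. x mod q = colour_step q \<sigma> v})"
      unfolding spin_event[OF q \<sigma>] unfolding spin_space_def
    proof (rule measure_eq_emeasure_eq_ennreal)
      show "0 \<le> (\<Prod>v\<in>tball n. measure (measure_pmf (spin_pmf q w v)) {x. x mod q = colour_step q \<sigma> v})"
        by (intro prod_nonneg measure_nonneg)
    qed (subst emeasure_PiM_Collect[OF tball_subset finite_tball],
        auto simp: measure_pmf.emeasure_eq_measure prod_ennreal)
    also have "\<dots> = (\<Prod>v\<in>tball n. pmf (spin_pmf q w v) (colour_step q \<sigma> v))"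
      by (intro prod.cong refl measure_pmf_residue sp cs)
    also have "\<dots> = pmf (spin_pmf q w r) (colour_step q \<sigma> r) * (\<Prod>v\<in>tball n - {r}. pmf (spin_pmf q w v) (colour_step q \<sigma> v))"
      by (rule prod.remove[OF finite_tball root_in_tball])
    also have "pmf (spin_pmf q w r) (colour_step q \<sigma> r) = 1 / real q"
      using q cs[OF root_in_tball] by (simp add: spin_pmf_def lessThan_empty_iff)
    also have "(\<Prod>v\<in>tball n - {r}. pmf (spin_pmf q w v) (colour_step q \<sigma> v))
        = (\<Prod>v\<in>tball n - {r}. (if \<sigma> v = \<sigma> (parent v) then w else 1) * (1 / (real q - 1 + w)))"
    proof (rule prod.cong[OF refl])
      fix v assume v: "v \<in> tball n - {r}"
      have lt: "\<sigma> (parent v) - 1 < q" "\<sigma> v - 1 < q"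
        using col[OF parent_in_tball[OF v]] col[of v] v by auto
      have "colour_step q \<sigma> v = 0 \<longleftrightarrow> \<sigma> (parent v) - 1 = \<sigma> v - 1"
        using mod_add_eq_iff[OF lt, of 0] v lt by (auto simp: colour_step_def)
      also have "\<dots> \<longleftrightarrow> \<sigma> v = \<sigma> (parent v)" using col[OF parent_in_tball[OF v]] col[of v] v by auto
      finally show "pmf (spin_pmf q w v) (colour_step q \<sigma> v)
          = (if \<sigma> v = \<sigma> (parent v) then w else 1) * (1 / (real q - 1 + w))"
        using v cs[of v] by (simp add: spin_pmf_def pmf_increment[OF q w])
    qed
    also have "\<dots> = potts_weight w (induced_edges E (tball n)) \<sigma> * (1 / (real q - 1 + w)) ^ card (tball n - {r})"
      unfolding potts_weight_tball prod.distrib prod_constant ..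
    finally show "measure M (cyl q V (tball n) \<sigma>) = c n * potts_weight w (induced_edges E (tball n)) \<sigma>"
      by (simp only: c_def mult_ac)
  qed (rule w)
qed

end

theorem theorem3p8:
  fixes q d :: nat and w :: real and V :: "'a set" and E :: "'a set set"
  assumes "q \<in> {3, 4}"
    and "q = 3 \<longrightarrow> d \<ge> 2"
    and "q = 4 \<longrightarrow> d \<ge> 4"
    and "1 - real q / (real d + 1) \<le> w" and "w < 1" and "w > 0"
    and "infinite_regular_tree (d + 1) V E"
  shows "\<exists>!M. gibbs_measure q w V E M"
proof -
  obtain r where "r \<in> V"
    using assms(7) unfolding infinite_regular_tree_def tree_graph_def connected_graph_def by blast
  moreover have "d \<ge> 1" using assms(1-3) by auto
  ultimately interpret rooted_tree V E d r using assms(7) by unfold_locales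
  obtain I a c where L: "lyapunov q d w I a c"
  proof (cases "q = 3 \<and> d = 2")
    case True
    then show ?thesis using lyapunov_cubic[OF assms(5,6)] that by auto
  next
    case False
    then have "d \<ge> q" using assms(1-3) by auto
    then show ?thesis using lyapunov_power assms(1,4-6) that by blast
  qed
  have q: "q > 0" using assms(1) by auto
  obtain M where M: "gibbs_measure q w V E M" using gibbs_exists[OF q assms(6)] by blast
  then show ?thesis using gibbs_unique[OF _ _ L q assms(6,5)] by blast
qed

end
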